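(* Let $T>0$ and let $s\in\mathbb{R}$. Assume that $a\in\mathcal{C}^\alpha([0,T])$ with $0<\alpha<1$ satisfies $\inf_{t\in[0,T]}a(t)=a_0>0$ and that $q\in L^\infty([0,T])$ is real-valued. Let $f\in C([0,T];\gamma^s_{\mathcal{H}})$. If $v_0,v_1\in\gamma^s_{\mathcal{H}}$, then the Cauchy problem $$\partial_t^2 v(t,x)+a(t)\mathcal{H}v(t,x)+q(t)v(t,x)=f(t,x),\quad (t,x)\in[0,T]\times\mathbb{R}^n,$$ $$v(0,x)=v_0(x),\qquad \partial_t v(0,x)=v_1(x),\quad x\in\mathbb{R}^n,$$ has a unique solution $v\in C^2([0,T];\gamma^s_{\mathcal{H}})$ provided that $$1\le s<1+\frac{\alpha}{1-\alpha}.$$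
   Context: The operator $\mathcal{H}$. Let $V$ be a complex potential on $\mathbb{R}^n$ and let $\mathcal{H}_0=-\Delta+V$ be a densely defined Schrödinger operator on $L^2(\mathbb{R}^n)$ with purely discrete spectrum (empty essential spectrum) $\{\lambda_\xi\in\mathbb{C}:\xi\in\mathcal{I}\}$, $\mathcal{I}$ an ordered countable set, whose corresponding eigenfunctions $\{u_\xi\}_{\xi\in\mathcal{I}}$ form a Riesz basis of $L^2(\mathbb{R}^n)$. Let $\{v_\xi\}_{\xi\in\mathcal{I}}$ be the biorthogonal system, $\int_{\mathbb{R}^n}u_\xi\overline{v_\eta}\,dx=\delta_{\xi\eta}$. Then $\mathcal{H}:=|\mathcal{H}_0|$ denotes the operator with $\mathcal{H}u_\xi=|\lambda_\xi|u_\xi$ for every $\xi$ (this is not the absolute value in the operator-theoretic sense). If some $\lambda_\xi=0$, one instead fixes $c>0$ and lets $\mathcal{H}$ be the operator with eigenvalue $|\lambda_\xi|+c$ on each $u_\xi$. Write $\mu_\xi>0$ for the eigenvalue of $\mathcal{H}$ on $u_\xi$, and $\langle\xi\rangle:=(1+|\lambda_\xi|)^{1/2}$. The $\mathcal{H}$-Fourier transform is $\widehat f(\xi)=\int_{\mathbb{R}^n}f(x)\overline{v_\xi(x)}\,dx$, so that $f=\sum_\xi\widehat f(\xi)u_\xi$. Gevrey spaces. For real $s\ge1$, the (Roumieu) Gevrey space $\gamma^s_{\mathcal{H}}$ consists of all $f$ for which there exists $A>0$ with $\sum_{\xi\in\mathcal{I}}e^{2A\langle\xi\rangle^{1/s}}|\widehat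 f(\xi)|^2<\infty$. It is the union over $A>0$ of the Hilbert spaces given by this sum, with the inductive limit topology. For $\alpha>0$ (here $0<\alpha<1$), $a\in\mathcal{C}^\alpha([0,T])$ means there is $M_a>0$ with $|a(t)-a(t')|\le M_a|t-t'|^\alpha$ for all $t,t'\in[0,T]$. Solutions of the equation are understood after $\mathcal{H}$-Fourier transform in $x$: for every $\xi\in\mathcal{I}$, $\partial_t^2\widehat v+a(t)\mu_\xi\widehat v+q(t)\widehat v=\widehat f$ in $t$ with the transformed initial data.
   Formalization: For q in L^∞ that jumps, v in C^2([0,T];γ^s) can fail; instead v is the unique solution in W^{2,∞}([0,T];γ^s) (C^1 in t, v' a primitive of a bounded v''), equation for a.e. t; v is C^2 with the equation for all t when q has a continuous representative. *)

theory Defs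
  imports "HOL-Analysis.Analysis"
begin

text \<open>
  Elements of $L^2$ are represented by functions; equality in $L^2$ is equality almost
  everywhere, and every notion below is invariant under it.
\<close>

definition L2 :: "(real ^ 'n \<Rightarrow> complex) set" where
  "L2 = {f. f \<in> borel_measurable lebesgue \<and> integrable lebesgue (\<lambda>x. (cmod (f x))\<^sup>2)}"

definition L2_norm :: "(real ^ 'n \<Rightarrow> complex) \<Rightarrow> real" where
  "L2_norm f = sqrt (integral\<^sup>L lebesgue (\<lambda>x. (cmod (f x))\<^sup>2))"


section \<open>The operator \<open>-\<Delta> + V\<close>\<close>

definition partial_deriv :: "'n \<Rightarrow> (real ^ 'n \<Rightarrow> complex) \<Rightarrow> real ^ 'n \<Rightarrow> complex" where
  "partial_deriv i \<phi> x = frechet_derivative \<phi> (at x) (axis i 1)"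

definition laplacian :: "(real ^ 'n \<Rightarrow> complex) \<Rightarrow> real ^ 'n \<Rightarrow> complex" where
  "laplacian \<phi> x = (\<Sum>i\<in>UNIV. partial_deriv i (partial_deriv i \<phi>) x)"

definition test_function :: "(real ^ 'n \<Rightarrow> complex) \<Rightarrow> bool" where
  "test_function \<phi> \<longleftrightarrow>
     (\<forall>is. (foldr partial_deriv is \<phi>) differentiable_on UNIV) \<and>
     (\<exists>K. compact K \<and> (\<forall>x. x \<notin> K \<longrightarrow> \<phi> x = 0))"

text \<open>
  \<open>schroedinger_eq V f g\<close>: the identity \<open>-\<Delta>f + V f = g\<close> in the sense of distributions,
  with \<open>f, g\<close> in $L^2$ and \<open>V f\<close> locally integrable.  It determines \<open>g\<close> up to null sets, so an
  $L^2$ realisation of \<open>-\<Delta> + V\<close> is fixed by its domain \<open>D\<close>, and below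
  \<open>schroedinger_eq V f g\<close> with \<open>f \<in> D\<close> expresses that the operator maps \<open>f\<close> to \<open>g\<close>.
\<close>

definition schroedinger_eq ::
    "(real ^ 'n \<Rightarrow> complex) \<Rightarrow> (real ^ 'n \<Rightarrow> complex) \<Rightarrow> (real ^ 'n \<Rightarrow> complex) \<Rightarrow> bool" where
  "schroedinger_eq V f g \<longleftrightarrow>
     f \<in> L2 \<and> g \<in> L2 \<and>
     (\<forall>K. compact K \<longrightarrow> set_integrable lebesgue K (\<lambda>x. V x * f x)) \<and>
     (\<forall>\<phi>. test_function \<phi> \<longrightarrow>
        integral\<^sup>L lebesgue (\<lambda>x. g x * \<phi> x) =
        integral\<^sup>L lebesgue (\<lambda>x. - (f x * laplacian \<phi> x) + V x * f x * \<phi> x))"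

definition schroedinger_operator ::
    "(real ^ 'n \<Rightarrow> complex) \<Rightarrow> (real ^ 'n \<Rightarrow> complex) set \<Rightarrow> bool" where
  "schroedinger_operator V D \<longleftrightarrow>
     V \<in> borel_measurable lebesgue \<and>
     D \<subseteq> L2 \<and>
     (\<forall>f\<in>D. \<forall>g\<in>L2. (AE x in lebesgue. f x = g x) \<longrightarrow> g \<in> D) \<and>
     (\<lambda>x. 0) \<in> D \<and>
     (\<forall>f\<in>D. \<forall>g\<in>D. \<forall>b c. (\<lambda>x. b * f x + c * g x) \<in> D) \<and>
     (\<forall>f\<in>L2. \<forall>e>0. \<exists>g\<in>D. L2_norm (\<lambda>x. f x - g x) < e) \<and>
     (\<forall>f\<in>D. \<exists>g. schroedinger_eq V f g)"

text \<open>The equation \<open>H\<^sub>0 f - z f = g\<close> is written as \<open>H\<^sub>0 f = g + z f\<close>.\<close>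

definition resolvent_set ::
    "(real ^ 'n \<Rightarrow> complex) \<Rightarrow> (real ^ 'n \<Rightarrow> complex) set \<Rightarrow> complex set" where
  "resolvent_set V D = {z.
     (\<forall>g\<in>L2. \<exists>f\<in>D. schroedinger_eq V f (\<lambda>x. g x + z * f x)) \<and>
     (\<exists>C. \<forall>f\<in>D. \<forall>g. schroedinger_eq V f (\<lambda>x. g x + z * f x) \<longrightarrow> L2_norm f \<le> C * L2_norm g)}"

definition op_spectrum ::
    "(real ^ 'n \<Rightarrow> complex) \<Rightarrow> (real ^ 'n \<Rightarrow> complex) set \<Rightarrow> complex set" where
  "op_spectrum V D = - resolvent_set V D"

definition op_range ::
    "(real ^ 'n \<Rightarrow> complex) \<Rightarrow> (real ^ 'n \<Rightarrow> complex) set \<Rightarrow> complex \<Rightarrow> (real ^ 'n \<Rightarrow> complex) set"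
  where
  "op_range V D z = {g \<in> L2. \<exists>f\<in>D. schroedinger_eq V f (\<lambda>x. g x + z * f x)}"

text \<open>
  \<open>H\<^sub>0 - z\<close> is Fredholm: finite-dimensional kernel, closed range, range of finite codimension.
\<close>

definition fredholm_at ::
    "(real ^ 'n \<Rightarrow> complex) \<Rightarrow> (real ^ 'n \<Rightarrow> complex) set \<Rightarrow> complex \<Rightarrow> bool" where
  "fredholm_at V D z \<longleftrightarrow>
     (\<exists>S. finite S \<and> S \<subseteq> L2 \<and>
        (\<forall>f\<in>D. schroedinger_eq V f (\<lambda>x. z * f x) \<longrightarrow>
           (\<exists>c. AE x in lebesgue. f x = (\<Sum>h\<in>S. c h * h x)))) \<and>
     (\<forall>g\<in>L2. (\<forall>e>0. \<exists>r\<in>op_range V D z. L2_norm (\<lambda>x. g x - r x) < e) \<longrightarrow> g \<in> op_range V D z) \<and>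
     (\<exists>S. finite S \<and> S \<subseteq> L2 \<and>
        (\<forall>g\<in>L2. \<exists>c. (\<lambda>x. g x - (\<Sum>h\<in>S. c h * h x)) \<in> op_range V D z))"

definition ess_spectrum ::
    "(real ^ 'n \<Rightarrow> complex) \<Rightarrow> (real ^ 'n \<Rightarrow> complex) set \<Rightarrow> complex set" where
  "ess_spectrum V D = {z. \<not> fredholm_at V D z}"


section \<open>Riesz bases and the Fourier transform of the operator\<close>

definition riesz_basis :: "'i set \<Rightarrow> ('i \<Rightarrow> real ^ 'n \<Rightarrow> complex) \<Rightarrow> bool" where
  "riesz_basis I u \<longleftrightarrow>
     (\<forall>\<xi>\<in>I. u \<xi> \<in> L2) \<and>
     (\<forall>f\<in>L2. \<forall>e>0. \<exists>F c. finite F \<and> F \<subseteq> I \<and> L2_norm (\<lambda>x. f x - (\<Sum>\<xi>\<in>F. c \<xi> * u \<xi> x)) < e) \<and>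
     (\<exists>A>0. \<exists>B>0. \<forall>F c. finite F \<longrightarrow> F \<subseteq> I \<longrightarrow>
        A * (\<Sum>\<xi>\<in>F. (cmod (c \<xi>))\<^sup>2) \<le> (L2_norm (\<lambda>x. \<Sum>\<xi>\<in>F. c \<xi> * u \<xi> x))\<^sup>2 \<and>
        (L2_norm (\<lambda>x. \<Sum>\<xi>\<in>F. c \<xi> * u \<xi> x))\<^sup>2 \<le> B * (\<Sum>\<xi>\<in>F. (cmod (c \<xi>))\<^sup>2))"

definition biorthogonal_system ::
    "'i set \<Rightarrow> ('i \<Rightarrow> real ^ 'n \<Rightarrow> complex) \<Rightarrow> ('i \<Rightarrow> real ^ 'n \<Rightarrow> complex) \<Rightarrow> bool" where
  "biorthogonal_system I u d \<longleftrightarrow>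
     (\<forall>\<xi>\<in>I. d \<xi> \<in> L2) \<and>
     (\<forall>\<xi>\<in>I. \<forall>\<eta>\<in>I. integral\<^sup>L lebesgue (\<lambda>x. u \<xi> x * cnj (d \<eta> x)) = (if \<xi> = \<eta> then 1 else 0))"

definition hfourier ::
    "('i \<Rightarrow> real ^ 'n \<Rightarrow> complex) \<Rightarrow> (real ^ 'n \<Rightarrow> complex) \<Rightarrow> 'i \<Rightarrow> complex" where
  "hfourier d f \<xi> = integral\<^sup>L lebesgue (\<lambda>x. f x * cnj (d \<xi> x))"

definition bracket :: "('i \<Rightarrow> complex) \<Rightarrow> 'i \<Rightarrow> real" where
  "bracket lam \<xi> = (1 + cmod (lam \<xi>)) powr (1/2)"

text \<open>Eigenvalues of \<open>H = |H\<^sub>0|\<close>, shifted by \<open>c\<close> exactly when \<open>0\<close> is an eigenvalue of \<open>H\<^sub>0\<close>.\<close>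

definition abs_eigenvalue :: "'i set \<Rightarrow> ('i \<Rightarrow> complex) \<Rightarrow> real \<Rightarrow> 'i \<Rightarrow> real" where
  "abs_eigenvalue I lam c \<xi> =
     (if \<exists>\<eta>\<in>I. lam \<eta> = 0 then cmod (lam \<xi>) + c else cmod (lam \<xi>))"


section \<open>Gevrey spaces with their inductive limit topology\<close>

definition gevrey_step ::
    "'i set \<Rightarrow> ('i \<Rightarrow> complex) \<Rightarrow> ('i \<Rightarrow> real ^ 'n \<Rightarrow> complex) \<Rightarrow> real \<Rightarrow> real
       \<Rightarrow> (real ^ 'n \<Rightarrow> complex) set" where
  "gevrey_step I lam d s A = {f \<in> L2.
     (\<lambda>\<xi>. exp (2 * A * bracket lam \<xi> powr (1/s)) * (cmod (hfourier d f \<xi>))\<^sup>2) summable_on I}"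

definition gevrey_norm ::
    "'i set \<Rightarrow> ('i \<Rightarrow> complex) \<Rightarrow> ('i \<Rightarrow> real ^ 'n \<Rightarrow> complex) \<Rightarrow> real \<Rightarrow> real
       \<Rightarrow> (real ^ 'n \<Rightarrow> complex) \<Rightarrow> real" where
  "gevrey_norm I lam d s A f =
     sqrt (\<Sum>\<^sub>\<infinity>\<xi>\<in>I. exp (2 * A * bracket lam \<xi> powr (1/s)) * (cmod (hfourier d f \<xi>))\<^sup>2)"

definition gevrey ::
    "'i set \<Rightarrow> ('i \<Rightarrow> complex) \<Rightarrow> ('i \<Rightarrow> real ^ 'n \<Rightarrow> complex) \<Rightarrow> real
       \<Rightarrow> (real ^ 'n \<Rightarrow> complex) set" where
  "gevrey I lam d s = (\<Union>A\<in>{0<..}. gevrey_step I lam d s A)"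

text \<open>
  The inductive limit topology is the finest locally convex topology making all inclusions of
  the Hilbert spaces \<open>gevrey_step I lam d s A\<close> continuous.  A base of its neighbourhoods of \<open>0\<close>
  is given by the absolutely convex sets whose trace on each step is a neighbourhood of \<open>0\<close>.
\<close>

definition gevrey_nhd ::
    "'i set \<Rightarrow> ('i \<Rightarrow> complex) \<Rightarrow> ('i \<Rightarrow> real ^ 'n \<Rightarrow> complex) \<Rightarrow> real
       \<Rightarrow> (real ^ 'n \<Rightarrow> complex) set \<Rightarrow> bool" where
  "gevrey_nhd I lam d s W \<longleftrightarrow>
     W \<subseteq> gevrey I lam d s \<and>
     (\<forall>f\<in>W. \<forall>g\<in>W. \<forall>b c. cmod b + cmod c \<le> 1 \<longrightarrow> (\<lambda>x. b * f x + c * g x) \<in> W) \<and>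
     (\<forall>A>0. \<exists>r>0. \<forall>f\<in>gevrey_step I lam d s A. gevrey_norm I lam d s A f < r \<longrightarrow> f \<in> W)"

definition gevrey_topology ::
    "'i set \<Rightarrow> ('i \<Rightarrow> complex) \<Rightarrow> ('i \<Rightarrow> real ^ 'n \<Rightarrow> complex) \<Rightarrow> real
       \<Rightarrow> (real ^ 'n \<Rightarrow> complex) topology" where
  "gevrey_topology I lam d s = topology (\<lambda>U.
     U \<subseteq> gevrey I lam d s \<and>
     (\<forall>f\<in>U. \<exists>W. gevrey_nhd I lam d s W \<and> (\<forall>h\<in>W. (\<lambda>x. f x + h x) \<in> U)))"

lemma gevrey_nhd_Int:
  assumes "gevrey_nhd I lam d s W" "gevrey_nhd I lam d s W'"
  shows "gevrey_nhd I lam d s (W \<inter> W')"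
  unfolding gevrey_nhd_def
proof (intro conjI allI impI ballI)
  show "W \<inter> W' \<subseteq> gevrey I lam d s"
    using assms unfolding gevrey_nhd_def by blast
next
  fix f g b c assume "f \<in> W \<inter> W'" "g \<in> W \<inter> W'" "cmod b + cmod c \<le> 1"
  then show "(\<lambda>x. b * f x + c * g x) \<in> W \<inter> W'"
    using assms unfolding gevrey_nhd_def by simp
next
  fix A :: real assume A: "A > 0"
  obtain r where r: "r > 0" "\<forall>f\<in>gevrey_step I lam d s A. gevrey_norm I lam d s A f < r \<longrightarrow> f \<in> W"
    using assms(1) A unfolding gevrey_nhd_def by blast
  obtain r' where r': "r' > 0"
      "\<forall>f\<in>gevrey_step I lam d s A. gevrey_norm I lam d s A f < r' \<longrightarrow> f \<in> W'"
    using assms(2) A unfolding gevrey_nhd_def by blast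
  show "\<exists>r>0. \<forall>f\<in>gevrey_step I lam d s A. gevrey_norm I lam d s A f < r \<longrightarrow> f \<in> W \<inter> W'"
    using r r' by (intro exI[of _ "min r r'"]) auto
qed

lemma openin_gevrey_topology:
  "openin (gevrey_topology I lam d s) U \<longleftrightarrow>
     U \<subseteq> gevrey I lam d s \<and>
     (\<forall>f\<in>U. \<exists>W. gevrey_nhd I lam d s W \<and> (\<forall>h\<in>W. (\<lambda>x. f x + h x) \<in> U))"
proof -
  let ?P = "\<lambda>U. U \<subseteq> gevrey I lam d s \<and>
     (\<forall>f\<in>U. \<exists>W. gevrey_nhd I lam d s W \<and> (\<forall>h\<in>W. (\<lambda>x. f x + h x) \<in> U))"
  have "istopology ?P"
    unfolding istopology_def
  proof (intro conjI allI impI)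
    fix S T assume S: "?P S" and T: "?P T"
    show "S \<inter> T \<subseteq> gevrey I lam d s" using S by blast
    show "\<forall>f\<in>S \<inter> T. \<exists>W. gevrey_nhd I lam d s W \<and> (\<forall>h\<in>W. (\<lambda>x. f x + h x) \<in> S \<inter> T)"
    proof
      fix f assume f: "f \<in> S \<inter> T"
      obtain W where "gevrey_nhd I lam d s W" "\<forall>h\<in>W. (\<lambda>x. f x + h x) \<in> S"
        using S f by blast
      moreover obtain W' where "gevrey_nhd I lam d s W'" "\<forall>h\<in>W'. (\<lambda>x. f x + h x) \<in> T"
        using T f by blast
      ultimately show "\<exists>W. gevrey_nhd I lam d s W \<and> (\<forall>h\<in>W. (\<lambda>x. f x + h x) \<in> S \<inter> T)"
        using gevrey_nhd_Int by (intro exI[of _ "W \<inter> W'"]) auto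
    qed
  next
    fix K assume K: "\<forall>U\<in>K. ?P U"
    show "\<Union>K \<subseteq> gevrey I lam d s" using K by blast
    show "\<forall>f\<in>\<Union>K. \<exists>W. gevrey_nhd I lam d s W \<and> (\<forall>h\<in>W. (\<lambda>x. f x + h x) \<in> \<Union>K)"
      using K by (meson UnionE UnionI)
  qed
  then show ?thesis
    unfolding gevrey_topology_def by (simp add: topology_inverse')
qed


section \<open>Time-dependent functions and solutions\<close>

text \<open>
  \<open>G\<close> stands for a vector space topology on a space of functions of \<open>x\<close>.
  Derivatives at the end points of \<open>[0,T]\<close> are one-sided.
\<close>

definition time_continuous ::
    "real \<Rightarrow> (real ^ 'n \<Rightarrow> complex) topology \<Rightarrow> (real \<Rightarrow> real ^ 'n \<Rightarrow> complex) \<Rightarrow> bool" where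
  "time_continuous T G v \<longleftrightarrow> continuous_map (top_of_set {0..T}) G v"

definition has_time_derivative ::
    "real \<Rightarrow> (real ^ 'n \<Rightarrow> complex) topology \<Rightarrow> (real \<Rightarrow> real ^ 'n \<Rightarrow> complex)
       \<Rightarrow> (real \<Rightarrow> real ^ 'n \<Rightarrow> complex) \<Rightarrow> bool" where
  "has_time_derivative T G v v' \<longleftrightarrow>
     (\<forall>t\<in>{0..T}. limitin G (\<lambda>\<tau> x. (v \<tau> x - v t x) / of_real (\<tau> - t)) (v' t) (at t within {0..T}))"

definition bounded_in ::
    "(real ^ 'n \<Rightarrow> complex) topology \<Rightarrow> (real ^ 'n \<Rightarrow> complex) set \<Rightarrow> bool" where
  "bounded_in G B \<longleftrightarrow>
     B \<subseteq> topspace G \<and>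
     (\<forall>U. openin G U \<and> (\<lambda>x. 0) \<in> U \<longrightarrow> (\<exists>r>0. \<forall>f\<in>B. (\<lambda>x. f x / of_real r) \<in> U))"

text \<open>
  Classical solutions: \<open>v \<in> C\<^sup>2([0,T]; G)\<close> and the transformed equation holds for every \<open>t\<close>.
\<close>

definition classical_solution where
  "classical_solution I d \<mu> T G (a :: real \<Rightarrow> real) (q :: real \<Rightarrow> real) f v\<^sub>0 v\<^sub>1 v \<longleftrightarrow>
     (\<exists>v' v''.
        time_continuous T G v \<and> time_continuous T G v' \<and> time_continuous T G v'' \<and>
        has_time_derivative T G v v' \<and> has_time_derivative T G v' v'' \<and>
        (\<forall>\<xi>\<in>I. \<forall>t\<in>{0..T}.
           hfourier d (v'' t) \<xi> + of_real (a t) * of_real (\<mu> \<xi>) * hfourier d (v t) \<xi>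
             + of_real (q t) * hfourier d (v t) \<xi> = hfourier d (f t) \<xi>) \<and>
        (\<forall>\<xi>\<in>I. hfourier d (v 0) \<xi> = hfourier d v\<^sub>0 \<xi> \<and> hfourier d (v' 0) \<xi> = hfourier d v\<^sub>1 \<xi>))"

text \<open>
  Strong solutions: the same with $C^2$ replaced by $W^{2,\infty}$, that is,
  \<open>v \<in> C\<^sup>1([0,T]; G)\<close>, the derivative \<open>v'\<close> is the primitive of a bounded function \<open>v''\<close>, and the
  transformed equation holds for almost every \<open>t\<close>.  If \<open>q\<close> is merely essentially bounded, then
  \<open>v'' = f - a H v - q v\<close> jumps where \<open>q\<close> does (unless \<open>v\<close> vanishes there), so that no
  solution need be of class $C^2$.
\<close>

definition strong_solution where
  "strong_solution I d \<mu> T G (a :: real \<Rightarrow> real) (q :: real \<Rightarrow> real) f v\<^sub>0 v\<^sub>1 v \<longleftrightarrow>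
     (\<exists>v' v''.
        time_continuous T G v \<and> time_continuous T G v' \<and> bounded_in G (v'' ` {0..T}) \<and>
        has_time_derivative T G v v' \<and>
        (\<forall>\<xi>\<in>I. \<forall>t\<in>{0..T}.
           ((\<lambda>\<tau>. hfourier d (v'' \<tau>) \<xi>) has_integral (hfourier d (v' t) \<xi> - hfourier d (v' 0) \<xi>)) {0..t}) \<and>
        (\<forall>\<xi>\<in>I. AE t in lebesgue_on {0..T}.
           hfourier d (v'' t) \<xi> + of_real (a t) * of_real (\<mu> \<xi>) * hfourier d (v t) \<xi>
             + of_real (q t) * hfourier d (v t) \<xi> = hfourier d (f t) \<xi>) \<and>
        (\<forall>\<xi>\<in>I. hfourier d (v 0) \<xi> = hfourier d v\<^sub>0 \<xi> \<and> hfourier d (v' 0) \<xi> = hfourier d v\<^sub>1 \<xi>))"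

definition hoelder_on :: "real \<Rightarrow> real \<Rightarrow> (real \<Rightarrow> real) \<Rightarrow> bool" where
  "hoelder_on T \<alpha> a \<longleftrightarrow> (\<exists>M>0. \<forall>t\<in>{0..T}. \<forall>t'\<in>{0..T}. \<bar>a t - a t'\<bar> \<le> M * \<bar>t - t'\<bar> powr \<alpha>)"

definition Linfty_on :: "real \<Rightarrow> (real \<Rightarrow> real) \<Rightarrow> bool" where
  "Linfty_on T q \<longleftrightarrow>
     q \<in> borel_measurable (lebesgue_on {0..T}) \<and> (\<exists>B. AE t in lebesgue_on {0..T}. \<bar>q t\<bar> \<le> B)"

end

theory Submission
  imports Defs
begin

text \<open>
  After the transform the problem splits into one ordinary differential equation
  $y'' + (a(t) \mu_\xi + q(t)) y = F_\xi(t)$ for each frequency \<open>\<xi>\<close>.  Each of them is solvable, so the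
  theorem is about the size of \<open>y\<close> as \<open>\<xi>\<close> varies.  Three ideas carry the proof.

  \<^bold>\<open>An energy with a frequency-dependent regularisation of \<open>a\<close>.\<close>  The function \<open>a\<close> is only Hoelder
  continuous, so the natural energy \<open>|y'|\<^sup>2 + a \<mu> |y|\<^sup>2\<close> cannot be differentiated.  Replacing \<open>a\<close> by its
  mean \<open>b\<close> over an interval of length \<open>1/L\<close>, with $L = \sqrt{1+\mu_\xi}$, costs an error
  \<open>|b - a| = O(L powr -\<alpha>)\<close> and leaves a derivative \<open>|b'| = O(L powr (1 - \<alpha>))\<close>; with this choice of
  scale both contribute \<open>O(L powr (1 - \<alpha>))\<close> to the logarithmic derivative of
  \<open>|y'|\<^sup>2 + b L\<^sup>2 |y|\<^sup>2\<close>.  Hence, up to powers of \<open>L\<close>, \<open>y\<close> exceeds its data by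
  at most a factor \<open>exp (C * L powr (1 - \<alpha>))\<close> (\<open>energy_estimate\<close>).  As \<open>q\<close> is merely bounded, \<open>y'\<close> is only a primitive
  and the energy need not be differentiable; it is compared at each time with a differentiable
  function touching it from above (\<open>nonincreasing_via_upper_barriers\<close>), which is all that a
  Gronwall argument requires.

  \<^bold>\<open>Absorbing the loss.\<close>  The bound on \<open>s\<close> says exactly that \<open>1 - \<alpha> < 1/s\<close>.  Since \<open>L\<close> is comparable
  with \<open>\<langle>\<xi>\<rangle>\<close>, the loss, and any power of \<open>\<langle>\<xi>\<rangle>\<close>, is below \<open>C * exp (\<delta> * \<langle>\<xi>\<rangle> powr (1/s))\<close> for every
  \<open>\<delta> > 0\<close> (\<open>mode_bound\<close>, \<open>mu_absorbed\<close>).  So data and force in the step with exponent \<open>A\<close> give a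
  solution in the step with exponent \<open>A - \<delta>\<close>.

  \<^bold>\<open>Working in a single step.\<close>  Continuity of the force refers to the inductive limit topology.  A
  continuous curve in it is bounded in one step, and continuous in every smaller one
  (\<open>time_continuous_step_bounded\<close>, \<open>time_continuous_step_continuous\<close>); the seminorms that prove this
  are weighted square sums whose weight grows more slowly than every
  \<open>exp (A * \<langle>\<xi>\<rangle> powr (1/s))\<close>.  Conversely, convergence in a step implies convergence in the limit.
  Continuity and differentiability of the solution are therefore statements about weighted square
  sums of coefficients, and follow from a Minkowski inequality for integrals (\<open>wl2_le_integral\<close>).
  Riesz bases enter only through the facts that the transform is injective on $L^2$ and maps onto the
  square-summable families (\<open>hfourier_injective\<close>, \<open>hfourier_surjective\<close>).
\<close>

section \<open>Riesz bases and the transform\<close>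

lemma L2_integrable: "f \<in> L2 \<Longrightarrow> integrable lebesgue (\<lambda>x. (cmod (f x))\<^sup>2)"
  by (auto simp: L2_def)

lemma L2_norm_power2: "(L2_norm f)\<^sup>2 = integral\<^sup>L lebesgue (\<lambda>x. (cmod (f x))\<^sup>2)"
  by (simp add: L2_norm_def)

lemma L2_norm_nonneg: "0 \<le> L2_norm f"
  by (simp add: L2_norm_def)

lemma cmod_add_power2_le: "(cmod (x + y))\<^sup>2 \<le> 2 * (cmod x)\<^sup>2 + 2 * (cmod y)\<^sup>2"
proof -
  have "(cmod (x + y))\<^sup>2 \<le> (cmod x + cmod y)\<^sup>2"
    by (intro power_mono norm_triangle_ineq) auto
  also have "\<dots> \<le> 2 * (cmod x)\<^sup>2 + 2 * (cmod y)\<^sup>2"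
    by (smt (verit) power2_sum sum_squares_bound)
  finally show ?thesis .
qed

lemma L2_add:
  assumes "f \<in> L2" "g \<in> L2"
  shows "(\<lambda>x. f x + g x) \<in> L2"
    and "(L2_norm (\<lambda>x. f x + g x))\<^sup>2 \<le> 2 * (L2_norm f)\<^sup>2 + 2 * (L2_norm g)\<^sup>2"
proof -
  have [measurable]: "f \<in> borel_measurable lebesgue" "g \<in> borel_measurable lebesgue"
    using assms by (auto simp: L2_def)
  have i: "integrable lebesgue (\<lambda>x. 2 * (cmod (f x))\<^sup>2 + 2 * (cmod (g x))\<^sup>2)"
    using assms by (auto intro!: L2_integrable)
  have j: "integrable lebesgue (\<lambda>x. (cmod (f x + g x))\<^sup>2)"
    by (rule Bochner_Integration.integrable_bound[OF i]) (auto intro!: cmod_add_power2_le)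
  show "(\<lambda>x. f x + g x) \<in> L2"
    using j by (simp add: L2_def)
  have "(L2_norm (\<lambda>x. f x + g x))\<^sup>2 \<le> (\<integral>x. 2 * (cmod (f x))\<^sup>2 + 2 * (cmod (g x))\<^sup>2 \<partial>lebesgue)"
    unfolding L2_norm_power2 by (rule integral_mono[OF j i]) (rule cmod_add_power2_le)
  also have "\<dots> = 2 * (L2_norm f)\<^sup>2 + 2 * (L2_norm g)\<^sup>2"
    unfolding L2_norm_power2 using assms
    by (subst Bochner_Integration.integral_add) (auto intro!: L2_integrable)
  finally show "(L2_norm (\<lambda>x. f x + g x))\<^sup>2 \<le> 2 * (L2_norm f)\<^sup>2 + 2 * (L2_norm g)\<^sup>2" .
qed

lemma L2_cmult: "f \<in> L2 \<Longrightarrow> (\<lambda>x. c * f x) \<in> L2"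
  by (auto simp: L2_def norm_mult power_mult_distrib)

lemma L2_zero: "(\<lambda>x. 0) \<in> L2"
  by (auto simp: L2_def)

lemma L2_lincomb: "f \<in> L2 \<Longrightarrow> g \<in> L2 \<Longrightarrow> (\<lambda>x. b * f x + c * g x) \<in> L2"
  by (intro L2_add L2_cmult)

lemma L2_diff: "f \<in> L2 \<Longrightarrow> g \<in> L2 \<Longrightarrow> (\<lambda>x. f x - g x) \<in> L2"
  using L2_lincomb[of f g 1 "-1"] by simp

lemma L2_sum: "(\<And>i. i \<in> F \<Longrightarrow> f i \<in> L2) \<Longrightarrow> (\<lambda>x. \<Sum>i\<in>F. c i * f i x) \<in> L2"
  by (induction F rule: infinite_finite_induct) (auto intro!: L2_zero L2_add L2_cmult)

lemma borel_measurable_cnj [measurable]: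
  "f \<in> borel_measurable M \<Longrightarrow> (\<lambda>x. cnj (f x)) \<in> borel_measurable M"
  by (rule borel_measurable_continuous_on[where f = cnj]) (auto intro!: continuous_intros)

lemma L2_mult_cnj_integrable:
  assumes "f \<in> L2" "g \<in> L2"
  shows "integrable lebesgue (\<lambda>x. f x * cnj (g x))"
proof (rule Bochner_Integration.integrable_bound)
  show "integrable lebesgue (\<lambda>x. (cmod (f x))\<^sup>2 + (cmod (g x))\<^sup>2)"
    using assms by (auto intro!: L2_integrable)
  show "(\<lambda>x. f x * cnj (g x)) \<in> borel_measurable lebesgue"
    using assms by (auto simp: L2_def)
  have "norm (f x * cnj (g x)) \<le> norm ((cmod (f x))\<^sup>2 + (cmod (g x))\<^sup>2)" for x
    using sum_squares_bound[of "cmod (f x)" "cmod (g x)"]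
      mult_nonneg_nonneg[OF norm_ge_zero[of "f x"] norm_ge_zero[of "g x"]]
    unfolding norm_mult complex_mod_cnj real_norm_def by linarith
  then show "AE x in lebesgue. norm (f x * cnj (g x)) \<le> norm ((cmod (f x))\<^sup>2 + (cmod (g x))\<^sup>2)"
    by simp
qed

lemma L2_norm_eq_0_AE:
  assumes "f \<in> L2" "L2_norm f = 0"
  shows "AE x in lebesgue. f x = 0"
proof -
  have "integral\<^sup>L lebesgue (\<lambda>x. (cmod (f x))\<^sup>2) = 0"
    using L2_norm_power2[of f] assms(2) by simp
  then have "AE x in lebesgue. (cmod (f x))\<^sup>2 = 0"
    using L2_integrable[OF assms(1)] by (subst (asm) integral_nonneg_eq_0_iff_AE) auto
  then show ?thesis by simp
qed

lemma hfourier_lincomb: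
  assumes "f \<in> L2" "g \<in> L2" "d \<xi> \<in> L2"
  shows "hfourier d (\<lambda>x. b * f x + c * g x) \<xi> = b * hfourier d f \<xi> + c * hfourier d g \<xi>"
proof -
  have "hfourier d (\<lambda>x. b * f x + c * g x) \<xi>
      = (\<integral>x. b * (f x * cnj (d \<xi> x)) + c * (g x * cnj (d \<xi> x)) \<partial>lebesgue)"
    unfolding hfourier_def by (intro arg_cong[where f="integral\<^sup>L lebesgue"]) (auto simp: algebra_simps)
  also have "\<dots> = b * hfourier d f \<xi> + c * hfourier d g \<xi>"
    unfolding hfourier_def
    using L2_mult_cnj_integrable[OF assms(1,3)] L2_mult_cnj_integrable[OF assms(2,3)]
    by (subst Bochner_Integration.integral_add) auto
  finally show ?thesis .
qed

lemma hfourier_diff: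
  assumes "f \<in> L2" "g \<in> L2" "d \<xi> \<in> L2"
  shows "hfourier d (\<lambda>x. f x - g x) \<xi> = hfourier d f \<xi> - hfourier d g \<xi>"
  using hfourier_lincomb[of f g d \<xi> 1 "-1"] assms by simp

lemma hfourier_sum:
  assumes "\<And>i. i \<in> F \<Longrightarrow> f i \<in> L2" "d \<xi> \<in> L2"
  shows "hfourier d (\<lambda>x. \<Sum>i\<in>F. c i * f i x) \<xi> = (\<Sum>i\<in>F. c i * hfourier d (f i) \<xi>)"
  using assms(1)
proof (induction F rule: infinite_finite_induct)
  case (insert i F)
  have "hfourier d (\<lambda>x. c i * f i x + 1 * (\<Sum>i\<in>F. c i * f i x)) \<xi>
      = c i * hfourier d (f i) \<xi> + 1 * hfourier d (\<lambda>x. \<Sum>i\<in>F. c i * f i x) \<xi>"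
    by (rule hfourier_lincomb) (use insert assms(2) in \<open>auto intro!: L2_sum\<close>)
  then show ?case using insert by simp
qed (auto simp: hfourier_def)

lemma hfourier_AE_cong:
  assumes "AE x in lebesgue. f x = g x" "f \<in> L2" "g \<in> L2" "d \<xi> \<in> L2"
  shows "hfourier d f \<xi> = hfourier d g \<xi>"
  unfolding hfourier_def
proof (rule integral_cong_AE)
  show "(\<lambda>x. f x * cnj (d \<xi> x)) \<in> borel_measurable lebesgue" "(\<lambda>x. g x * cnj (d \<xi> x)) \<in> borel_measurable lebesgue"
    using assms by (auto simp: L2_def)
qed (use assms(1) in auto)

text \<open>
  The Cauchy--Schwarz inequality up to a constant, which is all that continuity needs.  It comes from
  \<open>2 |f d| \<le> l |f|\<^sup>2 + |d|\<^sup>2 / l\<close> with \<open>l\<close> the inverse norm of \<open>f\<close>.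
\<close>

lemma hfourier_bounded_functional:
  assumes d: "d \<xi> \<in> L2"
  obtains C where "C > 0" "\<And>f. f \<in> L2 \<Longrightarrow> cmod (hfourier d f \<xi>) \<le> C * L2_norm f"
proof
  let ?C = "1 + (L2_norm (d \<xi>))\<^sup>2"
  show "?C > 0" by (smt (verit) zero_le_power2)
  fix f :: "real^'a \<Rightarrow> complex" assume f: "f \<in> L2"
  show "cmod (hfourier d f \<xi>) \<le> ?C * L2_norm f"
  proof (cases "L2_norm f = 0")
    case True
    have "hfourier d f \<xi> = hfourier d (\<lambda>x. 0) \<xi>"
      by (rule hfourier_AE_cong) (use f d L2_zero L2_norm_eq_0_AE[OF f True] in auto)
    then show ?thesis using True by (simp add: hfourier_def)
  next
    case False
    then have pos: "L2_norm f > 0" using L2_norm_nonneg[of f] by linarith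
    define l where "l = 1 / L2_norm f"
    have l: "l > 0" using pos by (simp add: l_def)
    have *: "cmod (f x) * cmod (d \<xi> x) \<le> l * (cmod (f x))\<^sup>2 + (cmod (d \<xi> x))\<^sup>2 / l" for x
    proof -
      have "2 * (sqrt l * cmod (f x)) * (cmod (d \<xi> x) / sqrt l)
          \<le> (sqrt l * cmod (f x))\<^sup>2 + (cmod (d \<xi> x) / sqrt l)\<^sup>2" by (rule sum_squares_bound)
      then have "2 * (cmod (f x) * cmod (d \<xi> x)) \<le> l * (cmod (f x))\<^sup>2 + (cmod (d \<xi> x))\<^sup>2 / l"
        using l by (simp add: power_mult_distrib power_divide)
      moreover have "0 \<le> cmod (f x) * cmod (d \<xi> x)" by simp
      ultimately show ?thesis by linarith
    qed
    have "cmod (hfourier d f \<xi>) \<le> (\<integral>x. norm (f x * cnj (d \<xi> x)) \<partial>lebesgue)"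
      unfolding hfourier_def by (rule integral_norm_bound)
    also have "\<dots> \<le> (\<integral>x. l * (cmod (f x))\<^sup>2 + (cmod (d \<xi> x))\<^sup>2 / l \<partial>lebesgue)"
      using * f d by (intro integral_mono integrable_norm L2_mult_cnj_integrable)
        (auto simp: norm_mult intro!: L2_integrable)
    also have "\<dots> = l * (L2_norm f)\<^sup>2 + (L2_norm (d \<xi>))\<^sup>2 / l"
      unfolding L2_norm_power2 using f d
      by (subst Bochner_Integration.integral_add) (auto intro!: L2_integrable)
    also have "\<dots> = ?C * L2_norm f"
      using pos by (simp add: l_def power2_eq_square algebra_simps)
    finally show ?thesis .
  qed
qed

lemma riesz_basis_lower:
  fixes u :: "'i \<Rightarrow> real ^ 'n::finite \<Rightarrow> complex"
  assumes "riesz_basis I u"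
  obtains A where "A > 0" "\<forall>F c. finite F \<longrightarrow> F \<subseteq> I \<longrightarrow>
      A * (\<Sum>\<xi>\<in>F. (cmod (c \<xi>))\<^sup>2) \<le> (L2_norm (\<lambda>x. \<Sum>\<xi>\<in>F. c \<xi> * u \<xi> x))\<^sup>2"
proof -
  obtain A B where AB: "A > 0" "B > 0" and H: "\<forall>F c. finite F \<longrightarrow> F \<subseteq> I \<longrightarrow>
        A * (\<Sum>\<xi>\<in>F. (cmod (c \<xi>))\<^sup>2) \<le> (L2_norm (\<lambda>x. \<Sum>\<xi>\<in>F. c \<xi> * u \<xi> x))\<^sup>2 \<and>
        (L2_norm (\<lambda>x. \<Sum>\<xi>\<in>F. c \<xi> * u \<xi> x))\<^sup>2 \<le> B * (\<Sum>\<xi>\<in>F. (cmod (c \<xi>))\<^sup>2)"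
    using assms unfolding riesz_basis_def by (elim conjE exE)
  show ?thesis
    by (rule that[OF AB(1)]) (use H in simp_all)
qed

lemma riesz_basis_upper:
  fixes u :: "'i \<Rightarrow> real ^ 'n::finite \<Rightarrow> complex"
  assumes "riesz_basis I u"
  obtains B where "B > 0" "\<forall>F c. finite F \<longrightarrow> F \<subseteq> I \<longrightarrow>
      (L2_norm (\<lambda>x. \<Sum>\<xi>\<in>F. c \<xi> * u \<xi> x))\<^sup>2 \<le> B * (\<Sum>\<xi>\<in>F. (cmod (c \<xi>))\<^sup>2)"
proof -
  obtain A B where AB: "A > 0" "B > 0" and H: "\<forall>F c. finite F \<longrightarrow> F \<subseteq> I \<longrightarrow>
        A * (\<Sum>\<xi>\<in>F. (cmod (c \<xi>))\<^sup>2) \<le> (L2_norm (\<lambda>x. \<Sum>\<xi>\<in>F. c \<xi> * u \<xi> x))\<^sup>2 \<and>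
        (L2_norm (\<lambda>x. \<Sum>\<xi>\<in>F. c \<xi> * u \<xi> x))\<^sup>2 \<le> B * (\<Sum>\<xi>\<in>F. (cmod (c \<xi>))\<^sup>2)"
    using assms unfolding riesz_basis_def by (elim conjE exE)
  show ?thesis
    by (rule that[OF AB(2)]) (use H in simp_all)
qed

lemma riesz_basis_dense:
  fixes u :: "'i \<Rightarrow> real ^ 'n::finite \<Rightarrow> complex"
  assumes "riesz_basis I u" "f \<in> L2" "e > 0"
  obtains F c where "finite F" "F \<subseteq> I" "L2_norm (\<lambda>x. f x - (\<Sum>\<xi>\<in>F. c \<xi> * u \<xi> x)) < e"
proof -
  have "\<forall>f\<in>L2. \<forall>e>0. \<exists>F c. finite F \<and> F \<subseteq> I \<and> L2_norm (\<lambda>x. f x - (\<Sum>\<xi>\<in>F. c \<xi> * u \<xi> x)) < e"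
    using assms(1) unfolding riesz_basis_def by (elim conjE)
  from this[rule_format, OF assms(2,3)] show ?thesis
    using that by (elim exE conjE)
qed

lemma hfourier_basis_sum:
  assumes "riesz_basis I u" "biorthogonal_system I u d" "finite F" "F \<subseteq> I" "\<xi> \<in> I"
  shows "hfourier d (\<lambda>x. \<Sum>\<eta>\<in>F. c \<eta> * u \<eta> x) \<xi> = (if \<xi> \<in> F then c \<xi> else 0)"
proof -
  have "hfourier d (\<lambda>x. \<Sum>\<eta>\<in>F. c \<eta> * u \<eta> x) \<xi> = (\<Sum>\<eta>\<in>F. c \<eta> * hfourier d (u \<eta>) \<xi>)"
    using assms by (intro hfourier_sum) (auto simp: riesz_basis_def biorthogonal_system_def)
  also have "\<dots> = (\<Sum>\<eta>\<in>F. c \<eta> * (if \<eta> = \<xi> then 1 else 0))"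
    using assms unfolding biorthogonal_system_def hfourier_def
    by (intro sum.cong refl arg_cong2[where f="(*)"]) (auto simp: subset_iff)
  also have "\<dots> = (if \<xi> \<in> F then c \<xi> else 0)"
    using assms(3) by (simp add: sum.delta if_distrib cong: if_cong)
  finally show ?thesis .
qed

text \<open>
  For a finite combination of the basis the coefficients are known and the lower Riesz bound applies;
  such combinations are dense and every single coefficient is continuous.
\<close>

lemma bessel_inequality:
  fixes u :: "'i \<Rightarrow> real ^ 'n::finite \<Rightarrow> complex"
  assumes ub: "riesz_basis I u" and bi: "biorthogonal_system I u d"
  obtains C where "C > 0"
    "\<And>F g. finite F \<Longrightarrow> F \<subseteq> I \<Longrightarrow> g \<in> L2 \<Longrightarrow> (\<Sum>\<xi>\<in>F. (cmod (hfourier d g \<xi>))\<^sup>2) \<le> C * (L2_norm g)\<^sup>2"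
proof -
  obtain A where A: "A > 0" and lower: "\<forall>F c. finite F \<longrightarrow> F \<subseteq> I \<longrightarrow>
      A * (\<Sum>\<xi>\<in>F. (cmod (c \<xi>))\<^sup>2) \<le> (L2_norm (\<lambda>x. \<Sum>\<xi>\<in>F. c \<xi> * u \<xi> x))\<^sup>2"
    by (rule riesz_basis_lower[OF ub])
  show ?thesis
  proof (rule that[of "4 / A"])
    show "4 / A > 0" using A by simp
    fix F and g :: "real ^ 'n \<Rightarrow> complex"
    assume F: "finite F" "F \<subseteq> I" and g: "g \<in> L2"
    have dL: "d \<xi> \<in> L2" if "\<xi> \<in> I" for \<xi> using bi that by (auto simp: biorthogonal_system_def)
    have "\<forall>\<xi>\<in>F. \<exists>C>0. \<forall>f\<in>L2. cmod (hfourier d f \<xi>) \<le> C * L2_norm f"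
      using hfourier_bounded_functional dL F(2) by (metis subsetD)
    then obtain K where K: "\<And>\<xi>. \<xi> \<in> F \<Longrightarrow> K \<xi> > 0"
      "\<And>\<xi> f. \<xi> \<in> F \<Longrightarrow> f \<in> L2 \<Longrightarrow> cmod (hfourier d f \<xi>) \<le> K \<xi> * L2_norm f" by metis
    define S where "S = (\<Sum>\<xi>\<in>F. (K \<xi>)\<^sup>2)"
    have S0: "S \<ge> 0" by (simp add: S_def sum_nonneg)
    have step: "(\<Sum>\<xi>\<in>F. (cmod (hfourier d g \<xi>))\<^sup>2) \<le> 4 / A * (L2_norm g)\<^sup>2 + (4 / A + 2 * S) * e\<^sup>2"
      if e: "e > 0" for e
    proof -
      obtain F' c where F': "finite F'" "F' \<subseteq> I"
        and ap: "L2_norm (\<lambda>x. g x - (\<Sum>\<xi>\<in>F'. c \<xi> * u \<xi> x)) < e"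
        by (rule riesz_basis_dense[OF ub g e])
      define p where "p = (\<lambda>x. \<Sum>\<xi>\<in>F'. c \<xi> * u \<xi> x)"
      have pL: "p \<in> L2" unfolding p_def using ub F' by (intro L2_sum) (auto simp: riesz_basis_def)
      have rL: "(\<lambda>x. g x - p x) \<in> L2" using g pL by (rule L2_diff)
      have r2: "(L2_norm (\<lambda>x. g x - p x))\<^sup>2 \<le> e\<^sup>2"
        using ap L2_norm_nonneg by (intro power_mono) (auto simp: p_def)
      have co: "hfourier d p \<xi> = (if \<xi> \<in> F' then c \<xi> else 0)" if "\<xi> \<in> I" for \<xi>
        unfolding p_def by (rule hfourier_basis_sum[OF ub bi F' that])
      have "(\<Sum>\<xi>\<in>F. (cmod (hfourier d p \<xi>))\<^sup>2) = (\<Sum>\<xi>\<in>F \<inter> F'. (cmod (c \<xi>))\<^sup>2)"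
        using F co by (subst sum.inter_restrict) (auto intro!: sum.cong)
      also have "\<dots> \<le> (\<Sum>\<xi>\<in>F'. (cmod (c \<xi>))\<^sup>2)" using F' by (intro sum_mono2) auto
      also have "\<dots> \<le> (L2_norm p)\<^sup>2 / A"
        using A lower[rule_format, OF F', of c] by (simp add: p_def field_simps)
      finally have 1: "(\<Sum>\<xi>\<in>F. (cmod (hfourier d p \<xi>))\<^sup>2) \<le> (L2_norm p)\<^sup>2 / A" .
      have "(L2_norm (\<lambda>x. g x + (-1) * (g x - p x)))\<^sup>2 \<le> 2 * (L2_norm g)\<^sup>2 + 2 * (L2_norm (\<lambda>x. (-1) * (g x - p x)))\<^sup>2"
        by (rule L2_add(2)[OF g L2_cmult[OF rL]])
      also have "L2_norm (\<lambda>x. (-1) * (g x - p x)) = L2_norm (\<lambda>x. g x - p x)"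
        by (simp add: L2_norm_def norm_minus_commute)
      finally have 2: "(L2_norm p)\<^sup>2 \<le> 2 * (L2_norm g)\<^sup>2 + 2 * e\<^sup>2" using r2 by simp
      have "(cmod (hfourier d g \<xi>))\<^sup>2 \<le> 2 * (cmod (hfourier d p \<xi>))\<^sup>2 + 2 * ((K \<xi>)\<^sup>2 * e\<^sup>2)"
        if "\<xi> \<in> F" for \<xi>
      proof -
        have "hfourier d g \<xi> = hfourier d p \<xi> + hfourier d (\<lambda>x. g x - p x) \<xi>"
          using hfourier_diff[OF g pL, of d \<xi>] dL that F(2) by auto
        then have "(cmod (hfourier d g \<xi>))\<^sup>2 \<le> 2 * (cmod (hfourier d p \<xi>))\<^sup>2
            + 2 * (cmod (hfourier d (\<lambda>x. g x - p x) \<xi>))\<^sup>2"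
          using cmod_add_power2_le by presburger
        moreover have "(cmod (hfourier d (\<lambda>x. g x - p x) \<xi>))\<^sup>2 \<le> (K \<xi> * L2_norm (\<lambda>x. g x - p x))\<^sup>2"
          using K(2)[OF that rL] by (intro power_mono) auto
        moreover have "(K \<xi> * L2_norm (\<lambda>x. g x - p x))\<^sup>2 \<le> (K \<xi>)\<^sup>2 * e\<^sup>2"
          unfolding power_mult_distrib using r2 by (intro mult_left_mono) auto
        ultimately show ?thesis by linarith
      qed
      then have "(\<Sum>\<xi>\<in>F. (cmod (hfourier d g \<xi>))\<^sup>2)
          \<le> (\<Sum>\<xi>\<in>F. 2 * (cmod (hfourier d p \<xi>))\<^sup>2 + 2 * ((K \<xi>)\<^sup>2 * e\<^sup>2))"
        by (intro sum_mono) auto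
      also have "\<dots> = 2 * (\<Sum>\<xi>\<in>F. (cmod (hfourier d p \<xi>))\<^sup>2) + 2 * S * e\<^sup>2"
        by (simp add: S_def sum.distrib sum_distrib_left sum_distrib_right mult.assoc)
      also have "\<dots> \<le> 2 * ((2 * (L2_norm g)\<^sup>2 + 2 * e\<^sup>2) / A) + 2 * S * e\<^sup>2"
        using 1 2 A by (smt (verit, best) divide_right_mono)
      also have "\<dots> = 4 / A * (L2_norm g)\<^sup>2 + (4 / A + 2 * S) * e\<^sup>2"
        using A by (simp add: field_simps)
      finally show ?thesis .
    qed
    have "((\<lambda>e. 4 / A * (L2_norm g)\<^sup>2 + (4 / A + 2 * S) * e\<^sup>2) \<longlongrightarrow>
        4 / A * (L2_norm g)\<^sup>2 + (4 / A + 2 * S) * 0\<^sup>2) (at_right 0)"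
      by (intro tendsto_intros)
    then have "(\<Sum>\<xi>\<in>F. (cmod (hfourier d g \<xi>))\<^sup>2) \<le> 4 / A * (L2_norm g)\<^sup>2 + (4 / A + 2 * S) * 0\<^sup>2"
      by (rule tendsto_lowerbound)
        (rule eventually_mono[OF eventually_at_right_less], erule step, simp)
    then show "(\<Sum>\<xi>\<in>F. (cmod (hfourier d g \<xi>))\<^sup>2) \<le> 4 / A * (L2_norm g)\<^sup>2"
      by simp
  qed
qed

text \<open>
  If \<open>p\<close> is a finite combination close to \<open>g\<close>, its coefficients are, up to sign, coefficients of
  \<open>g - p\<close>.  By Bessel's inequality they are small, and by the upper Riesz bound so is \<open>p\<close>.
\<close>

lemma hfourier_injective:
  fixes u :: "'i \<Rightarrow> real ^ 'n::finite \<Rightarrow> complex"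
  assumes ub: "riesz_basis I u" and bi: "biorthogonal_system I u d"
    and g: "g \<in> L2" and z: "\<And>\<xi>. \<xi> \<in> I \<Longrightarrow> hfourier d g \<xi> = 0"
  shows "AE x in lebesgue. g x = 0"
proof -
  obtain C where C: "C > 0"
    "\<And>F g. finite F \<Longrightarrow> F \<subseteq> I \<Longrightarrow> g \<in> L2 \<Longrightarrow> (\<Sum>\<xi>\<in>F. (cmod (hfourier d g \<xi>))\<^sup>2) \<le> C * (L2_norm g)\<^sup>2"
    using bessel_inequality[OF ub bi] by blast
  obtain B where B: "B > 0" and upper: "\<forall>F c. finite F \<longrightarrow> F \<subseteq> I \<longrightarrow>
      (L2_norm (\<lambda>x. \<Sum>\<xi>\<in>F. c \<xi> * u \<xi> x))\<^sup>2 \<le> B * (\<Sum>\<xi>\<in>F. (cmod (c \<xi>))\<^sup>2)"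
    by (rule riesz_basis_upper[OF ub])
  have step: "(L2_norm g)\<^sup>2 \<le> (2 + 2 * B * C) * e\<^sup>2" if e: "e > 0" for e
  proof -
    obtain F c where F: "finite F" "F \<subseteq> I"
      and ap: "L2_norm (\<lambda>x. g x - (\<Sum>\<xi>\<in>F. c \<xi> * u \<xi> x)) < e"
      by (rule riesz_basis_dense[OF ub g e])
    define p where "p = (\<lambda>x. \<Sum>\<xi>\<in>F. c \<xi> * u \<xi> x)"
    have pL: "p \<in> L2" unfolding p_def using ub F by (intro L2_sum) (auto simp: riesz_basis_def)
    have rL: "(\<lambda>x. g x - p x) \<in> L2" using g pL by (rule L2_diff)
    have r2: "(L2_norm (\<lambda>x. g x - p x))\<^sup>2 \<le> e\<^sup>2"
      using ap L2_norm_nonneg by (intro power_mono) (auto simp: p_def)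
    have "hfourier d (\<lambda>x. g x - p x) \<xi> = - c \<xi>" if "\<xi> \<in> F" for \<xi>
    proof -
      have "d \<xi> \<in> L2" using bi that F by (auto simp: biorthogonal_system_def)
      then have "hfourier d (\<lambda>x. g x - p x) \<xi> = hfourier d g \<xi> - hfourier d p \<xi>"
        using g pL by (intro hfourier_diff)
      then show ?thesis
        using hfourier_basis_sum[OF ub bi F, of \<xi> c] z that F by (auto simp: p_def)
    qed
    then have "(\<Sum>\<xi>\<in>F. (cmod (c \<xi>))\<^sup>2) = (\<Sum>\<xi>\<in>F. (cmod (hfourier d (\<lambda>x. g x - p x) \<xi>))\<^sup>2)"
      by (intro sum.cong) auto
    also have "\<dots> \<le> C * e\<^sup>2"
      using C(2)[OF F rL] mult_left_mono[OF r2, of C] C(1) by linarith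
    finally have 1: "(L2_norm p)\<^sup>2 \<le> B * (C * e\<^sup>2)"
      using upper[rule_format, OF F, of c] B mult_left_mono[of _ _ B] unfolding p_def by (smt (verit, best))
    have "(L2_norm (\<lambda>x. (g x - p x) + p x))\<^sup>2 \<le> 2 * (L2_norm (\<lambda>x. g x - p x))\<^sup>2 + 2 * (L2_norm p)\<^sup>2"
      by (rule L2_add(2)[OF rL pL])
    then show ?thesis using 1 r2 by (simp add: algebra_simps)
  qed
  have "((\<lambda>e. (2 + 2 * B * C) * e\<^sup>2) \<longlongrightarrow> (2 + 2 * B * C) * 0\<^sup>2) (at_right 0)"
    by (intro tendsto_intros)
  then have "(L2_norm g)\<^sup>2 \<le> (2 + 2 * B * C) * 0\<^sup>2"
    by (rule tendsto_lowerbound)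
        (rule eventually_mono[OF eventually_at_right_less], erule step, simp)
  then show ?thesis using g by (intro L2_norm_eq_0_AE) auto
qed

text \<open>
  Completeness of $L^2$ along rapidly converging sequences.  Writing \<open>D k\<close> for the increments,
  Cauchy--Schwarz gives
  \<open>(\<Sum>k\<ge>n. |D k|)\<^sup>2 \<le> (\<Sum>k\<ge>n. (1/2) ^ k) * (\<Sum>k. 2 ^ k * |D k|\<^sup>2)\<close>, and the last sum is integrable because
  the squared norms of the increments decay like \<open>(1/4) ^ k\<close>.
\<close>

lemma L2_fast_Cauchy_convergent:
  fixes S :: "nat \<Rightarrow> real ^ 'n::finite \<Rightarrow> complex"
  assumes S: "\<And>k. S k \<in> L2"
    and D: "\<And>k. (L2_norm (\<lambda>x. S (Suc k) x - S k x))\<^sup>2 \<le> K * (1/4) ^ k"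
  obtains f where "f \<in> L2" "(\<lambda>k. L2_norm (\<lambda>x. f x - S k x)) \<longlonglongrightarrow> 0"
proof -
  define D where "D = (\<lambda>k x. S (Suc k) x - S k x)"
  have DL: "D k \<in> L2" for k unfolding D_def by (intro L2_diff S)
  have [measurable]: "S k \<in> borel_measurable lebesgue" "D k \<in> borel_measurable lebesgue" for k
    using S[of k] DL[of k] by (auto simp: L2_def)
  define g where "g = (\<lambda>k x. 2 ^ k * (cmod (D k x))\<^sup>2)"
  have gi: "integrable lebesgue (g k)" for k
    unfolding g_def using L2_integrable[OF DL] by simp
  have gint: "integral\<^sup>L lebesgue (g k) \<le> K * (1/2) ^ k" for k
  proof -
    have "integral\<^sup>L lebesgue (g k) = 2 ^ k * (L2_norm (D k))\<^sup>2"
      unfolding g_def L2_norm_power2 by simp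
    also have "\<dots> \<le> 2 ^ k * (K * (1/4) ^ k)"
      using assms(2)[of k] by (simp add: D_def)
    also have "\<dots> = K * (1/2) ^ k"
      by (simp add: power_mult_distrib[symmetric] mult.left_commute)
    finally show ?thesis .
  qed
  have g0: "g k x \<ge> 0" for k x by (simp add: g_def)
  have sg: "summable (\<lambda>k. integral\<^sup>L lebesgue (g k))"
  proof (rule summable_comparison_test')
    show "summable (\<lambda>k. K * (1/2::real) ^ k)" by (intro summable_mult summable_geometric) auto
    show "norm (integral\<^sup>L lebesgue (g k)) \<le> K * (1/2) ^ k" if "k \<ge> 0" for k
      using gint[of k] integral_nonneg_AE[of "g k" lebesgue] g0 by auto
  qed
  have AEs: "AE x in lebesgue. summable (\<lambda>k. g k x)"
  proof -
    have "(\<integral>\<^sup>+x. (\<Sum>k. ennreal (g k x)) \<partial>lebesgue) = (\<Sum>k. \<integral>\<^sup>+x. ennreal (g k x) \<partial>lebesgue)"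
      by (rule nn_integral_suminf) (simp add: g_def)
    also have "\<dots> = (\<Sum>k. ennreal (integral\<^sup>L lebesgue (g k)))"
      using gi g0 by (intro suminf_cong nn_integral_eq_integral) auto
    also have "\<dots> = ennreal (\<Sum>k. integral\<^sup>L lebesgue (g k))"
      using sg g0 by (intro suminf_ennreal2 integral_nonneg_AE) auto
    finally have "(\<integral>\<^sup>+x. (\<Sum>k. ennreal (g k x)) \<partial>lebesgue) \<noteq> \<infinity>" by simp
    then have "AE x in lebesgue. (\<Sum>k. ennreal (g k x)) \<noteq> \<infinity>"
      by (intro nn_integral_PInf_AE) (auto simp: g_def)
    then show ?thesis
      by (rule AE_mp) (use g0 in \<open>auto intro!: summable_suminf_not_top\<close>)
  qed
  define h where "h = (\<lambda>x. \<Sum>k. g k x)"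
  have hi: "integrable lebesgue h"
    unfolding h_def using gi AEs sg g0 by (intro integrable_suminf) auto
  define f where "f = (\<lambda>x. lim (\<lambda>k. S k x))"
  have fm [measurable]: "f \<in> borel_measurable lebesgue"
    unfolding f_def by (rule borel_measurable_lim_metric) simp
  have bound: "(cmod (f x - S n x))\<^sup>2 \<le> 2 * (1/2) ^ n * h x" if sx: "summable (\<lambda>k. g k x)" for n x
  proof -
    have "summable (\<lambda>k. D k x)"
    proof (rule summable_comparison_test')
      show "summable (\<lambda>k. (1/2) ^ k + g k x)" using sx by (intro summable_add summable_geometric) auto
      show "cmod (D k x) \<le> (1/2) ^ k + g k x" if "k \<ge> 0" for k
      proof -
        have "2 * (sqrt (2 ^ k) * cmod (D k x)) * (1 / sqrt (2 ^ k)) \<le> (sqrt (2 ^ k) * cmod (D k x))\<^sup>2 + (1 / sqrt (2 ^ k))\<^sup>2"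
          by (rule sum_squares_bound)
        then have "2 * cmod (D k x) \<le> g k x + (1/2) ^ k"
          by (simp add: g_def power_mult_distrib power_divide)
        then show ?thesis using norm_ge_zero[of "D k x"] by linarith
      qed
    qed
    then have "(\<lambda>n. \<Sum>k<n. D k x) \<longlonglongrightarrow> (\<Sum>k. D k x)"
      by (rule summable_LIMSEQ)
    then have "(\<lambda>n. S n x - S 0 x) \<longlonglongrightarrow> (\<Sum>k. D k x)"
      unfolding D_def by (subst (asm) sum_lessThan_telescope)
    then have "(\<lambda>n. (S n x - S 0 x) + S 0 x) \<longlonglongrightarrow> (\<Sum>k. D k x) + S 0 x"
      by (intro tendsto_add tendsto_const)
    then have "convergent (\<lambda>n. S n x)" by (auto simp: convergent_def)
    then have lim: "(\<lambda>n. S n x) \<longlonglongrightarrow> f x" by (simp add: f_def convergent_LIMSEQ_iff)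
    have fin: "(cmod (S m x - S n x))\<^sup>2 \<le> 2 * (1/2) ^ n * h x" if "m \<ge> n" for m
    proof -
      have "S m x - S n x = (\<Sum>k=n..<m. D k x)"
        unfolding D_def using sum_Suc_diff'[OF that, of "\<lambda>k. S k x"] by simp
      then have "cmod (S m x - S n x) \<le> (\<Sum>k=n..<m. cmod (D k x))"
        by (simp add: norm_sum)
      then have "(cmod (S m x - S n x))\<^sup>2 \<le> (\<Sum>k=n..<m. cmod (D k x))\<^sup>2"
        by (intro power_mono) auto
      also have "\<dots> = (\<Sum>k=n..<m. (1 / sqrt (2 ^ k)) * (sqrt (2 ^ k) * cmod (D k x)))\<^sup>2"
        by simp
      also have "\<dots> \<le> (\<Sum>k=n..<m. (1 / sqrt (2 ^ k))\<^sup>2) * (\<Sum>k=n..<m. (sqrt (2 ^ k) * cmod (D k x))\<^sup>2)"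
        by (rule Cauchy_Schwarz_ineq_sum)
      also have "\<dots> = (\<Sum>k=n..<m. (1/2) ^ k) * (\<Sum>k=n..<m. g k x)"
        by (simp add: g_def power_mult_distrib power_divide)
      also have "\<dots> \<le> (2 * (1/2) ^ n) * h x"
      proof (rule mult_mono)
        have "(\<Sum>k=n..<m. (1/2::real) ^ k) = (\<Sum>k=0..<m-n. (1/2) ^ (k + n))"
          using sum.shift_bounds_nat_ivl[of "\<lambda>k. (1/2::real)^k" 0 n "m - n"] that by simp
        also have "\<dots> = (1/2) ^ n * (\<Sum>k<m-n. (1/2) ^ k)"
          by (simp add: power_add sum_distrib_left mult.commute lessThan_atLeast0)
        also have "(\<Sum>k<m-n. (1/2::real) ^ k) \<le> (\<Sum>k. (1/2) ^ k)"
          by (intro sum_le_suminf summable_geometric) auto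
        also have "(\<Sum>k. (1/2::real) ^ k) = 2" by (subst suminf_geometric) auto
        finally show "(\<Sum>k=n..<m. (1/2::real) ^ k) \<le> 2 * (1/2) ^ n" by simp
        show "(\<Sum>k=n..<m. g k x) \<le> h x"
          unfolding h_def using sx g0 by (intro sum_le_suminf) auto
      qed (auto intro!: sum_nonneg g0)
      finally show ?thesis .
    qed
    have "(\<lambda>m. (cmod (S m x - S n x))\<^sup>2) \<longlonglongrightarrow> (cmod (f x - S n x))\<^sup>2"
      by (intro tendsto_intros lim)
    then show ?thesis
      by (rule tendsto_upperbound) (auto intro!: eventually_sequentiallyI[of n] fin)
  qed
  have di: "integrable lebesgue (\<lambda>x. (cmod (f x - S n x))\<^sup>2)" for n
  proof (rule Bochner_Integration.integrable_bound)
    show "integrable lebesgue (\<lambda>x. 2 * (1/2) ^ n * h x)" using hi by simp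
    show "AE x in lebesgue. norm ((cmod (f x - S n x))\<^sup>2) \<le> norm (2 * (1/2) ^ n * h x)"
      using AEs by (rule AE_mp) (use bound[of _ n] in \<open>auto intro!: AE_I2 intro: order_trans[OF _ abs_ge_self]\<close>)
  qed measurable
  have fS: "(\<lambda>x. f x - S n x) \<in> L2" for n using di[of n] by (simp add: L2_def)
  show ?thesis
  proof
    show "f \<in> L2" using L2_add(1)[OF fS[of 0] S[of 0]] by simp
    have "(\<lambda>n. (L2_norm (\<lambda>x. f x - S n x))\<^sup>2) \<longlonglongrightarrow> 0"
    proof (rule tendsto_sandwich)
      show "\<forall>\<^sub>F n in sequentially. 0 \<le> (L2_norm (\<lambda>x. f x - S n x))\<^sup>2" by simp
      show "\<forall>\<^sub>F n in sequentially. (L2_norm (\<lambda>x. f x - S n x))\<^sup>2 \<le> (1/2) ^ n * (2 * integral\<^sup>L lebesgue h)"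
      proof (intro always_eventually allI)
        fix n
        have "(L2_norm (\<lambda>x. f x - S n x))\<^sup>2 \<le> (\<integral>x. 2 * (1/2) ^ n * h x \<partial>lebesgue)"
          unfolding L2_norm_power2
        proof (rule integral_mono_AE[OF di])
          show "AE x in lebesgue. (cmod (f x - S n x))\<^sup>2 \<le> 2 * (1/2) ^ n * h x"
            using AEs by (rule AE_mp) (use bound[of _ n] in auto)
        qed (use hi in simp)
        then show "(L2_norm (\<lambda>x. f x - S n x))\<^sup>2 \<le> (1/2) ^ n * (2 * integral\<^sup>L lebesgue h)"
          by (simp add: algebra_simps)
      qed
      show "(\<lambda>n. (1/2::real) ^ n * (2 * integral\<^sup>L lebesgue h)) \<longlonglongrightarrow> 0"
        by (intro tendsto_mult_left_zero LIMSEQ_power_zero) auto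
    qed simp
    then have "(\<lambda>n. sqrt ((L2_norm (\<lambda>x. f x - S n x))\<^sup>2)) \<longlonglongrightarrow> sqrt 0"
      by (rule tendsto_real_sqrt)
    then show "(\<lambda>n. L2_norm (\<lambda>x. f x - S n x)) \<longlonglongrightarrow> 0"
      by (simp add: L2_norm_nonneg)
  qed
qed

text \<open>
  Partial sums over an increasing sequence of finite sets, chosen so that the remaining mass of the
  coefficients is at most \<open>2 * (1/4) ^ k\<close>, converge rapidly by the upper Riesz bound.
\<close>

lemma hfourier_surjective:
  fixes u :: "'i \<Rightarrow> real ^ 'n::finite \<Rightarrow> complex"
  assumes ub: "riesz_basis I u" and bi: "biorthogonal_system I u d"
    and c: "(\<lambda>\<xi>. (cmod (c \<xi>))\<^sup>2) summable_on I"
  obtains f where "f \<in> L2" "\<And>\<xi>. \<xi> \<in> I \<Longrightarrow> hfourier d f \<xi> = c \<xi>"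
proof -
  obtain B where B: "B > 0" and upper: "\<forall>F c. finite F \<longrightarrow> F \<subseteq> I \<longrightarrow>
      (L2_norm (\<lambda>x. \<Sum>\<xi>\<in>F. c \<xi> * u \<xi> x))\<^sup>2 \<le> B * (\<Sum>\<xi>\<in>F. (cmod (c \<xi>))\<^sup>2)"
    by (rule riesz_basis_upper[OF ub])
  define s where "s = (\<Sum>\<^sub>\<infinity>\<xi>\<in>I. (cmod (c \<xi>))\<^sup>2)"
  define sm where "sm = (\<lambda>F. \<Sum>\<xi>\<in>F. (cmod (c \<xi>))\<^sup>2)"
  have lim: "(sm \<longlongrightarrow> s) (finite_subsets_at_top I)"
    using has_sum_infsum[OF c] unfolding has_sum_def s_def sm_def .
  have "\<exists>X. finite X \<and> X \<subseteq> I \<and> (\<forall>F. finite F \<and> X \<subseteq> F \<and> F \<subseteq> I \<longrightarrow> dist (sm F) s < (1/4) ^ k)" for k :: nat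
    using tendstoD[OF lim, of "(1/4) ^ k"] unfolding eventually_finite_subsets_at_top by simp
  then obtain X where X: "\<And>k::nat. finite (X k)" "\<And>k. X k \<subseteq> I"
    "\<And>k F. finite F \<Longrightarrow> X k \<subseteq> F \<Longrightarrow> F \<subseteq> I \<Longrightarrow> dist (sm F) s < (1/4) ^ k" by metis
  define F where "F = (\<lambda>k. \<Union>j\<le>k. X j)"
  have F: "finite (F k)" "F k \<subseteq> I" "X k \<subseteq> F k" "F k \<subseteq> F (Suc k)" for k
    using X unfolding F_def by (auto simp: le_Suc_eq)
  have tail: "(\<Sum>\<xi>\<in>G - F k. (cmod (c \<xi>))\<^sup>2) \<le> 2 * (1/4) ^ k" if "finite G" "F k \<subseteq> G" "G \<subseteq> I" for k G
  proof -
    have "dist (sm G) s < (1/4) ^ k" "dist (sm (F k)) s < (1/4) ^ k"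
      using that F[of k] by (auto intro!: X(3))
    then have "sm G - sm (F k) \<le> 2 * (1/4) ^ k" by (simp add: dist_real_def)
    moreover have "(\<Sum>\<xi>\<in>G - F k. (cmod (c \<xi>))\<^sup>2) = sm G - sm (F k)"
      unfolding sm_def using that by (intro sum_diff)
    ultimately show ?thesis by simp
  qed
  define S where "S = (\<lambda>k x. \<Sum>\<xi>\<in>F k. c \<xi> * u \<xi> x)"
  have SL: "S k \<in> L2" for k
    unfolding S_def using ub F(2)[of k] by (intro L2_sum) (auto simp: riesz_basis_def)
  have SD: "(L2_norm (\<lambda>x. S (Suc k) x - S k x))\<^sup>2 \<le> (B * 2) * (1/4) ^ k" for k
  proof -
    have "(\<lambda>x. S (Suc k) x - S k x) = (\<lambda>x. \<Sum>\<xi>\<in>F (Suc k) - F k. c \<xi> * u \<xi> x)"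
      unfolding S_def using F by (subst sum_diff) auto
    then have "(L2_norm (\<lambda>x. S (Suc k) x - S k x))\<^sup>2 \<le> B * (\<Sum>\<xi>\<in>F (Suc k) - F k. (cmod (c \<xi>))\<^sup>2)"
      using upper[rule_format, of "F (Suc k) - F k" c] F[of "Suc k"] by auto
    also have "\<dots> \<le> B * (2 * (1/4) ^ k)"
      using tail[of "F (Suc k)" k] F B by (intro mult_left_mono) auto
    finally show ?thesis by simp
  qed
  obtain f where f: "f \<in> L2" "(\<lambda>k. L2_norm (\<lambda>x. f x - S k x)) \<longlonglongrightarrow> 0"
    by (rule L2_fast_Cauchy_convergent[OF SL SD])
  show ?thesis
  proof
    show "f \<in> L2" by fact
    fix \<xi> assume xi: "\<xi> \<in> I"
    have d: "d \<xi> \<in> L2" using bi xi by (auto simp: biorthogonal_system_def)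
    obtain C where C: "C > 0" "\<And>f. f \<in> L2 \<Longrightarrow> cmod (hfourier d f \<xi>) \<le> C * L2_norm f"
      using hfourier_bounded_functional[of d \<xi>] d by blast
    have "(\<lambda>k. hfourier d f \<xi> - hfourier d (S k) \<xi>) \<longlonglongrightarrow> 0"
    proof (rule Lim_null_comparison)
      show "\<forall>\<^sub>F k in sequentially. norm (hfourier d f \<xi> - hfourier d (S k) \<xi>) \<le> C * L2_norm (\<lambda>x. f x - S k x)"
        using C(2)[OF L2_diff[OF f(1) SL]] hfourier_diff[of f _ d \<xi>] f(1) SL d by (auto intro!: always_eventually)
      show "(\<lambda>k. C * L2_norm (\<lambda>x. f x - S k x)) \<longlonglongrightarrow> 0"
        using f(2) by (rule tendsto_mult_right_zero)
    qed
    moreover have "(\<lambda>k. hfourier d (S k) \<xi> - c \<xi>) \<longlonglongrightarrow> 0"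
    proof (rule Lim_null_comparison)
      show "\<forall>\<^sub>F k in sequentially. norm (hfourier d (S k) \<xi> - c \<xi>) \<le> sqrt (2 * (1/4) ^ k)"
      proof (intro always_eventually allI)
        fix k
        have "hfourier d (S k) \<xi> = (if \<xi> \<in> F k then c \<xi> else 0)"
          unfolding S_def by (rule hfourier_basis_sum[OF ub bi F(1,2) xi])
        moreover have "(cmod (c \<xi>))\<^sup>2 \<le> 2 * (1/4) ^ k" if "\<xi> \<notin> F k"
        proof -
          have "insert \<xi> (F k) - F k = {\<xi>}" using that by auto
          then show ?thesis using tail[of "insert \<xi> (F k)" k] F xi by auto
        qed
        ultimately show "norm (hfourier d (S k) \<xi> - c \<xi>) \<le> sqrt (2 * (1/4) ^ k)"
          by (auto intro!: real_le_rsqrt)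
      qed
      have "(\<lambda>k. sqrt (2 * (1/4) ^ k)) \<longlonglongrightarrow> sqrt (2 * 0)"
        by (intro tendsto_real_sqrt tendsto_mult tendsto_const LIMSEQ_power_zero) auto
      then show "(\<lambda>k. sqrt (2 * (1/4) ^ k)) \<longlonglongrightarrow> 0" by simp
    qed
    ultimately have "(\<lambda>k. (hfourier d f \<xi> - hfourier d (S k) \<xi>) + (hfourier d (S k) \<xi> - c \<xi>)) \<longlonglongrightarrow> 0 + 0"
      by (rule tendsto_add)
    then show "hfourier d f \<xi> = c \<xi>" by (simp add: LIMSEQ_const_iff)
  qed
qed

section \<open>Weighted square sums and the Gevrey steps\<close>

text \<open>
  \<open>wl2_le I w c r\<close> says that the family \<open>c\<close> has norm at most \<open>r\<close> in the weighted space $\ell^2(I; w)$.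
  Phrasing it through finite subfamilies makes it meaningful for families of infinite norm and reduces
  every estimate to finite sums.
\<close>

definition wl2_le :: "'i set \<Rightarrow> ('i \<Rightarrow> real) \<Rightarrow> ('i \<Rightarrow> complex) \<Rightarrow> real \<Rightarrow> bool" where
  "wl2_le I w c r \<longleftrightarrow> (\<forall>F. finite F \<longrightarrow> F \<subseteq> I \<longrightarrow> L2_set (\<lambda>\<xi>. w \<xi> * cmod (c \<xi>)) F \<le> r)"

text \<open>
  The weight of the step with exponent \<open>A\<close>; its square appears in the norm of the step.
\<close>

definition gweight :: "('i \<Rightarrow> complex) \<Rightarrow> real \<Rightarrow> real \<Rightarrow> 'i \<Rightarrow> real" where
  "gweight lam s A \<xi> = exp (A * bracket lam \<xi> powr (1/s))"

lemma wl2_leI: "(\<And>F. finite F \<Longrightarrow> F \<subseteq> I \<Longrightarrow> L2_set (\<lambda>\<xi>. w \<xi> * cmod (c \<xi>)) F \<le> r) \<Longrightarrow> wl2_le I w c r"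
  by (simp add: wl2_le_def)

lemma wl2_leD: "wl2_le I w c r \<Longrightarrow> finite F \<Longrightarrow> F \<subseteq> I \<Longrightarrow> L2_set (\<lambda>\<xi>. w \<xi> * cmod (c \<xi>)) F \<le> r"
  by (simp add: wl2_le_def)

lemma wl2_le_nonneg: "wl2_le I w c r \<Longrightarrow> 0 \<le> r"
  using wl2_leD[of I w c r "{}"] by simp

lemma wl2_le_dominated:
  assumes "wl2_le I w' c' r" "0 \<le> K"
    and "\<And>\<xi>. \<xi> \<in> I \<Longrightarrow> 0 \<le> w \<xi>"
    and "\<And>\<xi>. \<xi> \<in> I \<Longrightarrow> w \<xi> * cmod (c \<xi>) \<le> K * (w' \<xi> * cmod (c' \<xi>))"
  shows "wl2_le I w c (K * r)"
proof (rule wl2_leI)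
  fix F assume F: "finite F" "F \<subseteq> I"
  have "L2_set (\<lambda>\<xi>. w \<xi> * cmod (c \<xi>)) F \<le> L2_set (\<lambda>\<xi>. K * (w' \<xi> * cmod (c' \<xi>))) F"
    using F assms by (intro L2_set_mono) (auto intro!: mult_nonneg_nonneg)
  also have "\<dots> = K * L2_set (\<lambda>\<xi>. w' \<xi> * cmod (c' \<xi>)) F"
    using assms(2) by (simp add: L2_set_right_distrib)
  also have "\<dots> \<le> K * r"
    using wl2_leD[OF assms(1) F] assms(2) by (rule mult_left_mono)
  finally show "L2_set (\<lambda>\<xi>. w \<xi> * cmod (c \<xi>)) F \<le> K * r" .
qed

lemma wl2_le_mono: "wl2_le I w c r \<Longrightarrow> r \<le> r' \<Longrightarrow> wl2_le I w c r'"
  by (fastforce simp: wl2_le_def)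

lemma wl2_le_cong: "(\<And>\<xi>. \<xi> \<in> I \<Longrightarrow> c \<xi> = c' \<xi>) \<Longrightarrow> wl2_le I w c r \<longleftrightarrow> wl2_le I w c' r"
  unfolding wl2_le_def by (intro all_cong imp_cong refl arg_cong2[where f="(\<le>)"] L2_set_cong) auto

lemma wl2_le_add:
  assumes "wl2_le I w c r" "wl2_le I w c' r'" "\<And>\<xi>. \<xi> \<in> I \<Longrightarrow> 0 \<le> w \<xi>"
  shows "wl2_le I w (\<lambda>\<xi>. c \<xi> + c' \<xi>) (r + r')"
proof (rule wl2_leI)
  fix F assume F: "finite F" "F \<subseteq> I"
  have "L2_set (\<lambda>\<xi>. w \<xi> * cmod (c \<xi> + c' \<xi>)) F
      \<le> L2_set (\<lambda>\<xi>. w \<xi> * cmod (c \<xi>) + w \<xi> * cmod (c' \<xi>)) F"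
    using F assms(3)
    by (intro L2_set_mono) (auto simp: distrib_left[symmetric] intro!: mult_left_mono norm_triangle_ineq)
  also have "\<dots> \<le> L2_set (\<lambda>\<xi>. w \<xi> * cmod (c \<xi>)) F + L2_set (\<lambda>\<xi>. w \<xi> * cmod (c' \<xi>)) F"
    by (rule L2_set_triangle_ineq)
  also have "\<dots> \<le> r + r'"
    using wl2_leD[OF assms(1) F] wl2_leD[OF assms(2) F] by simp
  finally show "L2_set (\<lambda>\<xi>. w \<xi> * cmod (c \<xi> + c' \<xi>)) F \<le> r + r'" .
qed

lemma wl2_le_cmult:
  assumes "wl2_le I w c r" "\<And>\<xi>. \<xi> \<in> I \<Longrightarrow> 0 \<le> w \<xi>"
  shows "wl2_le I w (\<lambda>\<xi>. b * c \<xi>) (cmod b * r)"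
  using assms by (intro wl2_le_dominated[OF assms(1)]) (auto simp: norm_mult)

lemma wl2_le_diff:
  assumes "wl2_le I w c r" "wl2_le I w c' r'" "\<And>\<xi>. \<xi> \<in> I \<Longrightarrow> 0 \<le> w \<xi>"
  shows "wl2_le I w (\<lambda>\<xi>. c \<xi> - c' \<xi>) (r + r')"
  using wl2_le_add[OF assms(1) wl2_le_cmult[OF assms(2), where b="-1"] assms(3)] assms(3) by simp

lemma wl2_le_iff_sum:
  assumes "0 \<le> r"
  shows "wl2_le I (gweight lam s A) c r \<longleftrightarrow>
    (\<forall>F. finite F \<longrightarrow> F \<subseteq> I \<longrightarrow> (\<Sum>\<xi>\<in>F. exp (2 * A * bracket lam \<xi> powr (1/s)) * (cmod (c \<xi>))\<^sup>2) \<le> r\<^sup>2)"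
proof -
  have "(gweight lam s A \<xi> * cmod (c \<xi>))\<^sup>2 = exp (2 * A * bracket lam \<xi> powr (1/s)) * (cmod (c \<xi>))\<^sup>2" for \<xi>
    by (simp add: gweight_def power_mult_distrib exp_double[symmetric] mult.assoc)
  then have "L2_set (\<lambda>\<xi>. gweight lam s A \<xi> * cmod (c \<xi>)) F \<le> r \<longleftrightarrow>
      (\<Sum>\<xi>\<in>F. exp (2 * A * bracket lam \<xi> powr (1/s)) * (cmod (c \<xi>))\<^sup>2) \<le> r\<^sup>2" for F
    unfolding L2_set_def using assms by (auto simp: sqrt_le_D real_le_lsqrt real_sqrt_le_iff')
  then show ?thesis by (simp add: wl2_le_def)
qed

lemma gweight_nonneg: "gweight lam s A \<xi> \<ge> 0"
  by (simp add: gweight_def)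

lemma gweight_mono: "A \<le> A' \<Longrightarrow> gweight lam s A \<xi> \<le> gweight lam s A' \<xi>"
  by (auto simp: gweight_def intro!: mult_right_mono)

lemma gweight_add: "gweight lam s (A + B) \<xi> = gweight lam s A \<xi> * gweight lam s B \<xi>"
  by (simp add: gweight_def distrib_right exp_add)

lemma wl2_le_gweight_mono:
  assumes "wl2_le I (gweight lam s A') c r" "A \<le> A'"
  shows "wl2_le I (gweight lam s A) c r"
proof -
  have "wl2_le I (gweight lam s A) c (1 * r)"
    using assms(2) by (intro wl2_le_dominated[OF assms(1)])
      (auto intro!: gweight_nonneg mult_right_mono gweight_mono)
  then show ?thesis by simp
qed

lemma gevrey_stepI:
  assumes "f \<in> L2" "wl2_le I (gweight lam s A) (hfourier d f) r"
  shows "f \<in> gevrey_step I lam d s A" "gevrey_norm I lam d s A f \<le> r"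
proof -
  have r: "r \<ge> 0" using assms(2) by (rule wl2_le_nonneg)
  have *: "finite F \<Longrightarrow> F \<subseteq> I \<Longrightarrow>
      (\<Sum>\<xi>\<in>F. exp (2 * A * bracket lam \<xi> powr (1/s)) * (cmod (hfourier d f \<xi>))\<^sup>2) \<le> r\<^sup>2" for F
    using assms(2) r by (simp add: wl2_le_iff_sum)
  have sm: "(\<lambda>\<xi>. exp (2 * A * bracket lam \<xi> powr (1/s)) * (cmod (hfourier d f \<xi>))\<^sup>2) summable_on I"
    by (rule nonneg_bdd_above_summable_on) (auto intro!: bdd_aboveI[where M="r\<^sup>2"] *)
  show "f \<in> gevrey_step I lam d s A" using assms(1) sm by (simp add: gevrey_step_def)
  have "(\<Sum>\<^sub>\<infinity>\<xi>\<in>I. exp (2 * A * bracket lam \<xi> powr (1/s)) * (cmod (hfourier d f \<xi>))\<^sup>2) \<le> r\<^sup>2"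
    using sm by (rule infsum_le_finite_sums) (rule *)
  then show "gevrey_norm I lam d s A f \<le> r"
    unfolding gevrey_norm_def using r by (simp add: real_le_lsqrt real_sqrt_le_iff')
qed

lemma gevrey_stepD:
  assumes "f \<in> gevrey_step I lam d s A"
  shows "f \<in> L2" "wl2_le I (gweight lam s A) (hfourier d f) (gevrey_norm I lam d s A f)"
proof -
  show "f \<in> L2" using assms by (simp add: gevrey_step_def)
  have sm: "(\<lambda>\<xi>. exp (2 * A * bracket lam \<xi> powr (1/s)) * (cmod (hfourier d f \<xi>))\<^sup>2) summable_on I"
    using assms by (simp add: gevrey_step_def)
  have n: "0 \<le> gevrey_norm I lam d s A f" unfolding gevrey_norm_def
    by (intro real_sqrt_ge_zero infsum_nonneg) auto
  have sq: "(gevrey_norm I lam d s A f)\<^sup>2 =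
      (\<Sum>\<^sub>\<infinity>\<xi>\<in>I. exp (2 * A * bracket lam \<xi> powr (1/s)) * (cmod (hfourier d f \<xi>))\<^sup>2)"
    unfolding gevrey_norm_def by (intro real_sqrt_pow2 infsum_nonneg) auto
  show "wl2_le I (gweight lam s A) (hfourier d f) (gevrey_norm I lam d s A f)"
    unfolding wl2_le_iff_sum[OF n] sq
    by (intro allI impI finite_sum_le_infsum[OF sm]) auto
qed

lemma gevreyI:
  assumes "f \<in> L2" "A > 0" "wl2_le I (gweight lam s A) (hfourier d f) r"
  shows "f \<in> gevrey I lam d s"
  using gevrey_stepI(1)[OF assms(1,3)] assms(2) by (auto simp: gevrey_def)

lemma gevreyE:
  assumes "f \<in> gevrey I lam d s"
  obtains A r where "A > 0" "f \<in> L2" "wl2_le I (gweight lam s A) (hfourier d f) r"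
  using assms gevrey_stepD[of f I lam d s] by (auto simp: gevrey_def)

lemma gevrey_L2: "f \<in> gevrey I lam d s \<Longrightarrow> f \<in> L2"
  by (erule gevreyE)

lemma hfourier_zero_fun: "hfourier d (\<lambda>x. 0) = (\<lambda>\<xi>. 0)"
  by (auto simp: hfourier_def)

lemma wl2_le_zero: "0 \<le> r \<Longrightarrow> wl2_le I w (\<lambda>\<xi>. 0) r"
  by (auto simp: wl2_le_def L2_set_0')

lemma gevrey_zero: "(\<lambda>x. 0) \<in> gevrey I lam d s"
  by (rule gevreyI[where A=1 and r=0]) (auto simp: L2_zero hfourier_zero_fun wl2_le_zero)

lemma gevrey_lincomb:
  assumes d: "\<forall>\<xi>\<in>I. d \<xi> \<in> L2"
    and f: "f \<in> gevrey I lam d s" and g: "g \<in> gevrey I lam d s"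
  shows "(\<lambda>x. b * f x + c * g x) \<in> gevrey I lam d s"
proof -
  obtain A r where A: "A > 0" "f \<in> L2" "wl2_le I (gweight lam s A) (hfourier d f) r"
    using f by (rule gevreyE)
  obtain B r' where B: "B > 0" "g \<in> L2" "wl2_le I (gweight lam s B) (hfourier d g) r'"
    using g by (rule gevreyE)
  have 1: "wl2_le I (gweight lam s (min A B)) (hfourier d f) r"
    and 2: "wl2_le I (gweight lam s (min A B)) (hfourier d g) r'"
    using A(3) B(3) by (auto elim!: wl2_le_gweight_mono)
  have "wl2_le I (gweight lam s (min A B)) (\<lambda>\<xi>. b * hfourier d f \<xi> + c * hfourier d g \<xi>) (cmod b * r + cmod c * r')"
    by (intro wl2_le_add wl2_le_cmult 1 2 gweight_nonneg)
  also have "?this \<longleftrightarrow> wl2_le I (gweight lam s (min A B)) (hfourier d (\<lambda>x. b * f x + c * g x)) (cmod b * r + cmod c * r')"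
    using A(2) B(2) d by (intro wl2_le_cong) (simp add: hfourier_lincomb)
  finally show ?thesis
    using A B by (intro gevreyI[where A="min A B"]) (auto intro!: L2_lincomb)
qed

lemma gevrey_add:
  assumes "\<forall>\<xi>\<in>I. d \<xi> \<in> L2" "f \<in> gevrey I lam d s" "g \<in> gevrey I lam d s"
  shows "(\<lambda>x. f x + g x) \<in> gevrey I lam d s"
  using gevrey_lincomb[OF assms, of 1 1] by simp

lemma gevrey_cmult:
  assumes "\<forall>\<xi>\<in>I. d \<xi> \<in> L2" "f \<in> gevrey I lam d s"
  shows "(\<lambda>x. b * f x) \<in> gevrey I lam d s"
  using gevrey_lincomb[OF assms assms(2), of b 0] by simp

section \<open>The inductive limit topology\<close>

text \<open>
  The weights for which the weighted square norm is finite and continuous on every step.  They supply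
  the continuous seminorms of the inductive limit by which curves are controlled.
\<close>

definition admissible_weight :: "'i set \<Rightarrow> ('i \<Rightarrow> complex) \<Rightarrow> real \<Rightarrow> ('i \<Rightarrow> real) \<Rightarrow> bool" where
  "admissible_weight I lam s w \<longleftrightarrow>
     (\<forall>\<xi>\<in>I. 0 \<le> w \<xi>) \<and> (\<forall>A>0. \<exists>C>0. \<forall>\<xi>\<in>I. w \<xi> \<le> C * gweight lam s A \<xi>)"

lemma wl2_le_admissible:
  assumes w: "admissible_weight I lam s w" and A: "A > 0"
  obtains C where "C > 0" "\<And>c r. wl2_le I (gweight lam s A) c r \<Longrightarrow> wl2_le I w c (C * r)"
proof -
  obtain C where C: "C > 0" "\<And>\<xi>. \<xi> \<in> I \<Longrightarrow> w \<xi> \<le> C * gweight lam s A \<xi>"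
    using w A unfolding admissible_weight_def by meson
  have "wl2_le I w c (C * r)" if "wl2_le I (gweight lam s A) c r" for c r
  proof (rule wl2_le_dominated[OF that])
    show "w \<xi> * cmod (c \<xi>) \<le> C * (gweight lam s A \<xi> * cmod (c \<xi>))" if "\<xi> \<in> I" for \<xi>
      using mult_right_mono[OF C(2)[OF that], of "cmod (c \<xi>)"] by (simp add: mult.assoc)
  qed (use C w in \<open>auto simp: admissible_weight_def\<close>)
  with C(1) show ?thesis by (rule that)
qed

lemma gevrey_nhd_wl2_ball:
  assumes d: "\<forall>\<xi>\<in>I. d \<xi> \<in> L2"
    and w: "admissible_weight I lam s w" and r: "r > 0"
  shows "gevrey_nhd I lam d s {g \<in> gevrey I lam d s. wl2_le I w (hfourier d g) r}"
  unfolding gevrey_nhd_def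
proof (intro conjI allI impI ballI)
  fix f g and b c :: complex
  assume f: "f \<in> {g \<in> gevrey I lam d s. wl2_le I w (hfourier d g) r}"
    and g: "g \<in> {g \<in> gevrey I lam d s. wl2_le I w (hfourier d g) r}" and bc: "cmod b + cmod c \<le> 1"
  have "wl2_le I w (\<lambda>\<xi>. b * hfourier d f \<xi> + c * hfourier d g \<xi>) (cmod b * r + cmod c * r)"
    using f g w by (intro wl2_le_add wl2_le_cmult) (auto simp: admissible_weight_def)
  moreover have "cmod b * r + cmod c * r \<le> r"
    using mult_right_mono[OF bc, of r] r by (simp add: distrib_right)
  ultimately have "wl2_le I w (\<lambda>\<xi>. b * hfourier d f \<xi> + c * hfourier d g \<xi>) r"
    by (rule wl2_le_mono)
  also have "?this \<longleftrightarrow> wl2_le I w (hfourier d (\<lambda>x. b * f x + c * g x)) r"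
    using f g d by (intro wl2_le_cong) (auto simp: hfourier_lincomb gevrey_L2)
  finally show "(\<lambda>x. b * f x + c * g x) \<in> {g \<in> gevrey I lam d s. wl2_le I w (hfourier d g) r}"
    using f g gevrey_lincomb[OF d] by auto
next
  fix A :: real assume A: "A > 0"
  obtain C where C: "C > 0" "\<And>c r. wl2_le I (gweight lam s A) c r \<Longrightarrow> wl2_le I w c (C * r)"
    using wl2_le_admissible[OF w A] by blast
  show "\<exists>r'>0. \<forall>f\<in>gevrey_step I lam d s A. gevrey_norm I lam d s A f < r' \<longrightarrow>
      f \<in> {g \<in> gevrey I lam d s. wl2_le I w (hfourier d g) r}"
  proof (intro exI[of _ "r / C"] conjI ballI impI)
    show "r / C > 0" using r C by simp
    fix f assume f: "f \<in> gevrey_step I lam d s A" "gevrey_norm I lam d s A f < r / C"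
    have "wl2_le I w (hfourier d f) (C * gevrey_norm I lam d s A f)"
      using gevrey_stepD(2)[OF f(1)] by (rule C(2))
    then have "wl2_le I w (hfourier d f) r"
      by (rule wl2_le_mono) (use f(2) C(1) in \<open>simp add: field_simps\<close>)
    then show "f \<in> {g \<in> gevrey I lam d s. wl2_le I w (hfourier d g) r}"
      using f(1) A by (auto simp: gevrey_def)
  qed
qed auto

lemma gevrey_nhd_subset: "gevrey_nhd I lam d s W \<Longrightarrow> W \<subseteq> gevrey I lam d s"
  by (simp add: gevrey_nhd_def)

lemma gevrey_nhd_lincomb:
  assumes "gevrey_nhd I lam d s W" "f \<in> W" "g \<in> W" "cmod b + cmod c \<le> 1"
  shows "(\<lambda>x. b * f x + c * g x) \<in> W"
proof -
  have "\<forall>f\<in>W. \<forall>g\<in>W. \<forall>b c. cmod b + cmod c \<le> 1 \<longrightarrow> (\<lambda>x. b * f x + c * g x) \<in> W"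
    using assms(1) unfolding gevrey_nhd_def by (elim conjE)
  from this[rule_format, OF assms(2-4)] show ?thesis .
qed

lemma gevrey_nhd_absorbs_step:
  assumes "gevrey_nhd I lam d s W" "A > 0"
  obtains r where "r > 0"
    "\<And>f. f \<in> gevrey_step I lam d s A \<Longrightarrow> gevrey_norm I lam d s A f < r \<Longrightarrow> f \<in> W"
proof -
  have "\<forall>A>0. \<exists>r>0. \<forall>f\<in>gevrey_step I lam d s A. gevrey_norm I lam d s A f < r \<longrightarrow> f \<in> W"
    using assms(1) unfolding gevrey_nhd_def by (elim conjE)
  with assms(2) that show ?thesis by metis
qed

lemma gevrey_nhd_gevrey:
  assumes "\<forall>\<xi>\<in>I. d \<xi> \<in> L2"
  shows "gevrey_nhd I lam d s (gevrey I lam d s)"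
  unfolding gevrey_nhd_def
proof (intro conjI allI impI ballI)
  show "(\<lambda>x. b * f x + c * g x) \<in> gevrey I lam d s"
    if "f \<in> gevrey I lam d s" "g \<in> gevrey I lam d s" for f g b c
    by (rule gevrey_lincomb[OF assms that])
  show "\<exists>r>0. \<forall>f\<in>gevrey_step I lam d s A. gevrey_norm I lam d s A f < r \<longrightarrow> f \<in> gevrey I lam d s"
    if "A > 0" for A
    using that by (intro exI[of _ 1]) (auto simp: gevrey_def)
qed simp

lemma topspace_gevrey_topology:
  assumes d: "\<forall>\<xi>\<in>I. d \<xi> \<in> L2"
  shows "topspace (gevrey_topology I lam d s) = gevrey I lam d s"
proof (rule antisym)
  show "topspace (gevrey_topology I lam d s) \<subseteq> gevrey I lam d s"
    using openin_topspace[of "gevrey_topology I lam d s"] unfolding openin_gevrey_topology by blast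
  have "openin (gevrey_topology I lam d s) (gevrey I lam d s)"
    unfolding openin_gevrey_topology
  proof (intro conjI ballI)
    show "\<exists>W. gevrey_nhd I lam d s W \<and> (\<forall>h\<in>W. (\<lambda>x. f x + h x) \<in> gevrey I lam d s)"
      if "f \<in> gevrey I lam d s" for f
      using gevrey_nhd_gevrey[OF d] gevrey_add[OF d that] by (intro exI[of _ "gevrey I lam d s"]) auto
  qed simp
  then show "gevrey I lam d s \<subseteq> topspace (gevrey_topology I lam d s)"
    by (rule openin_subset)
qed

lemma gevrey_nhd_scale:
  assumes d: "\<forall>\<xi>\<in>I. d \<xi> \<in> L2"
    and W: "gevrey_nhd I lam d s W" and \<theta>: "\<theta> > 0"
  shows "gevrey_nhd I lam d s {g. (\<lambda>x. g x / of_real \<theta>) \<in> W}"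
  unfolding gevrey_nhd_def
proof (intro conjI allI impI ballI subsetI)
  fix g assume "g \<in> {g. (\<lambda>x. g x / of_real \<theta>) \<in> W}"
  then have "(\<lambda>x. g x / of_real \<theta>) \<in> gevrey I lam d s"
    using gevrey_nhd_subset[OF W] by blast
  from gevrey_cmult[OF d this, of "of_real \<theta>"] show "g \<in> gevrey I lam d s"
    using \<theta> by simp
next
  fix f g and b c :: complex
  assume "f \<in> {g. (\<lambda>x. g x / of_real \<theta>) \<in> W}" "g \<in> {g. (\<lambda>x. g x / of_real \<theta>) \<in> W}"
    and bc: "cmod b + cmod c \<le> 1"
  then have "(\<lambda>x. b * (f x / of_real \<theta>) + c * (g x / of_real \<theta>)) \<in> W"
    using gevrey_nhd_lincomb[OF W _ _ bc] by blast
  then show "(\<lambda>x. b * f x + c * g x) \<in> {g. (\<lambda>x. g x / of_real \<theta>) \<in> W}"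
    by (simp add: add_divide_distrib)
next
  fix A :: real assume A: "A > 0"
  obtain r where r: "r > 0" "\<And>f. f \<in> gevrey_step I lam d s A \<Longrightarrow> gevrey_norm I lam d s A f < r \<Longrightarrow> f \<in> W"
    by (rule gevrey_nhd_absorbs_step[OF W A]) blast
  show "\<exists>r>0. \<forall>f\<in>gevrey_step I lam d s A. gevrey_norm I lam d s A f < r \<longrightarrow>
      f \<in> {g. (\<lambda>x. g x / of_real \<theta>) \<in> W}"
  proof (intro exI[of _ "\<theta> * r"] conjI ballI impI)
    show "\<theta> * r > 0" using r \<theta> by simp
    fix f assume f: "f \<in> gevrey_step I lam d s A" "gevrey_norm I lam d s A f < \<theta> * r"
    note fD = gevrey_stepD[OF f(1)]
    have "wl2_le I (gweight lam s A) (\<lambda>\<xi>. of_real (1/\<theta>) * hfourier d f \<xi>) (cmod (of_real (1/\<theta>)) * gevrey_norm I lam d s A f)"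
      by (intro wl2_le_cmult fD gweight_nonneg)
    also have "?this \<longleftrightarrow> wl2_le I (gweight lam s A) (hfourier d (\<lambda>x. f x / of_real \<theta>)) (cmod (of_real (1/\<theta>)) * gevrey_norm I lam d s A f)"
      using hfourier_lincomb[OF fD(1) fD(1), of d _ "of_real (1/\<theta>)" 0] d
      by (intro wl2_le_cong) (simp add: field_simps)
    finally have *: "wl2_le I (gweight lam s A) (hfourier d (\<lambda>x. f x / of_real \<theta>)) (cmod (of_real (1/\<theta>)) * gevrey_norm I lam d s A f)" .
    have "(\<lambda>x. f x / of_real \<theta>) \<in> L2"
      using L2_cmult[OF fD(1), of "of_real (1/\<theta>)"] by (simp add: field_simps)
    note ** = gevrey_stepI[OF this *]
    have "cmod (of_real (1/\<theta>)) * gevrey_norm I lam d s A f < r"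
      using f(2) \<theta> by (simp add: field_simps norm_divide)
    with ** r(2) show "f \<in> {g. (\<lambda>x. g x / of_real \<theta>) \<in> W}"
      by auto
  qed
qed

text \<open>
  A basic neighbourhood need not be open.  Its interior contains the points of gauge less than one:
  if \<open>g - g0 \<in> \<theta> W\<close> with \<open>\<theta> < 1\<close> then \<open>g - g0 + h \<in> (\<theta> + \<eta>) W\<close> for \<open>h \<in> \<eta> W\<close>, by convexity.
\<close>

lemma gevrey_nhd_interior:
  assumes d: "\<forall>\<xi>\<in>I. d \<xi> \<in> L2"
    and W: "gevrey_nhd I lam d s W" and g0: "g0 \<in> gevrey I lam d s"
  obtains U where "openin (gevrey_topology I lam d s) U" "g0 \<in> U" "\<And>g. g \<in> U \<Longrightarrow> (\<lambda>x. g x - g0 x) \<in> W"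
proof -
  \<comment> \<open>\<open>U\<close> consists of the points at which the gauge of \<open>W\<close>, centred at \<open>g0\<close>, is less than one.\<close>
  define U where "U = {g \<in> gevrey I lam d s. \<exists>\<theta>. 0 < \<theta> \<and> \<theta> < 1 \<and> (\<lambda>x. (g x - g0 x) / of_real \<theta>) \<in> W}"
  have conv: "(\<lambda>x. b * f x + c * g x) \<in> W" if "f \<in> W" "g \<in> W" "cmod b + cmod c \<le> 1" for f g b c
    by (rule gevrey_nhd_lincomb[OF W that])
  obtain r where r: "r > 0" "\<And>f. f \<in> gevrey_step I lam d s 1 \<Longrightarrow> gevrey_norm I lam d s 1 f < r \<Longrightarrow> f \<in> W"
    by (rule gevrey_nhd_absorbs_step[OF W zero_less_one]) blast
  have z: "(\<lambda>x. 0) \<in> W"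
    using gevrey_stepI[of "\<lambda>x. 0" I lam s 1 d 0] r by (auto simp: L2_zero hfourier_zero_fun wl2_le_zero)
  have "openin (gevrey_topology I lam d s) U"
    unfolding openin_gevrey_topology
  proof (intro conjI ballI)
    show "U \<subseteq> gevrey I lam d s" by (auto simp: U_def)
    fix g assume "g \<in> U"
    then obtain \<theta> where \<theta>: "0 < \<theta>" "\<theta> < 1" "(\<lambda>x. (g x - g0 x) / of_real \<theta>) \<in> W" and g: "g \<in> gevrey I lam d s"
      by (auto simp: U_def)
    define \<eta> where "\<eta> = (1 - \<theta>) / 2"
    have \<eta>: "\<eta> > 0" "\<theta> + \<eta> < 1" using \<theta> by (auto simp: \<eta>_def field_simps)
    let ?W = "{g. (\<lambda>x. g x / of_real \<eta>) \<in> W}"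
    have nW: "gevrey_nhd I lam d s ?W" by (rule gevrey_nhd_scale[OF d W \<eta>(1)])
    have "(\<lambda>x. g x + h x) \<in> U" if h: "h \<in> ?W" for h
    proof -
      have "h \<in> gevrey I lam d s" using gevrey_nhd_subset[OF nW] h by blast
      then have 1: "(\<lambda>x. g x + h x) \<in> gevrey I lam d s" by (rule gevrey_add[OF d g])
      have "(\<lambda>x. of_real (\<theta> / (\<theta> + \<eta>)) * ((g x - g0 x) / of_real \<theta>) + of_real (\<eta> / (\<theta> + \<eta>)) * (h x / of_real \<eta>)) \<in> W"
        using \<theta>(3) h \<theta>(1) \<eta>(1) by (intro conv) (auto simp: norm_divide simp flip: of_real_add add_divide_distrib)
      also have "(\<lambda>x. of_real (\<theta> / (\<theta> + \<eta>)) * ((g x - g0 x) / of_real \<theta>) + of_real (\<eta> / (\<theta> + \<eta>)) * (h x / of_real \<eta>))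
          = (\<lambda>x. (g x + h x - g0 x) / of_real (\<theta> + \<eta>))"
      proof
        fix x
        have nz: "complex_of_real \<theta> \<noteq> 0" "complex_of_real \<eta> \<noteq> 0" "complex_of_real (\<theta> + \<eta>) \<noteq> 0"
          using \<theta>(1) \<eta>(1) by (auto simp del: of_real_add)
        show "of_real (\<theta> / (\<theta> + \<eta>)) * ((g x - g0 x) / of_real \<theta>) + of_real (\<eta> / (\<theta> + \<eta>)) * (h x / of_real \<eta>)
          = (g x + h x - g0 x) / of_real (\<theta> + \<eta>)"
        proof -
          have "of_real (\<theta> / (\<theta> + \<eta>)) * ((g x - g0 x) / of_real \<theta>) = (g x - g0 x) / of_real (\<theta> + \<eta>)"
            and "of_real (\<eta> / (\<theta> + \<eta>)) * (h x / of_real \<eta>) = h x / of_real (\<theta> + \<eta>)"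
            using nz by (simp_all del: of_real_add)
          then show ?thesis by (simp add: add_divide_distrib diff_divide_distrib del: of_real_add)
        qed
      qed
      finally show ?thesis
        unfolding U_def using 1 \<theta> \<eta> by (auto intro!: exI[of _ "\<theta> + \<eta>"])
    qed
    with nW show "\<exists>W. gevrey_nhd I lam d s W \<and> (\<forall>h\<in>W. (\<lambda>x. g x + h x) \<in> U)" by blast
  qed
  moreover have "g0 \<in> U" unfolding U_def using g0 z by (auto intro!: exI[of _ "1/2"])
  moreover have "(\<lambda>x. g x - g0 x) \<in> W" if gU: "g \<in> U" for g
  proof -
    obtain \<theta> where \<theta>: "0 < \<theta>" "\<theta> < 1" "(\<lambda>x. (g x - g0 x) / of_real \<theta>) \<in> W"
      using gU by (auto simp: U_def)
    have "(\<lambda>x. of_real \<theta> * ((g x - g0 x) / of_real \<theta>) + 0 * ((g x - g0 x) / of_real \<theta>)) \<in> W"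
      using \<theta> by (intro conv) auto
    then show ?thesis using \<theta>(1) by simp
  qed
  ultimately show ?thesis by (rule that)
qed

text \<open>
  Convergence can be tested on the translated basic neighbourhoods, so that openness need not be
  considered again.
\<close>

lemma limitin_gevrey_topology:
  assumes d: "\<forall>\<xi>\<in>I. d \<xi> \<in> L2"
  shows "limitin (gevrey_topology I lam d s) \<phi> l \<F> \<longleftrightarrow>
    l \<in> gevrey I lam d s \<and> (\<forall>W. gevrey_nhd I lam d s W \<longrightarrow> (\<forall>\<^sub>F \<tau> in \<F>. (\<lambda>x. \<phi> \<tau> x - l x) \<in> W))"
    (is "?L \<longleftrightarrow> ?R")
proof
  assume L: ?L
  then have l: "l \<in> gevrey I lam d s" by (simp add: limitin_def topspace_gevrey_topology[OF d])
  moreover have "\<forall>\<^sub>F \<tau> in \<F>. (\<lambda>x. \<phi> \<tau> x - l x) \<in> W" if W: "gevrey_nhd I lam d s W" for W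
  proof -
    obtain U where U: "openin (gevrey_topology I lam d s) U" "l \<in> U" "\<And>g. g \<in> U \<Longrightarrow> (\<lambda>x. g x - l x) \<in> W"
      using gevrey_nhd_interior[OF d W l] by blast
    then have "\<forall>\<^sub>F \<tau> in \<F>. \<phi> \<tau> \<in> U" using L by (simp add: limitin_def)
    then show ?thesis by (rule eventually_mono) (rule U(3))
  qed
  ultimately show ?R by blast
next
  assume R: ?R
  show ?L unfolding limitin_def
  proof (intro conjI allI impI)
    show "l \<in> topspace (gevrey_topology I lam d s)" using R by (simp add: topspace_gevrey_topology[OF d])
    fix U assume U: "openin (gevrey_topology I lam d s) U \<and> l \<in> U"
    then obtain W where W: "gevrey_nhd I lam d s W" "\<And>h. h \<in> W \<Longrightarrow> (\<lambda>x. l x + h x) \<in> U"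
      unfolding openin_gevrey_topology by blast
    have "\<forall>\<^sub>F \<tau> in \<F>. (\<lambda>x. \<phi> \<tau> x - l x) \<in> W" using R W(1) by blast
    then show "\<forall>\<^sub>F \<tau> in \<F>. \<phi> \<tau> \<in> U"
      by (rule eventually_mono) (use W(2) in force)
  qed
qed

lemma limitin_gevrey_wl2:
  assumes d: "\<forall>\<xi>\<in>I. d \<xi> \<in> L2"
    and lim: "limitin (gevrey_topology I lam d s) \<phi> l \<F>"
    and w: "admissible_weight I lam s w" and e: "e > 0"
    and L2: "\<forall>\<^sub>F \<tau> in \<F>. \<phi> \<tau> \<in> L2"
  shows "\<forall>\<^sub>F \<tau> in \<F>. wl2_le I w (\<lambda>\<xi>. hfourier d (\<phi> \<tau>) \<xi> - hfourier d l \<xi>) e"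
proof -
  have l: "l \<in> gevrey I lam d s" using lim by (simp add: limitin_gevrey_topology[OF d])
  have "\<forall>\<^sub>F \<tau> in \<F>. (\<lambda>x. \<phi> \<tau> x - l x) \<in> {g \<in> gevrey I lam d s. wl2_le I w (hfourier d g) e}"
    using lim gevrey_nhd_wl2_ball[OF d w e] unfolding limitin_gevrey_topology[OF d] by blast
  with L2 show ?thesis
  proof eventually_elim
    case (elim \<tau>)
    have "wl2_le I w (hfourier d (\<lambda>x. \<phi> \<tau> x - l x)) e" using elim by simp
    also have "?this \<longleftrightarrow> ?case"
      using elim(1) d gevrey_L2[OF l] by (intro wl2_le_cong) (simp add: hfourier_diff)
    finally show ?case .
  qed
qed

lemma limitin_gevreyI:
  assumes d: "\<forall>\<xi>\<in>I. d \<xi> \<in> L2"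
    and l: "l \<in> gevrey I lam d s" and A: "A > 0"
    and L2: "\<forall>\<^sub>F \<tau> in \<F>. \<phi> \<tau> \<in> L2"
    and ev: "\<And>e. e > 0 \<Longrightarrow> \<forall>\<^sub>F \<tau> in \<F>. wl2_le I (gweight lam s A) (\<lambda>\<xi>. hfourier d (\<phi> \<tau>) \<xi> - hfourier d l \<xi>) e"
  shows "limitin (gevrey_topology I lam d s) \<phi> l \<F>"
  unfolding limitin_gevrey_topology[OF d]
proof (intro conjI allI impI)
  fix W assume W: "gevrey_nhd I lam d s W"
  obtain r where r: "r > 0" "\<And>f. f \<in> gevrey_step I lam d s A \<Longrightarrow> gevrey_norm I lam d s A f < r \<Longrightarrow> f \<in> W"
    by (rule gevrey_nhd_absorbs_step[OF W A]) blast
  have "\<forall>\<^sub>F \<tau> in \<F>. wl2_le I (gweight lam s A) (\<lambda>\<xi>. hfourier d (\<phi> \<tau>) \<xi> - hfourier d l \<xi>) (r/2)"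
    using r by (intro ev) simp
  with L2 show "\<forall>\<^sub>F \<tau> in \<F>. (\<lambda>x. \<phi> \<tau> x - l x) \<in> W"
  proof eventually_elim
    case (elim \<tau>)
    note elim(2)
    also have "wl2_le I (gweight lam s A) (\<lambda>\<xi>. hfourier d (\<phi> \<tau>) \<xi> - hfourier d l \<xi>) (r/2) \<longleftrightarrow>
        wl2_le I (gweight lam s A) (hfourier d (\<lambda>x. \<phi> \<tau> x - l x)) (r/2)"
      using elim(1) d gevrey_L2[OF l] by (intro wl2_le_cong) (simp add: hfourier_diff)
    finally have "wl2_le I (gweight lam s A) (hfourier d (\<lambda>x. \<phi> \<tau> x - l x)) (r/2)" .
    from gevrey_stepI[OF L2_diff[OF elim(1) gevrey_L2[OF l]] this] show ?case
      using r by auto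
  qed
qed (rule l)

section \<open>Continuous curves lie in a single step\<close>

lemma nhdsin_euclidean: "nhdsin euclidean a = nhds a"
  by (simp add: nhdsin_def nhds_def open_openin[symmetric])

lemma time_continuous_iff:
  "time_continuous T G v \<longleftrightarrow> (\<forall>t\<in>{0..T}. limitin G v (v t) (at t within {0..T}))"
proof -
  have "atin (top_of_set {0..T}) t = at t within {0..T}" if "t \<in> {0..T}" for t :: real
    unfolding atin_subtopology_within[OF that]
    by (simp add: atin_within_def at_within_def nhdsin_euclidean)
  then show ?thesis
    unfolding time_continuous_def continuous_map_atin by simp
qed

lemma time_continuous_gevrey:
  assumes d: "\<forall>\<xi>\<in>I. d \<xi> \<in> L2" and f: "time_continuous T (gevrey_topology I lam d s) f" and t: "t \<in> {0..T}"
  shows "f t \<in> gevrey I lam d s"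
  using f t unfolding time_continuous_iff limitin_gevrey_topology[OF d] by blast

lemma time_continuous_wl2:
  assumes d: "\<forall>\<xi>\<in>I. d \<xi> \<in> L2" and f: "time_continuous T (gevrey_topology I lam d s) f"
    and w: "admissible_weight I lam s w" and t: "t \<in> {0..T}" and e: "e > 0"
  obtains \<delta> where "\<delta> > 0"
    "\<And>t'. t' \<in> {0..T} \<Longrightarrow> \<bar>t' - t\<bar> < \<delta> \<Longrightarrow> wl2_le I w (\<lambda>\<xi>. hfourier d (f t') \<xi> - hfourier d (f t) \<xi>) e"
proof -
  have "\<forall>\<^sub>F t' in at t within {0..T}. f t' \<in> L2"
    using gevrey_L2[OF time_continuous_gevrey[OF d f]] by (auto simp: eventually_at_filter)
  then have "\<forall>\<^sub>F t' in at t within {0..T}. wl2_le I w (\<lambda>\<xi>. hfourier d (f t') \<xi> - hfourier d (f t) \<xi>) e"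
    using f t e by (intro limitin_gevrey_wl2[OF d _ w]) (auto simp: time_continuous_iff)
  then obtain \<delta> where \<delta>: "\<delta> > 0" "\<And>t'. t' \<in> {0..T} \<Longrightarrow> t' \<noteq> t \<Longrightarrow> dist t' t < \<delta> \<Longrightarrow>
      wl2_le I w (\<lambda>\<xi>. hfourier d (f t') \<xi> - hfourier d (f t) \<xi>) e"
    unfolding eventually_at by blast
  show ?thesis
  proof
    show "wl2_le I w (\<lambda>\<xi>. hfourier d (f t') \<xi> - hfourier d (f t) \<xi>) e"
      if "t' \<in> {0..T}" "\<bar>t' - t\<bar> < \<delta>" for t'
      using \<delta>(2)[of t'] that e by (cases "t' = t") (auto simp: dist_real_def wl2_le_zero)
  qed (rule \<delta>(1))
qed

lemma time_continuous_wl2_bounded: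
  assumes d: "\<forall>\<xi>\<in>I. d \<xi> \<in> L2" and f: "time_continuous T (gevrey_topology I lam d s) f"
    and w: "admissible_weight I lam s w"
  obtains C where "\<And>t. t \<in> {0..T} \<Longrightarrow> wl2_le I w (hfourier d (f t)) C"
proof (rule ccontr)
  assume "\<not> thesis"
  then have "\<forall>n::nat. \<exists>t\<in>{0..T}. \<not> wl2_le I w (hfourier d (f t)) (real n)" using that by blast
  then obtain t where t: "\<And>n. t n \<in> {0..T}" "\<And>n. \<not> wl2_le I w (hfourier d (f (t n))) (real n)" by metis
  obtain l r where l: "l \<in> {0..T}" and r: "strict_mono r" and lim: "(t \<circ> r) \<longlonglongrightarrow> l"
    using compact_Icc[of 0 T] t(1) unfolding compact_eq_seq_compact_metric seq_compact_def by metis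
  obtain A C0 where A: "A > 0" "wl2_le I (gweight lam s A) (hfourier d (f l)) C0"
    using time_continuous_gevrey[OF d f l] by (rule gevreyE)
  obtain K where K: "K > 0" "\<And>c r. wl2_le I (gweight lam s A) c r \<Longrightarrow> wl2_le I w c (K * r)"
    using wl2_le_admissible[OF w A(1)] by blast
  obtain \<delta> where \<delta>: "\<delta> > 0"
    "\<And>t'. t' \<in> {0..T} \<Longrightarrow> \<bar>t' - l\<bar> < \<delta> \<Longrightarrow> wl2_le I w (\<lambda>\<xi>. hfourier d (f t') \<xi> - hfourier d (f l) \<xi>) 1"
    using time_continuous_wl2[OF d f w l, of 1] by auto
  have "\<forall>\<^sub>F n in sequentially. dist ((t \<circ> r) n) l < \<delta>"
    using lim \<delta>(1) by (rule tendstoD)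
  moreover have "\<forall>\<^sub>F n in sequentially. real n \<ge> 1 + K * C0"
    by (rule eventually_sequentiallyI[of "nat \<lceil>1 + K * C0\<rceil>"]) linarith
  ultimately have "\<forall>\<^sub>F n in sequentially. dist ((t \<circ> r) n) l < \<delta> \<and> real n \<ge> 1 + K * C0"
    by (rule eventually_conj)
  then obtain n where n: "dist (t (r n)) l < \<delta>" "real n \<ge> 1 + K * C0"
    by (auto dest: eventually_happens)
  have "wl2_le I w (\<lambda>\<xi>. (hfourier d (f (t (r n))) \<xi> - hfourier d (f l) \<xi>) + hfourier d (f l) \<xi>) (1 + K * C0)"
    using w n(1) t(1) by (intro wl2_le_add \<delta>(2) K(2) A(2)) (auto simp: dist_real_def admissible_weight_def)
  then have "wl2_le I w (hfourier d (f (t (r n)))) (1 + K * C0)" by simp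
  then have "wl2_le I w (hfourier d (f (t (r n)))) (real (r n))"
    by (rule wl2_le_mono) (use n(2) seq_suble[OF r, of n] in linarith)
  with t(2) show False by blast
qed

lemma gweight_ge_1: "A \<ge> 0 \<Longrightarrow> gweight lam s A \<xi> \<ge> 1"
  by (simp add: gweight_def)

text \<open>
  Suppose that the curve is unbounded in the step with exponent \<open>1 / Suc n\<close> for every \<open>n\<close>, the finite
  set \<open>F n\<close> witnessing a norm above \<open>(Suc n)\<^sup>2\<close> at time \<open>t n\<close>.  The pointwise supremum \<open>w\<close> of the weights
  \<open>exp (\<langle>\<xi>\<rangle> powr (1/s) / Suc n) / Suc n\<close> on \<open>F n\<close> is admissible: for a given exponent \<open>A\<close>, all but finitely
  many of them are below \<open>exp (A * \<langle>\<xi>\<rangle> powr (1/s))\<close>, and the others live on finite sets.  But the curve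
  is unbounded for the weight \<open>w\<close>, contrary to compactness of the time interval.
\<close>

lemma time_continuous_step_bounded:
  assumes d: "\<forall>\<xi>\<in>I. d \<xi> \<in> L2" and f: "time_continuous T (gevrey_topology I lam d s) f"
  obtains A S where "A > 0" "\<And>t. t \<in> {0..T} \<Longrightarrow> wl2_le I (gweight lam s A) (hfourier d (f t)) S"
proof (rule ccontr)
  assume *: "\<not> thesis"
  have "\<exists>t\<in>{0..T}. \<exists>F. finite F \<and> F \<subseteq> I \<and>
      L2_set (\<lambda>\<xi>. gweight lam s (1 / Suc n) \<xi> * cmod (hfourier d (f t) \<xi>)) F > (Suc n)\<^sup>2" for n :: nat
  proof (rule ccontr)
    assume "\<not> ?thesis"
    then have "wl2_le I (gweight lam s (1 / Suc n)) (hfourier d (f t)) ((Suc n)\<^sup>2)" if "t \<in> {0..T}" for t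
      using that unfolding wl2_le_def by (auto simp: not_less)
    with * that[of "1 / Suc n" "(Suc n)\<^sup>2"] show False by simp
  qed
  then obtain t F where t: "\<And>n. t n \<in> {0..T}" and F: "\<And>n. finite (F n)" "\<And>n. F n \<subseteq> I"
    "\<And>n. L2_set (\<lambda>\<xi>. gweight lam s (1 / Suc n) \<xi> * cmod (hfourier d (f (t n)) \<xi>)) (F n) > (Suc n)\<^sup>2"
    by metis
  define v where "v = (\<lambda>n \<xi>. if \<xi> \<in> F n then gweight lam s (1 / Suc n) \<xi> / Suc n else 0)"
  define w where "w = (\<lambda>\<xi>. SUP n. v n \<xi>)"
  have v0: "v n \<xi> \<ge> 0" for n \<xi> by (simp add: v_def gweight_nonneg)
  have vle: "v n \<xi> \<le> gweight lam s (1 / Suc n) \<xi>" for n \<xi>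
    using gweight_nonneg[of lam s "1 / Suc n" \<xi>] by (auto simp: v_def divide_le_eq mult_le_cancel_left1)
  have v1: "v n \<xi> \<le> gweight lam s 1 \<xi>" for n \<xi>
    using vle[of n \<xi>] gweight_mono[of "1 / Suc n" 1 lam s \<xi>] by simp
  have bdd: "bdd_above (range (\<lambda>n. v n \<xi>))" for \<xi>
    using v1 by (auto intro!: bdd_aboveI[where M="gweight lam s 1 \<xi>"])
  have vw: "v n \<xi> \<le> w \<xi>" for n \<xi> unfolding w_def by (rule cSUP_upper[OF UNIV_I bdd])
  have adm: "admissible_weight I lam s w"
    unfolding admissible_weight_def
  proof (intro conjI ballI allI impI)
    show "0 \<le> w \<xi>" for \<xi> using v0[of 0 \<xi>] vw[of 0 \<xi>] by linarith
    fix A :: real assume A: "A > 0"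
    obtain N :: nat where N: "1 / A < real N" using reals_Archimedean2 by blast
    define C where "C = 1 + (\<Sum>n<N. \<Sum>\<eta>\<in>F n. gweight lam s 1 \<eta>)"
    have C1: "C \<ge> 1" by (simp add: C_def sum_nonneg gweight_nonneg)
    have "w \<xi> \<le> C * gweight lam s A \<xi>" for \<xi>
      unfolding w_def
    proof (rule cSUP_least)
      fix n :: nat
      show "v n \<xi> \<le> C * gweight lam s A \<xi>"
      proof (cases "n < N")
        case False
        then have "1 / Suc n \<le> A" using N A by (simp add: field_simps) (smt (verit) mult_left_mono of_nat_le_iff not_less)
        then have "v n \<xi> \<le> gweight lam s A \<xi>" using vle[of n \<xi>] gweight_mono[of "1/Suc n" A lam s \<xi>] by linarith
        also have "\<dots> \<le> C * gweight lam s A \<xi>"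
          using C1 gweight_nonneg[of lam s A \<xi>] by (simp add: mult_le_cancel_right1)
        finally show ?thesis .
      next
        case True
        have "v n \<xi> \<le> (\<Sum>\<eta>\<in>F n. gweight lam s 1 \<eta>)"
        proof (cases "\<xi> \<in> F n")
          case True
          have "v n \<xi> \<le> gweight lam s 1 \<xi>" by (rule v1)
          also have "\<dots> \<le> (\<Sum>\<eta>\<in>F n. gweight lam s 1 \<eta>)"
            using True F(1) by (intro member_le_sum) (auto intro: gweight_nonneg)
          finally show ?thesis .
        qed (auto simp: v_def intro!: sum_nonneg gweight_nonneg)
        also have "\<dots> \<le> (\<Sum>n<N. \<Sum>\<eta>\<in>F n. gweight lam s 1 \<eta>)"
          using True by (intro member_le_sum[where f="\<lambda>n. \<Sum>\<eta>\<in>F n. gweight lam s 1 \<eta>"]) (auto intro!: sum_nonneg gweight_nonneg)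
        also have "\<dots> \<le> C" by (simp add: C_def)
        also have "\<dots> \<le> C * gweight lam s A \<xi>"
          using C1 gweight_ge_1[of A lam s \<xi>] A by (simp add: mult_le_cancel_left1)
        finally show ?thesis .
      qed
    qed simp
    then show "\<exists>C>0. \<forall>\<xi>\<in>I. w \<xi> \<le> C * gweight lam s A \<xi>"
      using C1 by (intro exI[of _ C]) auto
  qed
  obtain C where C: "\<And>t. t \<in> {0..T} \<Longrightarrow> wl2_le I w (hfourier d (f t)) C"
    using time_continuous_wl2_bounded[OF d f adm] by blast
  obtain n :: nat where n: "C < real n" using reals_Archimedean2 by blast
  have "real (Suc n) < L2_set (\<lambda>\<xi>. gweight lam s (1 / Suc n) \<xi> * cmod (hfourier d (f (t n)) \<xi>)) (F n) * (1 / Suc n)"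
    using F(3)[of n] by (simp add: field_simps power2_eq_square)
  also have "\<dots> = L2_set (\<lambda>\<xi>. v n \<xi> * cmod (hfourier d (f (t n)) \<xi>)) (F n)"
    by (subst L2_set_left_distrib) (auto simp: v_def intro!: L2_set_cong)
  also have "\<dots> \<le> L2_set (\<lambda>\<xi>. w \<xi> * cmod (hfourier d (f (t n)) \<xi>)) (F n)"
    using v0 vw by (intro L2_set_mono mult_right_mono) auto
  also have "\<dots> \<le> C" by (rule wl2_leD[OF C[OF t] F(1,2)])
  finally show False using n by simp
qed

lemma wl2_le_weight_add:
  assumes "wl2_le I w c r" "wl2_le I w' c r'" "\<And>\<xi>. \<xi> \<in> I \<Longrightarrow> 0 \<le> v \<xi>" "\<And>\<xi>. \<xi> \<in> I \<Longrightarrow> v \<xi> \<le> w \<xi> + w' \<xi>"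
  shows "wl2_le I v c (r + r')"
proof (rule wl2_leI)
  fix F assume F: "finite F" "F \<subseteq> I"
  have "L2_set (\<lambda>\<xi>. v \<xi> * cmod (c \<xi>)) F \<le> L2_set (\<lambda>\<xi>. w \<xi> * cmod (c \<xi>) + w' \<xi> * cmod (c \<xi>)) F"
    using F assms(3,4) by (intro L2_set_mono) (auto simp: distrib_right[symmetric] intro!: mult_right_mono)
  also have "\<dots> \<le> L2_set (\<lambda>\<xi>. w \<xi> * cmod (c \<xi>)) F + L2_set (\<lambda>\<xi>. w' \<xi> * cmod (c \<xi>)) F"
    by (rule L2_set_triangle_ineq)
  also have "\<dots> \<le> r + r'"
    using wl2_leD[OF assms(1) F] wl2_leD[OF assms(2) F] by simp
  finally show "L2_set (\<lambda>\<xi>. v \<xi> * cmod (c \<xi>)) F \<le> r + r'" .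
qed

text \<open>
  The weight of the smaller step, cut off where \<open>\<langle>\<xi>\<rangle> powr (1/s) > R\<close>, is bounded and therefore
  admissible; beyond the cut-off it is at most \<open>exp (- (A - B) * R)\<close> times the weight of the step in
  which the curve is bounded.
\<close>

lemma time_continuous_step_continuous:
  assumes d: "\<forall>\<xi>\<in>I. d \<xi> \<in> L2" and f: "time_continuous T (gevrey_topology I lam d s) f"
    and S: "\<And>t. t \<in> {0..T} \<Longrightarrow> wl2_le I (gweight lam s A) (hfourier d (f t)) S"
    and A: "0 \<le> B" "B < A" and t: "t \<in> {0..T}" and e: "e > 0"
  obtains \<delta> where "\<delta> > 0" "\<And>t'. t' \<in> {0..T} \<Longrightarrow> \<bar>t' - t\<bar> < \<delta> \<Longrightarrow>
      wl2_le I (gweight lam s B) (\<lambda>\<xi>. hfourier d (f t') \<xi> - hfourier d (f t) \<xi>) e"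
proof -
  have S0: "S \<ge> 0" using S[OF t] by (rule wl2_le_nonneg)
  have "((\<lambda>R. exp (- ((A - B) * R)) * (S + S)) \<longlongrightarrow> 0 * (S + S)) at_top"
    using A by (intro tendsto_intros filterlim_compose[OF exp_at_bot] filterlim_uminus_at_top[THEN iffD1])
      (auto simp: filterlim_ident intro!: filterlim_tendsto_pos_mult_at_top[OF tendsto_const])
  then have "\<forall>\<^sub>F R in at_top. exp (- ((A - B) * R)) * (S + S) < e / 2"
    using e by (intro order_tendstoD(2)) auto
  then obtain R where R: "exp (- ((A - B) * R)) * (S + S) < e / 2"
    by (auto dest: eventually_happens)
  define w where "w = (\<lambda>\<xi>. if bracket lam \<xi> powr (1/s) \<le> R then gweight lam s B \<xi> else 0)"
  have "admissible_weight I lam s w"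
    unfolding admissible_weight_def
  proof (intro conjI ballI allI impI)
    show "0 \<le> w \<xi>" for \<xi> by (simp add: w_def gweight_nonneg)
    fix A' :: real assume A': "A' > 0"
    have "w \<xi> \<le> exp (B * R) * gweight lam s A' \<xi>" for \<xi>
    proof -
      have "w \<xi> \<le> exp (B * R) * 1" using A by (auto simp: w_def gweight_def mult_left_mono)
      also have "\<dots> \<le> exp (B * R) * gweight lam s A' \<xi>"
        using gweight_ge_1[of A' lam s \<xi>] A' by (intro mult_left_mono) auto
      finally show ?thesis .
    qed
    then show "\<exists>C>0. \<forall>\<xi>\<in>I. w \<xi> \<le> C * gweight lam s A' \<xi>" by (intro exI[of _ "exp (B * R)"]) auto
  qed
  then obtain \<delta> where \<delta>: "\<delta> > 0" "\<And>t'. t' \<in> {0..T} \<Longrightarrow> \<bar>t' - t\<bar> < \<delta> \<Longrightarrow>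
      wl2_le I w (\<lambda>\<xi>. hfourier d (f t') \<xi> - hfourier d (f t) \<xi>) (e / 2)"
    using time_continuous_wl2[OF d f _ t, of w "e / 2"] e by auto
  show ?thesis
  proof (rule that[OF \<delta>(1)])
    fix t' assume t': "t' \<in> {0..T}" "\<bar>t' - t\<bar> < \<delta>"
    let ?c = "\<lambda>\<xi>. hfourier d (f t') \<xi> - hfourier d (f t) \<xi>"
    have "wl2_le I (gweight lam s A) ?c (S + S)"
      by (intro wl2_le_diff S t t' gweight_nonneg)
    then have "wl2_le I (\<lambda>\<xi>. exp (- ((A - B) * R)) * gweight lam s A \<xi>) ?c (exp (- ((A - B) * R)) * (S + S))"
      by (rule wl2_le_dominated) (auto simp: gweight_nonneg mult.assoc)
    then have "wl2_le I (gweight lam s B) ?c (e / 2 + exp (- ((A - B) * R)) * (S + S))"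
    proof (rule wl2_le_weight_add[OF \<delta>(2)[OF t']])
      fix \<xi>
      show "gweight lam s B \<xi> \<le> w \<xi> + exp (- ((A - B) * R)) * gweight lam s A \<xi>"
      proof (cases "bracket lam \<xi> powr (1/s) \<le> R")
        case False
        have "gweight lam s B \<xi> \<le> exp (- ((A - B) * R)) * gweight lam s A \<xi>"
          using mult_left_mono[of R "bracket lam \<xi> powr (1/s)" "A - B"] False A
          by (simp add: gweight_def exp_add[symmetric] algebra_simps)
        then show ?thesis using False by (simp add: w_def)
      qed (simp add: w_def gweight_nonneg)
    qed (rule gweight_nonneg)
    then show "wl2_le I (gweight lam s B) ?c e"
      by (rule wl2_le_mono) (use R in simp)
  qed
qed

lemma bounded_in_gevreyI:
  assumes d: "\<forall>\<xi>\<in>I. d \<xi> \<in> L2" and A: "A > 0"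
    and B: "\<And>g. g \<in> B \<Longrightarrow> g \<in> L2" "\<And>g. g \<in> B \<Longrightarrow> wl2_le I (gweight lam s A) (hfourier d g) S"
  shows "bounded_in (gevrey_topology I lam d s) B"
  unfolding bounded_in_def topspace_gevrey_topology[OF d]
proof (intro conjI allI impI)
  show "B \<subseteq> gevrey I lam d s" using gevreyI[OF B(1) A B(2)] by blast
  fix U assume U: "openin (gevrey_topology I lam d s) U \<and> (\<lambda>x. 0) \<in> U"
  then obtain W where W: "gevrey_nhd I lam d s W" "\<And>h. h \<in> W \<Longrightarrow> (\<lambda>x. 0 + h x) \<in> U"
    unfolding openin_gevrey_topology by blast
  obtain r where r: "r > 0" "\<And>f. f \<in> gevrey_step I lam d s A \<Longrightarrow> gevrey_norm I lam d s A f < r \<Longrightarrow> f \<in> W"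
    by (rule gevrey_nhd_absorbs_step[OF W(1) A]) blast
  define \<theta> where "\<theta> = (\<bar>S\<bar> + 1) / r"
  have \<theta>: "\<theta> > 0" "\<bar>S\<bar> / \<theta> < r" using r(1) by (auto simp: \<theta>_def field_simps)
  have "(\<lambda>x. f x / of_real \<theta>) \<in> U" if f: "f \<in> B" for f
  proof -
    have fL: "(\<lambda>x. of_real (1/\<theta>) * f x) \<in> L2" using B(1)[OF f] by (rule L2_cmult)
    have "wl2_le I (gweight lam s A) (\<lambda>\<xi>. of_real (1/\<theta>) * hfourier d f \<xi>) (cmod (of_real (1/\<theta>)) * S)"
      by (intro wl2_le_cmult B(2)[OF f] gweight_nonneg)
    also have "?this \<longleftrightarrow> wl2_le I (gweight lam s A) (hfourier d (\<lambda>x. of_real (1/\<theta>) * f x)) (cmod (of_real (1/\<theta>)) * S)"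
      using hfourier_lincomb[OF B(1)[OF f] B(1)[OF f], of d _ "of_real (1/\<theta>)" 0] d
      by (intro wl2_le_cong) simp
    finally have "wl2_le I (gweight lam s A) (hfourier d (\<lambda>x. of_real (1/\<theta>) * f x)) (cmod (of_real (1/\<theta>)) * S)" .
    note * = gevrey_stepI[OF fL this]
    have "cmod (of_real (1/\<theta>)) * S \<le> \<bar>S\<bar> / \<theta>" using \<theta>(1) by (simp add: norm_divide divide_right_mono)
    then have "(\<lambda>x. of_real (1/\<theta>) * f x) \<in> W" using * \<theta>(2) by (intro r(2)) auto
    from W(2)[OF this] show ?thesis by (simp add: field_simps)
  qed
  with \<theta>(1) show "\<exists>r>0. \<forall>f\<in>B. (\<lambda>x. f x / complex_of_real r) \<in> U" by blast
qed

section \<open>The energy estimate for a single mode\<close>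

text \<open>
  A mean value inequality without differentiability of \<open>g\<close>: at each point \<open>g\<close> is touched from above by
  a function with nonpositive right derivative.  If \<open>g\<close> stays below a line of slope \<open>e > 0\<close> up to \<open>c\<close>, the
  barrier at \<open>c\<close> carries this slightly beyond \<open>c\<close>.
\<close>

lemma nonincreasing_via_upper_barriers:
  fixes g :: "real \<Rightarrow> real"
  assumes ab: "a \<le> b" and cont: "continuous_on {a..b} g"
    and barrier: "\<And>t. a \<le> t \<Longrightarrow> t < b \<Longrightarrow> \<exists>U D. U t = g t \<and>
      (U has_real_derivative D) (at t within {t..b}) \<and> D \<le> 0 \<and> (\<forall>x\<in>{t..b}. g x \<le> U x)"
  shows "g b \<le> g a"
proof -
  \<comment> \<open>The slope \<open>e\<close> makes the inequality at the barrier strict, so that it persists to the right.\<close>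
  have "g b \<le> g a + e * (b - a)" if e: "e > 0" for e
  proof -
    define S where "S = {x \<in> {a..b}. g x \<le> g a + e * (x - a)}"
    have "closed S" unfolding S_def
      by (intro continuous_on_closed_Collect_le continuous_intros cont)
    moreover have "a \<in> S" using ab by (simp add: S_def)
    moreover have bdd: "bdd_above S" by (auto simp: S_def intro!: bdd_aboveI[where M=b])
    ultimately have c: "Sup S \<in> S" by (intro closed_contains_Sup) auto
    define c where "c = Sup S"
    have cS: "a \<le> c" "c \<le> b" "g c \<le> g a + e * (c - a)"
      using c by (auto simp: c_def S_def)
    have "c = b"
    proof (rule ccontr)
      assume "c \<noteq> b"
      then have cb: "c < b" using cS by simp
      obtain U D where U: "U c = g c" "(U has_real_derivative D) (at c within {c..b})" "D \<le> 0"
        "\<And>x. x \<in> {c..b} \<Longrightarrow> g x \<le> U x"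
        using barrier[OF cS(1) cb] by blast
      have "((\<lambda>x. (U x - U c) / (x - c)) \<longlongrightarrow> D) (at c within {c..b})"
        using U(2) by (simp add: has_field_derivative_iff)
      then have "\<forall>\<^sub>F x in at c within {c..b}. (U x - U c) / (x - c) < e"
        using U(3) e by (intro order_tendstoD(2)[where y=D]) auto
      then obtain \<delta> where \<delta>: "\<delta> > 0"
        "\<And>x. x \<in> {c..b} \<Longrightarrow> x \<noteq> c \<Longrightarrow> dist x c < \<delta> \<Longrightarrow> (U x - U c) / (x - c) < e"
        unfolding eventually_at by blast
      define x where "x = min b (c + \<delta> / 2)"
      have x: "x \<in> {c..b}" "x > c" "dist x c < \<delta>" using cb \<delta>(1) by (auto simp: x_def dist_real_def)
      have "(U x - U c) / (x - c) < e" using \<delta>(2) x by auto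
      then have "U x - U c < e * (x - c)" using x(2) by (simp add: divide_less_eq)
      then have "g x \<le> g a + e * (x - a)"
        using U(4)[OF x(1)] U(1) cS(3) by (simp add: algebra_simps)
      then have "x \<in> S" using x cS(1) by (simp add: S_def)
      then have "x \<le> c" unfolding c_def by (rule cSup_upper[OF _ bdd])
      with x(2) show False by simp
    qed
    with cS show ?thesis by simp
  qed
  note * = this
  show ?thesis
  proof (rule field_le_epsilon)
    fix e :: real assume e: "e > 0"
    have "g b \<le> g a + e / (b - a + 1) * (b - a)" using ab e by (intro *) simp
    also have "e / (b - a + 1) * (b - a) \<le> e" using ab e by (simp add: field_simps)
    finally show "g b \<le> g a + e" by simp
  qed
qed

lemma has_integral_subinterval:
  fixes g :: "real \<Rightarrow> 'a::banach"
  assumes "\<And>t. t \<in> {0..T} \<Longrightarrow> (g has_integral (Z t - Z 0)) {0..t}"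
    and "0 \<le> s" "s \<le> t" "t \<le> T"
  shows "(g has_integral (Z t - Z s)) {s..t}"
proof -
  have it: "(g has_integral (Z t - Z 0)) {0..t}" and is': "(g has_integral (Z s - Z 0)) {0..s}"
    using assms by auto
  have gi: "g integrable_on {0..t}" using it by blast
  have st: "g integrable_on {s..t}"
    using gi assms by (intro integrable_subinterval_real[OF gi]) auto
  have "integral {0..s} g + integral {s..t} g = integral {0..t} g"
    using assms gi by (intro Henstock_Kurzweil_Integration.integral_combine) auto
  then have "integral {s..t} g = Z t - Z s"
    using integral_unique[OF it] integral_unique[OF is'] by (simp add: algebra_simps)
  then show ?thesis using integrable_integral[OF st] by simp
qed

text \<open>
  \<open>b t\<close> is the mean of \<open>a\<close>, extended by constants, over \<open>[t, t + 1/L]\<close>.  By the mean value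
  theorem it is a value of the extended function at distance less than \<open>1/L\<close> from \<open>t\<close>, which gives its
  bounds; its derivative is the increment over this interval divided by the length.
\<close>

lemma hoelder_mollification:
  fixes a :: "real \<Rightarrow> real"
  assumes T: "T \<ge> 0" and al: "0 < \<alpha>" and L: "L \<ge> 1"
    and hoe: "\<And>t t'. t \<in> {0..T} \<Longrightarrow> t' \<in> {0..T} \<Longrightarrow> \<bar>a t - a t'\<bar> \<le> M * \<bar>t - t'\<bar> powr \<alpha>"
    and M: "M \<ge> 0"
    and bounds: "\<And>t. t \<in> {0..T} \<Longrightarrow> lo \<le> a t \<and> a t \<le> hi"
  obtains b b' where
    "\<And>t. t \<in> {0..T} \<Longrightarrow> (b has_real_derivative b' t) (at t)"
    "\<And>t. t \<in> {0..T} \<Longrightarrow> lo \<le> b t \<and> b t \<le> hi"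
    "\<And>t. t \<in> {0..T} \<Longrightarrow> \<bar>b t - a t\<bar> \<le> M * L powr (-\<alpha>)"
    "\<And>t. t \<in> {0..T} \<Longrightarrow> \<bar>b' t\<bar> \<le> M * L powr (1 - \<alpha>)"
proof -
  define cl where "cl = (\<lambda>t. max 0 (min T t))"
  define ac where "ac = (\<lambda>t. a (cl t))"
  have cl: "cl t \<in> {0..T}" for t using T by (auto simp: cl_def)
  have clid: "cl t = t" if "t \<in> {0..T}" for t using that by (auto simp: cl_def)
  have cll: "\<bar>cl t - cl t'\<bar> \<le> \<bar>t - t'\<bar>" for t t' by (auto simp: cl_def max_def min_def)
  have ach: "\<bar>ac t - ac t'\<bar> \<le> M * \<bar>t - t'\<bar> powr \<alpha>" for t t'
  proof -
    have "\<bar>ac t - ac t'\<bar> \<le> M * \<bar>cl t - cl t'\<bar> powr \<alpha>" unfolding ac_def by (intro hoe cl)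
    also have "\<dots> \<le> M * \<bar>t - t'\<bar> powr \<alpha>"
      using cll M al by (intro mult_left_mono powr_mono2) auto
    finally show ?thesis .
  qed
  have accont: "continuous_on X ac" for X
  proof -
    have "(ac \<longlongrightarrow> ac t) (at t)" for t
    proof (rule LIM_zero_cancel)
      show "((\<lambda>x. ac x - ac t) \<longlongrightarrow> 0) (at t)"
      proof (rule Lim_null_comparison)
        show "\<forall>\<^sub>F x in at t. norm (ac x - ac t) \<le> M * \<bar>x - t\<bar> powr \<alpha>"
          using ach by (intro always_eventually) auto
        have "((\<lambda>x. M * \<bar>x - t\<bar> powr \<alpha>) \<longlongrightarrow> M * \<bar>t - t\<bar> powr \<alpha>) (at t)"
          using al by (intro tendsto_intros) auto
        then show "((\<lambda>x. M * \<bar>x - t\<bar> powr \<alpha>) \<longlongrightarrow> 0) (at t)" by simp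
      qed
    qed
    then have "continuous (at t) ac" for t by (simp add: isCont_def)
    then show ?thesis by (simp add: continuous_at_imp_continuous_on)
  qed
  define P where "P = (\<lambda>t. integral {-1..t} ac)"
  have P: "(P has_real_derivative ac t) (at t)" if "-1 < t" "t < T + 2" for t
  proof -
    have "(P has_real_derivative ac t) (at t within {-1..T+2})"
      unfolding P_def using that by (intro integral_has_real_derivative accont) auto
    then show ?thesis using that by (subst (asm) at_within_interior) auto
  qed
  define h where "h = 1 / L"
  have h: "0 < h" "h \<le> 1" using L by (auto simp: h_def)
  define b where "b = (\<lambda>t. L * (P (t + h) - P t))"
  define b' where "b' = (\<lambda>t. L * (ac (t + h) - ac t))"
  have mean: "\<exists>c. t < c \<and> c < t + h \<and> b t = ac c" if t: "t \<in> {0..T}" for t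
  proof -
    have "\<exists>c>t. c < t + h \<and> P (t + h) - P t = (t + h - t) * ac c"
      using t h by (intro MVT2) (auto intro!: P)
    then show ?thesis using L by (auto simp: b_def h_def)
  qed
  have hL: "h powr \<alpha> = L powr (-\<alpha>)" using L by (simp add: h_def powr_divide powr_minus field_simps)
  show ?thesis
  proof
    fix t assume t: "t \<in> {0..T}"
    have P1: "(P has_real_derivative ac t) (at t)" using t by (intro P) auto
    have "((\<lambda>t. P (t + h)) has_real_derivative ac (t + h)) (at t)"
      unfolding DERIV_shift[symmetric] using t h by (intro P) auto
    then show "(b has_real_derivative b' t) (at t)"
      unfolding b_def b'_def using P1 by (intro DERIV_cmult DERIV_diff)
    obtain c where c: "t < c" "c < t + h" "b t = ac c" using mean[OF t] by blast
    show "lo \<le> b t \<and> b t \<le> hi" using bounds[OF cl[of c]] by (simp add: c(3) ac_def)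
    have "\<bar>b t - a t\<bar> = \<bar>ac c - ac t\<bar>" using clid[OF t] by (simp add: c(3) ac_def)
    also have "\<dots> \<le> M * \<bar>c - t\<bar> powr \<alpha>" by (rule ach)
    also have "\<dots> \<le> M * h powr \<alpha>" using c M al by (intro mult_left_mono powr_mono2) auto
    finally show "\<bar>b t - a t\<bar> \<le> M * L powr (-\<alpha>)" by (simp add: hL)
    have "\<bar>b' t\<bar> = L * \<bar>ac (t + h) - ac t\<bar>" using L by (simp add: b'_def abs_mult)
    also have "\<dots> \<le> L * (M * h powr \<alpha>)" using ach[of "t + h" t] h L by (intro mult_left_mono) auto
    also have "\<dots> = M * (L powr 1 * L powr (-\<alpha>))" using L by (simp add: hL)
    also have "\<dots> = M * L powr (1 - \<alpha>)" by (subst powr_add[symmetric]) simp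
    finally show "\<bar>b' t\<bar> \<le> M * L powr (1 - \<alpha>)" .
  qed
qed

text \<open>
  The algebra behind the energy estimate at a fixed time.  Here \<open>n\<close>, \<open>r\<close>, \<open>f\<close> stand for the moduli of
  \<open>y'\<close>, \<open>y\<close>, \<open>F\<close>, while \<open>zF\<close> and \<open>zy\<close> stand for the real inner products of \<open>y'\<close> with \<open>F\<close> and \<open>y\<close>.  Taking
  the square root \<open>L\<close> of \<open>1 + m\<close> also as the inverse length of averaging balances the two errors: both
  \<open>L\<^sup>2 |b - a| |zy|\<close> and \<open>|b'| L\<^sup>2 r\<^sup>2\<close> are at most a constant times \<open>L powr (1 - \<alpha>)\<close> times the energy.
\<close>

lemma energy_rate_bound:
  fixes n r f zF zy :: real
  assumes L: "L \<ge> 1" and m: "L\<^sup>2 = 1 + m" and a0: "a\<^sub>0 > 0" and \<kappa>: "\<kappa> = max 1 (1 / a\<^sub>0)"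
    and nn: "n \<ge> 0" "r \<ge> 0" "f \<ge> 0" "B \<ge> 0" "M \<ge> 0"
    and zF: "zF \<le> n * f" and zy: "\<bar>zy\<bar> \<le> n * r"
    and b: "a\<^sub>0 \<le> b" and a: "0 \<le> a" "a \<le> A1"
    and ba: "\<bar>b - a\<bar> \<le> M * L powr (-\<alpha>)" and b': "\<bar>b'\<bar> \<le> M * L powr (1 - \<alpha>)"
  shows "2 * zF - 2 * (a * m) * zy + 2 * B * (n * r) + (b' * L\<^sup>2 * r\<^sup>2 + 2 * b * L\<^sup>2 * zy)
    \<le> (\<kappa> * (2 * M * L powr (1 - \<alpha>) + A1 + B) + 1) * (n\<^sup>2 + b * L\<^sup>2 * r\<^sup>2) + f\<^sup>2"
proof -
  define E where "E = n\<^sup>2 + b * L\<^sup>2 * r\<^sup>2"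
  define p where "p = L powr (1 - \<alpha>)"
  have p0: "p \<ge> 0" by (simp add: p_def)
  have k1: "\<kappa> \<ge> 1" "\<kappa> * b \<ge> 1"
  proof -
    show "\<kappa> \<ge> 1" by (simp add: \<kappa>)
    have "1 = 1 / a\<^sub>0 * a\<^sub>0" using a0 by simp
    also have "\<dots> \<le> \<kappa> * b" using a0 b by (intro mult_mono) (auto simp: \<kappa>)
    finally show "\<kappa> * b \<ge> 1" .
  qed
  have 1: "n\<^sup>2 + L\<^sup>2 * r\<^sup>2 \<le> \<kappa> * E"
  proof -
    have "n\<^sup>2 \<le> \<kappa> * n\<^sup>2" using k1 by (simp add: mult_le_cancel_right1)
    moreover have "1 * (L\<^sup>2 * r\<^sup>2) \<le> (\<kappa> * b) * (L\<^sup>2 * r\<^sup>2)" using k1 by (intro mult_right_mono) auto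
    ultimately show ?thesis by (simp add: E_def algebra_simps)
  qed
  have 2: "2 * (L * (n * r)) \<le> \<kappa> * E"
    using 1 sum_squares_bound[of n "L * r"] by (simp add: power_mult_distrib algebra_simps)
  have 3: "2 * (n * r) \<le> \<kappa> * E"
  proof -
    have "1 * (n * r) \<le> L * (n * r)" using L nn by (intro mult_right_mono) auto
    then show ?thesis using 2 by simp
  qed
  have 4: "L\<^sup>2 * r\<^sup>2 \<le> \<kappa> * E" using 1 zero_le_power2[of n] by linarith
  have E0: "n\<^sup>2 \<le> E" using a0 b by (simp add: E_def)
  have LL: "L powr (-\<alpha>) * L\<^sup>2 = p * L"
  proof -
    have "L powr (-\<alpha>) * L\<^sup>2 = L powr (-\<alpha>) * L powr 2" using L by simp
    also have "\<dots> = L powr (-\<alpha> + 2)" by (rule powr_add[symmetric])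
    also have "\<dots> = p * L" using L by (simp add: p_def powr_add[symmetric] powr_mult_base mult.commute)
    finally show ?thesis .
  qed
  have c: "2 * b * L\<^sup>2 * zy - 2 * (a * m) * zy = 2 * ((b - a) * L\<^sup>2 + a) * zy"
    unfolding m by (simp add: algebra_simps)
  have "2 * ((b - a) * L\<^sup>2 + a) * zy \<le> 2 * (\<bar>(b - a) * L\<^sup>2 + a\<bar> * \<bar>zy\<bar>)"
    using abs_ge_self[of "((b - a) * L\<^sup>2 + a) * zy"] unfolding abs_mult by linarith
  also have "\<dots> \<le> 2 * ((M * (p * L) + A1) * (n * r))"
  proof -
    have "\<bar>(b - a) * L\<^sup>2 + a\<bar> \<le> \<bar>b - a\<bar> * L\<^sup>2 + a" using a(1) abs_triangle_ineq[of "(b - a) * L\<^sup>2" a] by (simp add: abs_mult)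
    also have "\<dots> \<le> (M * L powr (-\<alpha>)) * L\<^sup>2 + A1" using ba a by (intro add_mono mult_right_mono) auto
    also have "\<dots> = M * (p * L) + A1" using LL by (simp add: mult.assoc)
    finally show ?thesis using zy by (intro mult_left_mono mult_mono) auto
  qed
  also have "\<dots> = M * p * (2 * (L * (n * r))) + A1 * (2 * (n * r))" by (simp add: algebra_simps)
  also have "\<dots> \<le> M * p * (\<kappa> * E) + A1 * (\<kappa> * E)"
    using 2 3 nn p0 a by (intro add_mono mult_left_mono) auto
  finally have I: "2 * ((b - a) * L\<^sup>2 + a) * zy \<le> M * p * (\<kappa> * E) + A1 * (\<kappa> * E)" .
  have "b' * (L\<^sup>2 * r\<^sup>2) \<le> (M * p) * (L\<^sup>2 * r\<^sup>2)" using b' by (intro mult_right_mono) (auto simp: p_def)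
  also have "\<dots> \<le> (M * p) * (\<kappa> * E)" using 4 nn p0 by (intro mult_left_mono) auto
  finally have II: "b' * L\<^sup>2 * r\<^sup>2 \<le> M * p * (\<kappa> * E)" by (simp add: mult.assoc)
  have III: "2 * B * (n * r) \<le> B * (\<kappa> * E)" using mult_left_mono[OF 3 nn(4)] by (simp add: algebra_simps)
  have IV: "2 * zF \<le> E + f\<^sup>2" using zF sum_squares_bound[of n f] E0 by linarith
  have "(\<kappa> * (2 * M * p + A1 + B) + 1) * E = M * p * (\<kappa> * E) + A1 * (\<kappa> * E) + M * p * (\<kappa> * E) + B * (\<kappa> * E) + E"
    by (simp add: algebra_simps)
  then show ?thesis using I II III IV c unfolding E_def[symmetric] p_def[symmetric] by linarith
qed

lemma hoelder_imp_continuous_on: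
  fixes a :: "real \<Rightarrow> real"
  assumes hoe: "\<And>t t'. t \<in> S \<Longrightarrow> t' \<in> S \<Longrightarrow> \<bar>a t - a t'\<bar> \<le> M * \<bar>t - t'\<bar> powr \<alpha>" and al: "0 < \<alpha>"
  shows "continuous_on S a"
proof (rule continuous_onI)
  fix x e :: real assume x: "x \<in> S" "e > 0"
  have "((\<lambda>x'. M * \<bar>x' - x\<bar> powr \<alpha>) \<longlongrightarrow> M * \<bar>x - x\<bar> powr \<alpha>) (at x)"
    using al by (intro tendsto_intros) auto
  then have "\<forall>\<^sub>F x' in at x. M * \<bar>x' - x\<bar> powr \<alpha> < e"
    using x by (intro order_tendstoD(2)) auto
  then obtain \<delta> where \<delta>: "\<delta> > 0" "\<And>x'. x' \<noteq> x \<Longrightarrow> dist x' x < \<delta> \<Longrightarrow> M * \<bar>x' - x\<bar> powr \<alpha> < e"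
    unfolding eventually_at by auto
  have "dist (a x') (a x) \<le> e" if "x' \<in> S" "dist x' x < \<delta>" for x'
    using \<delta>(2)[of x'] hoe[OF that(1) x(1)] that x(2) by (cases "x' = x") (auto simp: dist_real_def)
  then show "\<exists>d>0. \<forall>x'\<in>S. dist x' x < d \<longrightarrow> dist (a x') (a x) \<le> e" using \<delta>(1) by blast
qed

lemma inner_of_real_mult_right: "w \<bullet> (of_real r * v) = r * (w \<bullet> v)" for w v :: complex
  by (simp add: inner_complex_def algebra_simps)

text \<open>
  The energy is \<open>E = |z|\<^sup>2 + b L\<^sup>2 |y|\<^sup>2\<close>, and the function shown to be nonincreasing is
  \<open>exp (- K t) * E t\<close> minus the accumulated force.  The second summand of \<open>E\<close> is differentiable; the
  first is not, as \<open>q\<close> is only bounded, but its increments are controlled from above by the integral of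
  a continuous function.
\<close>

lemma energy_estimate:
  fixes y z F :: "real \<Rightarrow> complex" and a q :: "real \<Rightarrow> real"
  assumes T: "T \<ge> 0" and al: "0 < \<alpha>" and m: "m \<ge> 0"
    and hoe: "\<And>t t'. t \<in> {0..T} \<Longrightarrow> t' \<in> {0..T} \<Longrightarrow> \<bar>a t - a t'\<bar> \<le> M * \<bar>t - t'\<bar> powr \<alpha>"
    and M: "M \<ge> 0"
    and a0: "a\<^sub>0 > 0" and abounds: "\<And>t. t \<in> {0..T} \<Longrightarrow> a\<^sub>0 \<le> a t \<and> a t \<le> A1"
    and q: "\<And>t. t \<in> {0..T} \<Longrightarrow> \<bar>q t\<bar> \<le> B"
    and F: "continuous_on {0..T} F"
    and y: "\<And>t. t \<in> {0..T} \<Longrightarrow> (y has_vector_derivative z t) (at t within {0..T})"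
    and z: "\<And>t. t \<in> {0..T} \<Longrightarrow> ((\<lambda>\<tau>. F \<tau> - of_real (a \<tau> * m + q \<tau>) * y \<tau>) has_integral (z t - z 0)) {0..t}"
    and t: "t \<in> {0..T}"
  defines "L \<equiv> sqrt (1 + m)"
  defines "K \<equiv> max 1 (1 / a\<^sub>0) * (2 * M * L powr (1 - \<alpha>) + A1 + B) + 1"
  shows "(cmod (z t))\<^sup>2 + a\<^sub>0 * L\<^sup>2 * (cmod (y t))\<^sup>2
    \<le> exp (K * t) * ((cmod (z 0))\<^sup>2 + A1 * L\<^sup>2 * (cmod (y 0))\<^sup>2 + integral {0..t} (\<lambda>\<tau>. (cmod (F \<tau>))\<^sup>2))"
proof -
  have L: "L \<ge> 1" "L\<^sup>2 = 1 + m" using m by (auto simp: L_def)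
  have B0: "B \<ge> 0" using q[OF t] by linarith
  have A10: "A1 \<ge> 0" using abounds[OF t] a0 by linarith
  have K0: "K \<ge> 0" using M B0 A10 a0 by (auto simp: K_def intro!: add_nonneg_nonneg mult_nonneg_nonneg)
  obtain b b' where b: "\<And>t. t \<in> {0..T} \<Longrightarrow> (b has_real_derivative b' t) (at t)"
    and blo: "\<And>t. t \<in> {0..T} \<Longrightarrow> a\<^sub>0 \<le> b t \<and> b t \<le> A1"
    and ba: "\<And>t. t \<in> {0..T} \<Longrightarrow> \<bar>b t - a t\<bar> \<le> M * L powr (-\<alpha>)"
    and b': "\<And>t. t \<in> {0..T} \<Longrightarrow> \<bar>b' t\<bar> \<le> M * L powr (1 - \<alpha>)"
    by (rule hoelder_mollification[OF T al L(1) hoe M abounds]) blast+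
  define G where "G = (\<lambda>\<tau>. F \<tau> - of_real (a \<tau> * m + q \<tau>) * y \<tau>)"
  have Gint: "(G has_integral (z x - z s)) {s..x}" if "0 \<le> s" "s \<le> x" "x \<le> T" for s x
    using has_integral_subinterval[OF z that] by (simp add: G_def)
  have ycont: "continuous_on {0..T} y"
    using y by (intro continuous_on_vector_derivative) auto
  have acont: "continuous_on {0..T} a"
    using hoe al by (rule hoelder_imp_continuous_on)
  have zcont: "continuous_on {0..T} z"
  proof -
    have "continuous_on {0..T} (\<lambda>x. integral {0..x} G)"
      using Gint[of 0 T] T by (intro indefinite_integral_continuous_1) blast
    then have "continuous_on {0..T} (\<lambda>x. z 0 + integral {0..x} G)" by (intro continuous_intros)
    then show ?thesis
      by (rule continuous_on_eq) (use integral_unique[OF Gint[of 0]] in simp)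
  qed
  have "bounded (F ` {0..T})"
    using compact_continuous_image[OF F compact_Icc] by (rule compact_imp_bounded)
  then obtain CF where CF: "\<And>x. x \<in> {0..T} \<Longrightarrow> cmod (F x) \<le> CF"
    unfolding bounded_iff by blast
  have "bounded (y ` {0..T})"
    using compact_continuous_image[OF ycont compact_Icc] by (rule compact_imp_bounded)
  then obtain Cy where Cy: "\<And>x. x \<in> {0..T} \<Longrightarrow> cmod (y x) \<le> Cy"
    unfolding bounded_iff by blast
  define C where "C = CF + (A1 * m + B) * Cy"
  have C: "cmod (G x) \<le> C" if "x \<in> {0..T}" for x
  proof -
    have "cmod (G x) \<le> cmod (F x) + cmod (of_real (a x * m + q x) * y x)" unfolding G_def by (rule norm_triangle_ineq4)
    also have "\<dots> \<le> CF + (A1 * m + B) * Cy"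
    proof (rule add_mono[OF CF[OF that]])
      have "\<bar>a x * m + q x\<bar> \<le> \<bar>a x\<bar> * m + \<bar>q x\<bar>" using m abs_triangle_ineq[of "a x * m" "q x"] by (simp add: abs_mult)
      also have "\<dots> \<le> A1 * m + B" using abounds[OF that] a0 q[OF that] m by (intro add_mono mult_right_mono) auto
      finally show "cmod (of_real (a x * m + q x) * y x) \<le> (A1 * m + B) * Cy"
        unfolding norm_mult norm_of_real using Cy[OF that] A10 B0 m by (intro mult_mono) auto
    qed
    finally show ?thesis by (simp add: C_def)
  qed
  define E where "E = (\<lambda>x. (cmod (z x))\<^sup>2 + b x * L\<^sup>2 * (cmod (y x))\<^sup>2)"
  define \<Phi> where "\<Phi> = (\<lambda>x. integral {0..x} (\<lambda>\<sigma>. exp (- K * \<sigma>) * (cmod (F \<sigma>))\<^sup>2))"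
  have \<Phi>d: "(\<Phi> has_real_derivative exp (- K * x) * (cmod (F x))\<^sup>2) (at x within {0..T})" if "x \<in> {0..T}" for x
    unfolding \<Phi>_def using that F by (intro integral_has_real_derivative continuous_intros) auto
  define g where "g = (\<lambda>x. exp (- K * x) * E x - \<Phi> x)"
  have bcont: "continuous_on {0..T} b"
    using b by (meson DERIV_continuous_on has_field_derivative_at_within)
  have \<Phi>cont: "continuous_on {0..T} \<Phi>" using \<Phi>d by (rule DERIV_continuous_on)
  have gcont: "continuous_on {0..T} g"
    unfolding g_def E_def by (intro continuous_intros bcont zcont ycont \<Phi>cont)
  have barrier: "\<exists>U D. U s = g s \<and> (U has_real_derivative D) (at s within {s..t}) \<and> D \<le> 0 \<and> (\<forall>x\<in>{s..t}. g x \<le> U x)"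
    if s: "0 \<le> s" "s < t" for s
  proof -
    have sT: "s \<in> {0..T}" "{s..t} \<subseteq> {0..T}" using s t by auto
    \<comment> \<open>\<open>h\<close> bounds the integrand of \<open>2 * (z s \<bullet> (z x - z s))\<close> from above; replacing \<open>q\<close> by its bound \<open>B\<close>
      makes it continuous.\<close>
    define h where "h = (\<lambda>\<sigma>. 2 * (z s \<bullet> (F \<sigma> - of_real (a \<sigma> * m) * y \<sigma>)) + 2 * B * (cmod (z s) * cmod (y \<sigma>)))"
    have hcont: "continuous_on {s..t} h" unfolding h_def
      by (intro continuous_intros continuous_on_subset[OF F] continuous_on_subset[OF acont]
          continuous_on_subset[OF ycont] sT)
    define U where "U = (\<lambda>x. exp (- K * x) * ((cmod (z s))\<^sup>2 + integral {s..x} h + (C * (x - s))\<^sup>2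
        + b x * L\<^sup>2 * (y x \<bullet> y x)) - \<Phi> x)"
    have yd: "((\<lambda>x. y x \<bullet> y x) has_real_derivative 2 * (z s \<bullet> y s)) (at s within {s..t})"
    proof -
      have "(y has_vector_derivative z s) (at s within {s..t})"
        using y[OF sT(1)] sT(2) by (rule has_vector_derivative_within_subset)
      from bounded_bilinear.has_vector_derivative[OF bounded_bilinear_inner this this]
      show ?thesis by (simp add: has_real_derivative_iff_has_vector_derivative inner_commute)
    qed
    have hd: "((\<lambda>x. integral {s..x} h) has_real_derivative h s) (at s within {s..t})"
      using s hcont by (intro integral_has_real_derivative) auto
    have \<Phi>ds: "(\<Phi> has_real_derivative exp (- K * s) * (cmod (F s))\<^sup>2) (at s within {s..t})"
      using \<Phi>d[OF sT(1)] sT(2) by (rule DERIV_subset)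
    have bd: "(b has_real_derivative b' s) (at s within {s..t})"
      using b[OF sT(1)] by (rule has_field_derivative_at_within)
    define R where "R = h s + (b' s * L\<^sup>2 * (cmod (y s))\<^sup>2 + 2 * b s * L\<^sup>2 * (z s \<bullet> y s))"
    define D where "D = exp (- K * s) * (R - K * E s - (cmod (F s))\<^sup>2)"
    have "(U has_real_derivative D) (at s within {s..t})"
      unfolding U_def
      by (rule derivative_eq_intros hd yd bd \<Phi>ds refl)+
        (simp add: D_def R_def E_def power2_norm_eq_inner algebra_simps)
    moreover have "D \<le> 0"
    proof -
      have "R = 2 * (z s \<bullet> F s) - 2 * (a s * m) * (z s \<bullet> y s) + 2 * B * (cmod (z s) * cmod (y s))
          + (b' s * L\<^sup>2 * (cmod (y s))\<^sup>2 + 2 * b s * L\<^sup>2 * (z s \<bullet> y s))"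
        unfolding R_def h_def inner_diff_right inner_of_real_mult_right by (simp add: algebra_simps)
      also have "\<dots> \<le> K * E s + (cmod (F s))\<^sup>2"
        unfolding K_def E_def
        by (rule energy_rate_bound[OF L(1) L(2) a0 refl])
          (use blo[OF sT(1)] abounds[OF sT(1)] a0 B0 M ba[OF sT(1)] b'[OF sT(1)] in
            \<open>auto intro: norm_cauchy_schwarz Cauchy_Schwarz_ineq2\<close>)
      finally show ?thesis by (simp add: D_def mult_nonneg_nonpos)
    qed
    moreover have "U s = g s" by (simp add: U_def g_def E_def power2_norm_eq_inner)
    moreover have "g x \<le> U x" if x: "x \<in> {s..t}" for x
    proof -
      have sx: "0 \<le> s" "s \<le> x" "x \<le> T" using s x t by auto
      note Gi = Gint[OF sx]
      have 1: "cmod (z x - z s) \<le> C * (x - s)"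
      proof -
        have "C \<ge> 0" using order_trans[OF norm_ge_zero C[OF sT(1)]] .
        from has_integral_bound_real[OF this, of "{}" G "z x - z s" s x] show ?thesis
          using Gi C sx by auto
      qed
      have "((\<lambda>\<sigma>. z s \<bullet> G \<sigma>) has_integral (z s \<bullet> (z x - z s))) {s..x}"
        using has_integral_linear[OF Gi bounded_linear_inner_right] by (simp add: o_def)
      then have "((\<lambda>\<sigma>. 2 * (z s \<bullet> G \<sigma>)) has_integral 2 * (z s \<bullet> (z x - z s))) {s..x}"
        by (rule has_integral_mult_right)
      moreover have "(h has_integral (integral {s..x} h)) {s..x}"
        by (intro integrable_integral integrable_continuous_real continuous_on_subset[OF hcont]) (use x in auto)
      ultimately have 2: "2 * (z s \<bullet> (z x - z s)) \<le> integral {s..x} h"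
      proof (rule has_integral_le)
        fix \<sigma> assume \<sigma>: "\<sigma> \<in> {s..x}"
        then have \<sigma>T: "\<sigma> \<in> {0..T}" using sx by auto
        have "z s \<bullet> G \<sigma> = z s \<bullet> (F \<sigma> - of_real (a \<sigma> * m) * y \<sigma>) - q \<sigma> * (z s \<bullet> y \<sigma>)"
          unfolding G_def inner_diff_right inner_of_real_mult_right by (simp only: algebra_simps)
        moreover have "- (q \<sigma> * (z s \<bullet> y \<sigma>)) \<le> B * (cmod (z s) * cmod (y \<sigma>))"
        proof -
          have "- (q \<sigma> * (z s \<bullet> y \<sigma>)) \<le> \<bar>q \<sigma>\<bar> * \<bar>z s \<bullet> y \<sigma>\<bar>"
            unfolding abs_mult[symmetric] by (rule abs_ge_minus_self)
          also have "\<dots> \<le> B * (cmod (z s) * cmod (y \<sigma>))"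
            using q[OF \<sigma>T] B0 by (intro mult_mono Cauchy_Schwarz_ineq2) auto
          finally show ?thesis .
        qed
        ultimately show "2 * (z s \<bullet> G \<sigma>) \<le> h \<sigma>" unfolding h_def mult.assoc by linarith
      qed
      \<comment> \<open>The term quadratic in the increment of \<open>z\<close> does not contribute to the derivative at \<open>s\<close>.\<close>
      have "(cmod (z x))\<^sup>2 = (cmod (z s))\<^sup>2 + 2 * (z s \<bullet> (z x - z s)) + (cmod (z x - z s))\<^sup>2"
        by (simp add: power2_norm_eq_inner inner_diff_left inner_diff_right inner_commute algebra_simps)
      also have "\<dots> \<le> (cmod (z s))\<^sup>2 + integral {s..x} h + (C * (x - s))\<^sup>2"
        using 1 2 by (intro add_mono power_mono) auto
      finally have "E x \<le> (cmod (z s))\<^sup>2 + integral {s..x} h + (C * (x - s))\<^sup>2 + b x * L\<^sup>2 * (y x \<bullet> y x)"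
        by (simp add: E_def power2_norm_eq_inner)
      then show ?thesis unfolding g_def U_def by (intro diff_right_mono mult_left_mono) auto
    qed
    ultimately show ?thesis by blast
  qed
  have "g t \<le> g 0"
    using t by (intro nonincreasing_via_upper_barriers[OF _ continuous_on_subset[OF gcont] barrier]) auto
  then have "exp (- K * t) * E t \<le> E 0 + \<Phi> t" by (simp add: g_def \<Phi>_def)
  also have "\<Phi> t \<le> integral {0..t} (\<lambda>\<tau>. (cmod (F \<tau>))\<^sup>2)"
    unfolding \<Phi>_def
  proof (rule integral_le)
    show "exp (- K * \<sigma>) * (cmod (F \<sigma>))\<^sup>2 \<le> (cmod (F \<sigma>))\<^sup>2" if "\<sigma> \<in> {0..t}" for \<sigma>
      using that K0 by (intro mult_left_le_one_le) auto
  qed (use t in \<open>auto intro!: integrable_continuous_real continuous_intros continuous_on_subset[OF F]\<close>)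
  also have "E 0 \<le> (cmod (z 0))\<^sup>2 + A1 * L\<^sup>2 * (cmod (y 0))\<^sup>2"
    using blo[of 0] T unfolding E_def by (intro add_left_mono mult_right_mono) auto
  finally have "exp (- K * t) * E t \<le> (cmod (z 0))\<^sup>2 + A1 * L\<^sup>2 * (cmod (y 0))\<^sup>2 + integral {0..t} (\<lambda>\<tau>. (cmod (F \<tau>))\<^sup>2)"
    by simp
  then have "exp (K * t) * (exp (- K * t) * E t)
      \<le> exp (K * t) * ((cmod (z 0))\<^sup>2 + A1 * L\<^sup>2 * (cmod (y 0))\<^sup>2 + integral {0..t} (\<lambda>\<tau>. (cmod (F \<tau>))\<^sup>2))"
    by (intro mult_left_mono) auto
  moreover have "exp (K * t) * (exp (- K * t) * E t) = E t"
    by (simp add: mult.assoc[symmetric] exp_add[symmetric])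
  moreover have "(cmod (z t))\<^sup>2 + a\<^sub>0 * L\<^sup>2 * (cmod (y t))\<^sup>2 \<le> E t"
    using blo[OF t] unfolding E_def by (intro add_left_mono mult_right_mono) auto
  ultimately show ?thesis by linarith
qed

section \<open>Solvability for a single mode\<close>

lemma integral_exp_le:
  fixes L t :: real
  assumes "L > 0" "0 \<le> t"
  shows "integral {0..t} (\<lambda>\<sigma>. exp (L * \<sigma>)) \<le> exp (L * t) / L"
    and "(\<lambda>\<sigma>. exp (L * \<sigma>)) integrable_on {0..t}"
proof -
  have "((\<lambda>\<sigma>. exp (L * \<sigma>)) has_integral (exp (L * t) / L - exp (L * 0) / L)) {0..t}"
    using assms
    by (intro fundamental_theorem_of_calculus[where f="\<lambda>\<sigma>. exp (L * \<sigma>) / L"])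
      (auto intro!: derivative_eq_intros simp flip: has_real_derivative_iff_has_vector_derivative)
  then show "integral {0..t} (\<lambda>\<sigma>. exp (L * \<sigma>)) \<le> exp (L * t) / L" "(\<lambda>\<sigma>. exp (L * \<sigma>)) integrable_on {0..t}"
    using assms(1) by (auto dest: integral_unique intro: has_integral_integrable)
qed

lemma bounded_measurable_times_continuous_integrable:
  fixes b :: "real \<Rightarrow> real" and y :: "real \<Rightarrow> complex"
  assumes b: "b \<in> borel_measurable (lebesgue_on {0..T})" "\<And>t. t \<in> {0..T} \<Longrightarrow> \<bar>b t\<bar> \<le> B"
    and y: "continuous_on {0..T} y" and t: "t \<in> {0..T}"
  shows "(\<lambda>\<tau>. of_real (b \<tau>) * y \<tau>) integrable_on {0..t}"
proof -
  have "(\<lambda>\<tau>. b \<tau> *\<^sub>R y \<tau>) absolutely_integrable_on {0..T}"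
  proof (rule absolutely_integrable_bounded_measurable_product[where h = scaleR])
    show "bilinear (scaleR :: real \<Rightarrow> complex \<Rightarrow> complex)"
      by (simp add: bilinear_conv_bounded_bilinear bounded_bilinear_scaleR)
    show "bounded (b ` {0..T})" using b(2) by (auto simp: bounded_iff intro!: exI[of _ B])
    show "y absolutely_integrable_on {0..T}" using y by (rule absolutely_integrable_continuous_real)
  qed (use b(1) in auto)
  then have "(\<lambda>\<tau>. of_real (b \<tau>) * y \<tau>) integrable_on {0..T}"
    by (auto simp: scaleR_conv_of_real dest: set_lebesgue_integral_eq_integral(1))
  then show ?thesis using t by (auto intro: integrable_subinterval_real)
qed

text \<open>
  The coefficient \<open>b\<close> is bounded and measurable, so the equation is read in integrated form.  Its fixed
  point formulation is a contraction, of factor \<open>B / L\<^sup>2 \<le> 1/2\<close>, for the supremum norm of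
  \<open>exp (- L * t) * y t\<close>; the fixed point \<open>Y\<close> below is this rescaled solution, constant outside
  \<open>[0, T]\<close>.
\<close>

lemma second_order_linear_ode_exists:
  fixes b :: "real \<Rightarrow> real" and F :: "real \<Rightarrow> complex"
  assumes T: "T \<ge> 0"
    and b: "b \<in> borel_measurable (lebesgue_on {0..T})" "\<And>t. t \<in> {0..T} \<Longrightarrow> \<bar>b t\<bar> \<le> B"
    and F: "continuous_on {0..T} F"
  obtains y z where "y 0 = y0" "z 0 = z0"
    "\<And>t. t \<in> {0..T} \<Longrightarrow> (y has_vector_derivative z t) (at t within {0..T})"
    "\<And>t. t \<in> {0..T} \<Longrightarrow> ((\<lambda>\<tau>. F \<tau> - of_real (b \<tau>) * y \<tau>) has_integral (z t - z 0)) {0..t}"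
proof -
  have B0: "B \<ge> 0" using b(2)[of 0] T by force
  define L where "L = B + 1"
  have L: "L > 0" "B / L / L \<le> 1/2"
  proof -
    show "L > 0" using B0 by (simp add: L_def)
    have "2 * B \<le> L * L" using sum_squares_bound[of B 1] by (simp add: L_def power2_eq_square algebra_simps)
    with \<open>L > 0\<close> show "B / L / L \<le> 1/2" by (simp add: field_simps)
  qed
  define cl where "cl = (\<lambda>t. max 0 (min T t))"
  have cl: "cl t \<in> {0..T}" for t using T by (auto simp: cl_def)
  have clid: "cl t = t" if "t \<in> {0..T}" for t using that by (auto simp: cl_def)
  define G where "G = (\<lambda>Y \<tau>. F \<tau> - of_real (b \<tau>) * (exp (L * \<tau>) *\<^sub>R apply_bcontfun Y \<tau>))"
  define Z where "Z = (\<lambda>Y \<sigma>. z0 + integral {0..\<sigma>} (G Y))"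
  define W where "W = (\<lambda>Y t. y0 + integral {0..t} (Z Y))"
  have Gi: "G Y integrable_on {0..t}" if "t \<in> {0..T}" for Y t
    unfolding G_def using that
    by (intro integrable_diff bounded_measurable_times_continuous_integrable[OF b] integrable_continuous_real
        continuous_on_subset[OF F] continuous_intros) auto
  have Zc: "continuous_on {0..T} (Z Y)" for Y
    unfolding Z_def using Gi[of T Y] T by (intro continuous_intros indefinite_integral_continuous_1) auto
  have Zi: "Z Y integrable_on {0..t}" if "t \<in> {0..T}" for Y t
    using that by (intro integrable_continuous_real continuous_on_subset[OF Zc]) auto
  have Wc: "continuous_on {0..T} (W Y)" for Y
    unfolding W_def using Zi[of T Y] T by (intro continuous_intros indefinite_integral_continuous_1) auto
  define \<Phi>0 where "\<Phi>0 = (\<lambda>Y t. exp (- (L * cl t)) *\<^sub>R W Y (cl t))"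
  have \<Phi>0: "\<Phi>0 Y \<in> bcontfun" for Y
  proof -
    have h: "continuous_on {0..T} (\<lambda>t. exp (- (L * t)) *\<^sub>R W Y t)"
      by (intro continuous_intros Wc)
    have "continuous_on UNIV (\<Phi>0 Y)"
      unfolding \<Phi>0_def
      by (rule continuous_on_compose2[OF h, where f=cl]) (use cl in \<open>auto simp: cl_def intro!: continuous_intros\<close>)
    moreover have "bounded ((\<lambda>t. exp (- (L * t)) *\<^sub>R W Y t) ` {0..T})"
      using compact_continuous_image[OF h compact_Icc] by (rule compact_imp_bounded)
    then obtain C where "\<And>t. t \<in> {0..T} \<Longrightarrow> norm (exp (- (L * t)) *\<^sub>R W Y t) \<le> C"
      unfolding bounded_iff by blast
    then have "norm (\<Phi>0 Y t) \<le> C" for t unfolding \<Phi>0_def using cl by blast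
    ultimately show ?thesis by (rule bcontfun_normI)
  qed
  define \<Phi> where "\<Phi> = (\<lambda>Y. Bcontfun (\<Phi>0 Y))"
  have \<Phi>: "apply_bcontfun (\<Phi> Y) = \<Phi>0 Y" for Y unfolding \<Phi>_def by (rule Bcontfun_inverse[OF \<Phi>0])
  have contr: "dist (\<Phi> Y) (\<Phi> Y') \<le> 1/2 * dist Y Y'" for Y Y'
  proof (rule dist_bound)
    fix t
    define \<delta> where "\<delta> = dist Y Y'"
    define r where "r = cl t"
    have r: "r \<in> {0..T}" unfolding r_def by (rule cl)
    have pt: "norm (apply_bcontfun Y \<tau> - apply_bcontfun Y' \<tau>) \<le> \<delta>" for \<tau>
      using dist_bounded[of Y \<tau> Y'] by (simp add: \<delta>_def dist_norm)
    have \<delta>0: "\<delta> \<ge> 0" by (simp add: \<delta>_def)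
    have Zd: "norm (Z Y \<sigma> - Z Y' \<sigma>) \<le> B * \<delta> / L * exp (L * \<sigma>)" if \<sigma>: "\<sigma> \<in> {0..T}" for \<sigma>
    proof -
      have "Z Y \<sigma> - Z Y' \<sigma> = integral {0..\<sigma>} (\<lambda>\<tau>. G Y \<tau> - G Y' \<tau>)"
        unfolding Z_def using Gi[OF \<sigma>] by (simp add: Henstock_Kurzweil_Integration.integral_diff)
      also have "norm \<dots> \<le> integral {0..\<sigma>} (\<lambda>\<tau>. (B * \<delta>) * exp (L * \<tau>))"
      proof (rule integral_norm_bound_integral)
        show "(\<lambda>\<tau>. G Y \<tau> - G Y' \<tau>) integrable_on {0..\<sigma>}" using Gi[OF \<sigma>] by (intro integrable_diff)
        show "(\<lambda>\<tau>. (B * \<delta>) * exp (L * \<tau>)) integrable_on {0..\<sigma>}"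
          using \<sigma> L by (intro integrable_on_mult_right integral_exp_le) auto
        fix \<tau> assume \<tau>: "\<tau> \<in> {0..\<sigma>}"
        have "G Y \<tau> - G Y' \<tau> = - (of_real (b \<tau>) * (exp (L * \<tau>) *\<^sub>R (apply_bcontfun Y \<tau> - apply_bcontfun Y' \<tau>)))"
          by (simp add: G_def algebra_simps)
        then have "norm (G Y \<tau> - G Y' \<tau>) = \<bar>b \<tau>\<bar> * (exp (L * \<tau>) * norm (apply_bcontfun Y \<tau> - apply_bcontfun Y' \<tau>))"
          by (simp add: norm_mult)
        also have "\<dots> \<le> B * (exp (L * \<tau>) * \<delta>)"
          using b(2)[of \<tau>] \<tau> \<sigma> B0 pt by (intro mult_mono) auto
        finally show "norm (G Y \<tau> - G Y' \<tau>) \<le> (B * \<delta>) * exp (L * \<tau>)" by (simp add: algebra_simps)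
      qed
      also have "\<dots> = (B * \<delta>) * integral {0..\<sigma>} (\<lambda>\<tau>. exp (L * \<tau>))" by simp
      also have "\<dots> \<le> (B * \<delta>) * (exp (L * \<sigma>) / L)"
        using \<sigma> L B0 \<delta>0 by (intro mult_left_mono integral_exp_le) auto
      finally show ?thesis by simp
    qed
    have "W Y r - W Y' r = integral {0..r} (\<lambda>\<sigma>. Z Y \<sigma> - Z Y' \<sigma>)"
      unfolding W_def using Zi[OF r] by (simp add: Henstock_Kurzweil_Integration.integral_diff)
    also have "norm \<dots> \<le> integral {0..r} (\<lambda>\<tau>. B * \<delta> / L * exp (L * \<tau>))"
    proof (rule integral_norm_bound_integral)
      show "(\<lambda>\<sigma>. Z Y \<sigma> - Z Y' \<sigma>) integrable_on {0..r}" using Zi[OF r] by (intro integrable_diff)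
      show "(\<lambda>\<tau>. B * \<delta> / L * exp (L * \<tau>)) integrable_on {0..r}"
        using r L by (intro integrable_on_mult_right integral_exp_le) auto
    qed (use Zd r in auto)
    also have "\<dots> = B * \<delta> / L * integral {0..r} (\<lambda>\<tau>. exp (L * \<tau>))" by simp
    also have "\<dots> \<le> B * \<delta> / L * (exp (L * r) / L)"
      using r L B0 \<delta>0 by (intro mult_left_mono integral_exp_le) auto
    also have "\<dots> = (B / L / L) * \<delta> * exp (L * r)" by simp
    also have "\<dots> \<le> 1/2 * \<delta> * exp (L * r)"
      using L \<delta>0 by (intro mult_right_mono) auto
    finally have "norm (W Y r - W Y' r) \<le> 1/2 * \<delta> * exp (L * r)" .
    then have "exp (- (L * r)) * norm (W Y r - W Y' r) \<le> exp (- (L * r)) * (1/2 * \<delta> * exp (L * r))"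
      by (intro mult_left_mono) auto
    also have "\<dots> = 1/2 * \<delta>" by (simp add: exp_minus)
    finally show "dist (apply_bcontfun (\<Phi> Y) t) (apply_bcontfun (\<Phi> Y') t) \<le> 1/2 * dist Y Y'"
      unfolding \<Phi> \<Phi>0_def dist_norm r_def[symmetric] scaleR_diff_right[symmetric] \<delta>_def by simp
  qed
  obtain Y where Y: "\<Phi> Y = Y"
    using banach_fix_type[of "1/2" \<Phi>] contr by auto
  define y where "y = W Y"
  define z where "z = Z Y"
  have fix_eq: "exp (L * t) *\<^sub>R apply_bcontfun Y t = y t" if "t \<in> {0..T}" for t
  proof -
    have "apply_bcontfun Y t = exp (- (L * t)) *\<^sub>R y t"
      using arg_cong[OF Y, of "\<lambda>Y. apply_bcontfun Y t"] clid[OF that] by (simp add: \<Phi> \<Phi>0_def y_def)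
    then show ?thesis by (simp add: exp_minus)
  qed
  show ?thesis
  proof
    show "y 0 = y0" by (simp add: y_def W_def)
    show z0: "z 0 = z0" by (simp add: z_def Z_def)
    fix t assume t: "t \<in> {0..T}"
    have "((\<lambda>u. integral {0..u} (Z Y)) has_vector_derivative Z Y t) (at t within {0..T})"
      by (rule integral_has_vector_derivative[OF Zc t])
    then show "(y has_vector_derivative z t) (at t within {0..T})"
      unfolding y_def z_def W_def by (auto intro!: derivative_eq_intros)
    have "(G Y has_integral (z t - z 0)) {0..t}"
      using integrable_integral[OF Gi[OF t, of Y]] z0 by (simp add: z_def Z_def)
    then show "((\<lambda>\<tau>. F \<tau> - of_real (b \<tau>) * y \<tau>) has_integral (z t - z 0)) {0..t}"
    proof (rule has_integral_eq[rotated])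
      fix \<tau> assume "\<tau> \<in> {0..t}"
      then have "\<tau> \<in> {0..T}" using t by auto
      then show "G Y \<tau> = F \<tau> - of_real (b \<tau>) * y \<tau>" by (simp only: G_def fix_eq)
    qed
  qed
qed

section \<open>Curves given by their coefficients\<close>

text \<open>
  Minkowski's inequality for integrals, restricted to a finite set of indices, by duality: pairing the
  integral \<open>\<Delta>\<close> with itself under the integral sign bounds the square of its norm by the product of
  its norm and the integral of the norm of \<open>g\<close>.
\<close>

lemma wl2_le_integral:
  fixes g :: "'i \<Rightarrow> real \<Rightarrow> complex"
  assumes int: "\<And>\<xi>. \<xi> \<in> I \<Longrightarrow> (g \<xi> has_integral \<Delta> \<xi>) {s..t}" and st: "s \<le> t"
    and bnd: "\<And>\<sigma>. \<sigma> \<in> {s..t} \<Longrightarrow> wl2_le I w (\<lambda>\<xi>. g \<xi> \<sigma>) S"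
  shows "wl2_le I w \<Delta> (S * (t - s))"
proof (rule wl2_leI)
  fix F assume F: "finite F" "F \<subseteq> I"
  have S0: "S \<ge> 0" using bnd[of s] st by (auto intro: wl2_le_nonneg)
  define X where "X = L2_set (\<lambda>\<xi>. w \<xi> * cmod (\<Delta> \<xi>)) F"
  have X0: "X \<ge> 0" by (simp add: X_def)
  have int_sum: "((\<lambda>\<sigma>. \<Sum>\<xi>\<in>F. (w \<xi>)\<^sup>2 * (\<Delta> \<xi> \<bullet> g \<xi> \<sigma>)) has_integral (\<Sum>\<xi>\<in>F. (w \<xi>)\<^sup>2 * (\<Delta> \<xi> \<bullet> \<Delta> \<xi>))) {s..t}"
  proof (intro has_integral_sum has_integral_mult_right F(1))
    fix \<xi> assume "\<xi> \<in> F"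
    then have "(g \<xi> has_integral \<Delta> \<xi>) {s..t}" using int F by auto
    from has_integral_linear[OF this bounded_linear_inner_right]
    show "((\<lambda>\<sigma>. \<Delta> \<xi> \<bullet> g \<xi> \<sigma>) has_integral (\<Delta> \<xi> \<bullet> \<Delta> \<xi>)) {s..t}" by (simp add: o_def)
  qed
  have sum_eq: "(\<Sum>\<xi>\<in>F. (w \<xi>)\<^sup>2 * (\<Delta> \<xi> \<bullet> \<Delta> \<xi>)) = X\<^sup>2"
    unfolding X_def L2_set_def
    by (simp add: sum_nonneg power_mult_distrib power2_norm_eq_inner)
  have int_const: "((\<lambda>\<sigma>. X * S) has_integral X * S * (t - s)) {s..t}"
    using has_integral_const_real[of "X * S" s t] st by (simp add: mult.commute)
  have pointwise: "(\<Sum>\<xi>\<in>F. (w \<xi>)\<^sup>2 * (\<Delta> \<xi> \<bullet> g \<xi> \<sigma>)) \<le> X * S" if "\<sigma> \<in> {s..t}" for \<sigma>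
  proof -
    have "(\<Sum>\<xi>\<in>F. (w \<xi>)\<^sup>2 * (\<Delta> \<xi> \<bullet> g \<xi> \<sigma>)) \<le> (\<Sum>\<xi>\<in>F. \<bar>w \<xi> * cmod (\<Delta> \<xi>)\<bar> * \<bar>w \<xi> * cmod (g \<xi> \<sigma>)\<bar>)"
    proof (rule sum_mono)
      fix \<xi>
      have "(w \<xi>)\<^sup>2 * (\<Delta> \<xi> \<bullet> g \<xi> \<sigma>) \<le> (w \<xi>)\<^sup>2 * (cmod (\<Delta> \<xi>) * cmod (g \<xi> \<sigma>))"
        by (intro mult_left_mono norm_cauchy_schwarz) auto
      then show "(w \<xi>)\<^sup>2 * (\<Delta> \<xi> \<bullet> g \<xi> \<sigma>) \<le> \<bar>w \<xi> * cmod (\<Delta> \<xi>)\<bar> * \<bar>w \<xi> * cmod (g \<xi> \<sigma>)\<bar>"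
        by (simp add: abs_mult power2_eq_square mult_ac)
    qed
    also have "\<dots> \<le> X * L2_set (\<lambda>\<xi>. w \<xi> * cmod (g \<xi> \<sigma>)) F"
      unfolding X_def by (rule L2_set_mult_ineq)
    also have "\<dots> \<le> X * S" using wl2_leD[OF bnd[OF that] F] X0 by (rule mult_left_mono)
    finally show ?thesis .
  qed
  have "X\<^sup>2 \<le> X * S * (t - s)"
    using has_integral_le[OF int_sum int_const pointwise] by (simp add: sum_eq)
  then have "X \<le> S * (t - s)" using X0 S0 st
    by (cases "X = 0") (auto simp: power2_eq_square mult.assoc)
  then show "L2_set (\<lambda>\<xi>. w \<xi> * cmod (\<Delta> \<xi>)) F \<le> S * (t - s)" by (simp add: X_def)
qed

lemma wl2_le_primitive_lipschitz:
  fixes g Z :: "'i \<Rightarrow> real \<Rightarrow> complex"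
  assumes int: "\<And>\<xi> t. \<xi> \<in> I \<Longrightarrow> t \<in> {0..T} \<Longrightarrow> (g \<xi> has_integral (Z \<xi> t - Z \<xi> 0)) {0..t}"
    and w: "\<And>\<xi>. \<xi> \<in> I \<Longrightarrow> 0 \<le> w \<xi>"
    and bnd: "\<And>\<sigma>. \<sigma> \<in> {0..T} \<Longrightarrow> wl2_le I w (\<lambda>\<xi>. g \<xi> \<sigma>) S"
    and t: "t \<in> {0..T}" "t' \<in> {0..T}"
  shows "wl2_le I w (\<lambda>\<xi>. Z \<xi> t' - Z \<xi> t) (S * \<bar>t' - t\<bar>)"
proof -
  have *: "wl2_le I w (\<lambda>\<xi>. Z \<xi> t - Z \<xi> s) (S * (t - s))" if "0 \<le> s" "s \<le> t" "t \<le> T" for s t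
    using that by (intro wl2_le_integral[where g=g] has_integral_subinterval[OF int] bnd) auto
  show ?thesis
  proof (cases "t \<le> t'")
    case True
    then show ?thesis using *[of t t'] t by auto
  next
    case False
    then have "wl2_le I w (\<lambda>\<xi>. (-1) * (Z \<xi> t - Z \<xi> t')) (cmod (-1) * (S * (t - t')))"
      using t by (intro wl2_le_cmult * w) auto
    then show ?thesis using False by simp
  qed
qed

lemma wl2_le_difference_quotient:
  fixes g Z :: "'i \<Rightarrow> real \<Rightarrow> complex"
  assumes int: "\<And>\<xi> t. \<xi> \<in> I \<Longrightarrow> t \<in> {0..T} \<Longrightarrow> (g \<xi> has_integral (Z \<xi> t - Z \<xi> 0)) {0..t}"
    and w: "\<And>\<xi>. \<xi> \<in> I \<Longrightarrow> 0 \<le> w \<xi>"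
    and cont: "\<exists>\<delta>>0. \<forall>t'\<in>{0..T}. \<bar>t' - t\<bar> < \<delta> \<longrightarrow> wl2_le I w (\<lambda>\<xi>. g \<xi> t' - g \<xi> t) e"
    and t: "t \<in> {0..T}"
  shows "\<forall>\<^sub>F \<tau> in at t within {0..T}. wl2_le I w (\<lambda>\<xi>. (Z \<xi> \<tau> - Z \<xi> t) / of_real (\<tau> - t) - g \<xi> t) e"
proof -
  obtain \<delta> where \<delta>: "\<delta> > 0" "\<And>t'. t' \<in> {0..T} \<Longrightarrow> \<bar>t' - t\<bar> < \<delta> \<Longrightarrow> wl2_le I w (\<lambda>\<xi>. g \<xi> t' - g \<xi> t) e"
    using cont by blast
  have *: "wl2_le I w (\<lambda>\<xi>. (Z \<xi> r - Z \<xi> l) / of_real (r - l) - g \<xi> t) e"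
    if lr: "0 \<le> l" "l < r" "r \<le> T" "\<bar>l - t\<bar> < \<delta>" "\<bar>r - t\<bar> < \<delta>" for l r
  proof -
    have "wl2_le I w (\<lambda>\<xi>. (Z \<xi> r - Z \<xi> l) - (r - l) *\<^sub>R g \<xi> t) (e * (r - l))"
    proof (rule wl2_le_integral[where g="\<lambda>\<xi> \<sigma>. g \<xi> \<sigma> - g \<xi> t"])
      fix \<xi> assume "\<xi> \<in> I"
      then have "(g \<xi> has_integral (Z \<xi> r - Z \<xi> l)) {l..r}"
        using lr by (intro has_integral_subinterval[OF int]) auto
      from has_integral_diff[OF this has_integral_const_real[of "g \<xi> t" l r]]
      show "((\<lambda>\<sigma>. g \<xi> \<sigma> - g \<xi> t) has_integral (Z \<xi> r - Z \<xi> l) - (r - l) *\<^sub>R g \<xi> t) {l..r}"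
        using lr by simp
    qed (use lr in \<open>auto intro!: \<delta>(2)\<close>)
    then have "wl2_le I w (\<lambda>\<xi>. of_real (1 / (r - l)) * ((Z \<xi> r - Z \<xi> l) - (r - l) *\<^sub>R g \<xi> t))
        (cmod (of_real (1 / (r - l))) * (e * (r - l)))"
      by (intro wl2_le_cmult w)
    moreover have "cmod (of_real (1 / (r - l))) * (e * (r - l)) = e"
      unfolding norm_of_real using lr by simp
    moreover have "of_real (1 / (r - l)) * ((Z \<xi> r - Z \<xi> l) - (r - l) *\<^sub>R g \<xi> t)
        = (Z \<xi> r - Z \<xi> l) / of_real (r - l) - g \<xi> t" for \<xi>
    proof -
      have "complex_of_real (r - l) \<noteq> 0" using lr by (simp del: of_real_diff)
      then show ?thesis
        by (simp add: scaleR_conv_of_real right_diff_distrib diff_divide_distrib del: of_real_diff)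
    qed
    ultimately show ?thesis by (simp only:)
  qed
  have "wl2_le I w (\<lambda>\<xi>. (Z \<xi> \<tau> - Z \<xi> t) / of_real (\<tau> - t) - g \<xi> t) e"
    if \<tau>: "\<tau> \<in> {0..T}" "\<tau> \<noteq> t" "dist \<tau> t < \<delta>" for \<tau>
  proof (cases "t < \<tau>")
    case True
    then show ?thesis using *[of t \<tau>] \<tau> t \<delta>(1) by (auto simp: dist_real_def)
  next
    case False
    then have "wl2_le I w (\<lambda>\<xi>. (Z \<xi> t - Z \<xi> \<tau>) / of_real (t - \<tau>) - g \<xi> t) e"
      using *[of \<tau> t] \<tau> t \<delta>(1) by (auto simp: dist_real_def)
    moreover have "(Z \<xi> t - Z \<xi> \<tau>) / of_real (t - \<tau>) = (Z \<xi> \<tau> - Z \<xi> t) / of_real (\<tau> - t)" for \<xi>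
      using minus_divide_divide[of "Z \<xi> \<tau> - Z \<xi> t" "of_real (\<tau> - t)"] by simp
    ultimately show ?thesis by simp
  qed
  then show ?thesis unfolding eventually_at using \<delta>(1) by blast
qed

lemma time_continuous_gevreyI:
  assumes d: "\<forall>\<xi>\<in>I. d \<xi> \<in> L2" and A: "A > 0"
    and v: "\<And>t. t \<in> {0..T} \<Longrightarrow> v t \<in> gevrey I lam d s"
    and cont: "\<And>t e. t \<in> {0..T} \<Longrightarrow> e > 0 \<Longrightarrow> \<exists>\<delta>>0. \<forall>t'\<in>{0..T}. \<bar>t' - t\<bar> < \<delta> \<longrightarrow>
      wl2_le I (gweight lam s A) (\<lambda>\<xi>. hfourier d (v t') \<xi> - hfourier d (v t) \<xi>) e"
  shows "time_continuous T (gevrey_topology I lam d s) v"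
  unfolding time_continuous_iff
proof
  fix t assume t: "t \<in> {0..T}"
  show "limitin (gevrey_topology I lam d s) v (v t) (at t within {0..T})"
  proof (rule limitin_gevreyI[OF d v[OF t] A])
    show "\<forall>\<^sub>F \<tau> in at t within {0..T}. v \<tau> \<in> L2"
      using gevrey_L2[OF v] by (auto simp: eventually_at_filter)
    fix e :: real assume "e > 0"
    from cont[OF t this] show "\<forall>\<^sub>F \<tau> in at t within {0..T}.
        wl2_le I (gweight lam s A) (\<lambda>\<xi>. hfourier d (v \<tau>) \<xi> - hfourier d (v t) \<xi>) e"
      unfolding eventually_at by (auto simp: dist_real_def)
  qed
qed

lemma difference_quotient_eq:
  fixes f g :: "'a \<Rightarrow> complex"
  shows "(\<lambda>x. (f x - g x) / of_real r) = (\<lambda>x. of_real (1/r) * f x + (- of_real (1/r)) * g x)"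
  by (auto simp: diff_divide_distrib)

lemma L2_difference_quotient:
  "f \<in> L2 \<Longrightarrow> g \<in> L2 \<Longrightarrow> (\<lambda>x. (f x - g x) / of_real r) \<in> L2"
  unfolding difference_quotient_eq by (rule L2_lincomb)

lemma hfourier_difference_quotient:
  assumes "f \<in> L2" "g \<in> L2" "d \<xi> \<in> L2"
  shows "hfourier d (\<lambda>x. (f x - g x) / of_real r) \<xi> = (hfourier d f \<xi> - hfourier d g \<xi>) / of_real r"
  unfolding difference_quotient_eq hfourier_lincomb[of f g d \<xi>, OF assms] by (simp add: diff_divide_distrib)

text \<open>
  A curve whose coefficients are primitives of those of a step-continuous curve is differentiable,
  since the error of the difference quotient is a mean of the increments of the derivative.
\<close>

lemma has_time_derivative_gevreyI:
  assumes d: "\<forall>\<xi>\<in>I. d \<xi> \<in> L2" and A: "A > 0"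
    and v: "\<And>t. t \<in> {0..T} \<Longrightarrow> v t \<in> gevrey I lam d s"
    and v': "\<And>t. t \<in> {0..T} \<Longrightarrow> v' t \<in> gevrey I lam d s"
    and int: "\<And>\<xi> t. \<xi> \<in> I \<Longrightarrow> t \<in> {0..T} \<Longrightarrow>
      ((\<lambda>\<tau>. hfourier d (v' \<tau>) \<xi>) has_integral (hfourier d (v t) \<xi> - hfourier d (v 0) \<xi>)) {0..t}"
    and cont: "\<And>t e. t \<in> {0..T} \<Longrightarrow> e > 0 \<Longrightarrow> \<exists>\<delta>>0. \<forall>t'\<in>{0..T}. \<bar>t' - t\<bar> < \<delta> \<longrightarrow>
      wl2_le I (gweight lam s A) (\<lambda>\<xi>. hfourier d (v' t') \<xi> - hfourier d (v' t) \<xi>) e"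
  shows "has_time_derivative T (gevrey_topology I lam d s) v v'"
  unfolding has_time_derivative_def
proof
  fix t assume t: "t \<in> {0..T}"
  show "limitin (gevrey_topology I lam d s) (\<lambda>\<tau> x. (v \<tau> x - v t x) / of_real (\<tau> - t)) (v' t) (at t within {0..T})"
  proof (rule limitin_gevreyI[OF d v'[OF t] A])
    have vL: "\<forall>\<^sub>F \<tau> in at t within {0..T}. v \<tau> \<in> L2"
      using gevrey_L2[OF v] by (auto simp: eventually_at_filter)
    then show "\<forall>\<^sub>F \<tau> in at t within {0..T}. (\<lambda>x. (v \<tau> x - v t x) / of_real (\<tau> - t)) \<in> L2"
      by eventually_elim (rule L2_difference_quotient[OF _ gevrey_L2[OF v[OF t]]])
    fix e :: real assume e: "e > 0"
    have "\<forall>\<^sub>F \<tau> in at t within {0..T}. wl2_le I (gweight lam s A)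
        (\<lambda>\<xi>. (hfourier d (v \<tau>) \<xi> - hfourier d (v t) \<xi>) / of_real (\<tau> - t) - hfourier d (v' t) \<xi>) e"
      using cont[OF t e]
      by (intro wl2_le_difference_quotient[where Z="\<lambda>\<xi> t. hfourier d (v t) \<xi>" and g="\<lambda>\<xi> t. hfourier d (v' t) \<xi>"]
          int t gweight_nonneg)
    with vL show "\<forall>\<^sub>F \<tau> in at t within {0..T}. wl2_le I (gweight lam s A)
        (\<lambda>\<xi>. hfourier d (\<lambda>x. (v \<tau> x - v t x) / of_real (\<tau> - t)) \<xi> - hfourier d (v' t) \<xi>) e"
    proof eventually_elim
      case (elim \<tau>)
      note elim(2)
      also have "wl2_le I (gweight lam s A)
        (\<lambda>\<xi>. (hfourier d (v \<tau>) \<xi> - hfourier d (v t) \<xi>) / of_real (\<tau> - t) - hfourier d (v' t) \<xi>) e \<longleftrightarrow> ?case"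
        using d by (intro wl2_le_cong)
          (simp add: hfourier_difference_quotient[OF elim(1) gevrey_L2[OF v[OF t]]] del: of_real_diff)
      finally show ?case .
    qed
  qed
qed

text \<open>
  The constant weight \<open>1\<close> is admissible, so every coefficient is continuous on the inductive limit and
  inherits the derivative of the curve.
\<close>

lemma has_time_derivative_hfourier:
  assumes d: "\<forall>\<xi>\<in>I. d \<xi> \<in> L2" and v: "\<And>t. t \<in> {0..T} \<Longrightarrow> v t \<in> gevrey I lam d s"
    and v': "has_time_derivative T (gevrey_topology I lam d s) v v'"
    and \<xi>: "\<xi> \<in> I" and t: "t \<in> {0..T}"
  shows "((\<lambda>\<tau>. hfourier d (v \<tau>) \<xi>) has_vector_derivative hfourier d (v' t) \<xi>) (at t within {0..T})"
proof -
  have adm: "admissible_weight I lam s (\<lambda>_. 1)"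
    unfolding admissible_weight_def using gweight_ge_1[of _ lam s] by (auto intro!: exI[of _ 1])
  let ?q = "\<lambda>\<tau> x. (v \<tau> x - v t x) / complex_of_real (\<tau> - t)"
  have L: "\<forall>\<^sub>F \<tau> in at t within {0..T}. ?q \<tau> \<in> L2"
  proof -
    have "?q \<tau> \<in> L2" if "\<tau> \<in> {0..T}" for \<tau>
      by (rule L2_difference_quotient[OF gevrey_L2[OF v[OF that]] gevrey_L2[OF v[OF t]]])
    then show ?thesis by (auto simp: eventually_at_filter)
  qed
  have lim: "limitin (gevrey_topology I lam d s) ?q (v' t) (at t within {0..T})"
    using v' t unfolding has_time_derivative_def by blast
  have "((\<lambda>\<tau>. (hfourier d (v \<tau>) \<xi> - hfourier d (v t) \<xi>) / of_real (\<tau> - t)) \<longlongrightarrow> hfourier d (v' t) \<xi>) (at t within {0..T})"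
  proof (rule tendstoI)
    fix e :: real assume e: "e > 0"
    have "\<forall>\<^sub>F \<tau> in at t within {0..T}. wl2_le I (\<lambda>_. 1) (\<lambda>\<xi>. hfourier d (?q \<tau>) \<xi> - hfourier d (v' t) \<xi>) (e/2)"
      using limitin_gevrey_wl2[OF d lim adm _ L, of "e/2"] e by simp
    moreover have "\<forall>\<^sub>F \<tau> in at t within {0..T}. \<tau> \<in> {0..T}" by (auto simp: eventually_at_filter)
    ultimately show "\<forall>\<^sub>F \<tau> in at t within {0..T}.
        dist ((hfourier d (v \<tau>) \<xi> - hfourier d (v t) \<xi>) / of_real (\<tau> - t)) (hfourier d (v' t) \<xi>) < e"
    proof eventually_elim
      case (elim \<tau>)
      have "hfourier d (?q \<tau>) \<xi> = (hfourier d (v \<tau>) \<xi> - hfourier d (v t) \<xi>) / of_real (\<tau> - t)"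
        using d \<xi> by (intro hfourier_difference_quotient[OF gevrey_L2[OF v[OF elim(2)]] gevrey_L2[OF v[OF t]]]) auto
      moreover have "cmod (hfourier d (?q \<tau>) \<xi> - hfourier d (v' t) \<xi>) \<le> e / 2"
        using wl2_leD[OF elim(1), of "{\<xi>}"] \<xi> by (simp add: L2_set_def)
      ultimately show ?case using e by (simp add: dist_norm del: of_real_diff)
    qed
  qed
  then have "((\<lambda>\<tau>. cmod ((hfourier d (v \<tau>) \<xi> - hfourier d (v t) \<xi>) / of_real (\<tau> - t) - hfourier d (v' t) \<xi>)) \<longlongrightarrow> 0)
      (at t within {0..T})"
    by (intro tendsto_norm_zero LIM_zero)
  then have "((\<lambda>\<tau>. cmod (hfourier d (v \<tau>) \<xi> - hfourier d (v t) \<xi> - (\<tau> - t) *\<^sub>R hfourier d (v' t) \<xi>) / norm (\<tau> - t)) \<longlongrightarrow> 0)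
      (at t within {0..T})"
  proof (rule Lim_transform_eventually)
    have "cmod ((hfourier d (v \<tau>) \<xi> - hfourier d (v t) \<xi>) / of_real (\<tau> - t) - hfourier d (v' t) \<xi>)
        = cmod (hfourier d (v \<tau>) \<xi> - hfourier d (v t) \<xi> - (\<tau> - t) *\<^sub>R hfourier d (v' t) \<xi>) / norm (\<tau> - t)"
      if "\<tau> \<noteq> t" for \<tau>
    proof -
      have nz: "complex_of_real (\<tau> - t) \<noteq> 0" using that by (simp del: of_real_diff)
      have "(hfourier d (v \<tau>) \<xi> - hfourier d (v t) \<xi>) / of_real (\<tau> - t) - hfourier d (v' t) \<xi>
        = (hfourier d (v \<tau>) \<xi> - hfourier d (v t) \<xi> - (\<tau> - t) *\<^sub>R hfourier d (v' t) \<xi>) / of_real (\<tau> - t)"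
        using nz by (simp add: scaleR_conv_of_real diff_divide_distrib del: of_real_diff)
      then show ?thesis by (simp only: norm_divide norm_of_real real_norm_def)
    qed
    then show "\<forall>\<^sub>F \<tau> in at t within {0..T}.
        cmod ((hfourier d (v \<tau>) \<xi> - hfourier d (v t) \<xi>) / of_real (\<tau> - t) - hfourier d (v' t) \<xi>)
        = cmod (hfourier d (v \<tau>) \<xi> - hfourier d (v t) \<xi> - (\<tau> - t) *\<^sub>R hfourier d (v' t) \<xi>) / norm (\<tau> - t)"
      unfolding eventually_at_filter by (auto intro: always_eventually)
  qed
  then show ?thesis
    unfolding has_vector_derivative_def has_derivative_iff_norm by (simp add: bounded_linear_scaleR_left)
qed

section \<open>Absorbing the loss\<close>

lemma powr_absorbed_by_larger_powr:
  fixes \<theta> \<sigma> \<delta> k :: real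
  assumes "\<theta> < \<sigma>" "0 \<le> \<theta>" "\<delta> > 0" "k \<ge> 0"
  obtains D where "D \<ge> 0" "\<And>x. x \<ge> 1 \<Longrightarrow> k * x powr \<theta> \<le> \<delta> * x powr \<sigma> + D"
proof -
  have "((\<lambda>x::real. k * x powr (\<theta> - \<sigma>)) \<longlongrightarrow> k * 0) at_top"
    using assms by (intro tendsto_intros tendsto_neg_powr filterlim_ident) auto
  then have "\<forall>\<^sub>F x in at_top. k * x powr (\<theta> - \<sigma>) < \<delta>"
    using assms by (intro order_tendstoD(2)) auto
  then obtain X where X: "\<And>x. x \<ge> X \<Longrightarrow> k * x powr (\<theta> - \<sigma>) < \<delta>"
    unfolding eventually_at_top_linorder by blast
  show ?thesis
  proof
    show "k * \<bar>X\<bar> powr \<theta> \<ge> 0" using assms by simp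
    fix x :: real assume x: "x \<ge> 1"
    show "k * x powr \<theta> \<le> \<delta> * x powr \<sigma> + k * \<bar>X\<bar> powr \<theta>"
    proof (cases "x \<ge> X")
      case True
      have "k * x powr \<theta> = (k * x powr (\<theta> - \<sigma>)) * x powr \<sigma>"
        using x by (simp add: powr_add[symmetric])
      also have "\<dots> \<le> \<delta> * x powr \<sigma>" using X[OF True] by (intro mult_right_mono) auto
      also have "\<dots> \<le> \<delta> * x powr \<sigma> + k * \<bar>X\<bar> powr \<theta>" using assms by simp
      finally show ?thesis .
    next
      case False
      then have "k * x powr \<theta> \<le> k * \<bar>X\<bar> powr \<theta>"
        using assms x by (intro mult_left_mono powr_mono2) auto
      then show ?thesis using assms by (simp add: add_increasing)
    qed
  qed
qed

text \<open>
  The square is absorbed like the exponential, being \<open>exp (2 * ln x)\<close> with \<open>ln x\<close> below a multiple of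
  \<open>x powr (\<sigma>/2)\<close>.
\<close>

lemma subexponential_factor_absorbed:
  fixes \<theta> \<sigma> \<delta> k :: real
  assumes "\<theta> < \<sigma>" "0 \<le> \<theta>" "\<delta> > 0" "k \<ge> 0"
  obtains C where "C > 0" "\<And>x. x \<ge> 1 \<Longrightarrow> x\<^sup>2 * exp (k * x powr \<theta>) \<le> C * exp (\<delta> * x powr \<sigma>)"
proof -
  have \<sigma>: "\<sigma> > 0" using assms by simp
  obtain D1 where D1: "D1 \<ge> 0" "\<And>x. x \<ge> 1 \<Longrightarrow> k * x powr \<theta> \<le> \<delta>/2 * x powr \<sigma> + D1"
    using powr_absorbed_by_larger_powr[OF assms(1,2) _ assms(4), of "\<delta>/2"] assms(3) by auto
  obtain D2 where D2: "D2 \<ge> 0" "\<And>x. x \<ge> 1 \<Longrightarrow> 4/\<sigma> * x powr (\<sigma>/2) \<le> \<delta>/2 * x powr \<sigma> + D2"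
    using powr_absorbed_by_larger_powr[of "\<sigma>/2" \<sigma> "\<delta>/2" "4/\<sigma>"] assms(3) \<sigma> by auto
  show ?thesis
  proof
    show "exp (D1 + D2) > 0" by simp
    fix x :: real assume x: "x \<ge> 1"
    have "ln (x powr (\<sigma>/2)) \<le> x powr (\<sigma>/2)" using x ln_less_self[of "x powr (\<sigma>/2)"] by simp
    then have "2 * ln x \<le> 4/\<sigma> * x powr (\<sigma>/2)" using x \<sigma> by (simp add: ln_powr field_simps)
    moreover have "x\<^sup>2 = exp (2 * ln x)" using x by (simp add: exp_double)
    ultimately have "x\<^sup>2 * exp (k * x powr \<theta>) \<le> exp (4/\<sigma> * x powr (\<sigma>/2)) * exp (k * x powr \<theta>)"
      by simp
    also have "\<dots> \<le> exp (\<delta>/2 * x powr \<sigma> + D2) * exp (\<delta>/2 * x powr \<sigma> + D1)"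
      using D1(2)[OF x] D2(2)[OF x] by (intro mult_mono) auto
    also have "\<dots> = exp (D1 + D2) * exp (\<delta> * x powr \<sigma>)" by (simp add: exp_add[symmetric])
    finally show "x\<^sup>2 * exp (k * x powr \<theta>) \<le> exp (D1 + D2) * exp (\<delta> * x powr \<sigma>)" .
  qed
qed

lemma bracket_ge_1: "bracket lam \<xi> \<ge> 1"
  by (simp add: bracket_def ge_one_powr_ge_zero)

lemma bracket_power2: "(bracket lam \<xi>)\<^sup>2 = 1 + cmod (lam \<xi>)"
  by (simp add: bracket_def powr_half_sqrt)

lemma AE_lebesgue_on_negligible:
  fixes S :: "real set"
  assumes "AE t in lebesgue_on S. P t" "S \<in> sets lebesgue"
  obtains N where "negligible N" "\<And>t. t \<in> S - N \<Longrightarrow> P t"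
proof -
  have "AE t in lebesgue. t \<in> S \<longrightarrow> P t" using assms by (simp add: AE_restrict_space_iff)
  then obtain N where "N \<in> null_sets lebesgue" "{t. \<not> (t \<in> S \<longrightarrow> P t)} \<subseteq> N"
    by (auto simp: eventually_ae_filter)
  then show ?thesis using that[of N] by (auto simp: negligible_iff_null_sets)
qed

lemma wl2_le_mult_gweight:
  assumes "wl2_le I (gweight lam s A) u S" "C \<ge> 0"
    and "\<And>\<xi>. \<xi> \<in> I \<Longrightarrow> cmod (k \<xi>) \<le> C * gweight lam s \<delta> \<xi>"
  shows "wl2_le I (gweight lam s (A - \<delta>)) (\<lambda>\<xi>. k \<xi> * u \<xi>) (C * S)"
proof (rule wl2_le_dominated[OF assms(1,2)])
  fix \<xi> assume \<xi>: "\<xi> \<in> I"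
  have "gweight lam s (A - \<delta>) \<xi> * (cmod (k \<xi>) * cmod (u \<xi>))
      \<le> gweight lam s (A - \<delta>) \<xi> * ((C * gweight lam s \<delta> \<xi>) * cmod (u \<xi>))"
    using assms(3)[OF \<xi>] by (intro mult_left_mono mult_right_mono gweight_nonneg) auto
  also have "\<dots> = C * ((gweight lam s (A - \<delta>) \<xi> * gweight lam s \<delta> \<xi>) * cmod (u \<xi>))" by (simp add: mult_ac)
  also have "gweight lam s (A - \<delta>) \<xi> * gweight lam s \<delta> \<xi> = gweight lam s A \<xi>"
    using gweight_add[of lam s "A - \<delta>" \<delta> \<xi>] by simp
  finally show "gweight lam s (A - \<delta>) \<xi> * cmod (k \<xi> * u \<xi>) \<le> C * (gweight lam s A \<xi> * cmod (u \<xi>))"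
    by (simp add: norm_mult)
qed (rule gweight_nonneg)

section \<open>Estimates uniform in the frequency\<close>

text \<open>
  The force enters the estimate of a single mode through its square integral over time.  Summing over
  the frequencies first and integrating afterwards only requires a bound in the step at each
  time.
\<close>

lemma wl2_le_data_norm:
  fixes F :: "'i \<Rightarrow> real \<Rightarrow> complex"
  assumes u: "wl2_le I w u S\<^sub>0" and v: "wl2_le I w v S\<^sub>1" and T: "T \<ge> 0"
    and F: "\<And>t. t \<in> {0..T} \<Longrightarrow> wl2_le I w (\<lambda>\<xi>. F \<xi> t) S"
    and Fc: "\<And>\<xi>. \<xi> \<in> I \<Longrightarrow> continuous_on {0..T} (F \<xi>)"
  shows "wl2_le I w (\<lambda>\<xi>. of_real (sqrt ((cmod (u \<xi>))\<^sup>2 + (cmod (v \<xi>))\<^sup>2 + integral {0..T} (\<lambda>t. (cmod (F \<xi> t))\<^sup>2))))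
    (sqrt (S\<^sub>0\<^sup>2 + S\<^sub>1\<^sup>2 + T * S\<^sup>2))"
proof (rule wl2_leI)
  fix X assume X: "finite X" "X \<subseteq> I"
  have sq: "(\<Sum>\<xi>\<in>X. (w \<xi> * cmod (g \<xi>))\<^sup>2) \<le> R\<^sup>2" if "wl2_le I w g R" for g R
    using wl2_leD[OF that X] unfolding L2_set_def by (rule sqrt_le_D)
  define J where "J = (\<lambda>\<xi>. integral {0..T} (\<lambda>t. (cmod (F \<xi> t))\<^sup>2))"
  have J0: "J \<xi> \<ge> 0" for \<xi> unfolding J_def
    by (cases "(\<lambda>t. (cmod (F \<xi> t))\<^sup>2) integrable_on {0..T}")
      (auto intro: integral_nonneg simp: not_integrable_integral)
  have "((\<lambda>t. \<Sum>\<xi>\<in>X. (w \<xi>)\<^sup>2 * (cmod (F \<xi> t))\<^sup>2) has_integral (\<Sum>\<xi>\<in>X. (w \<xi>)\<^sup>2 * J \<xi>)) {0..T}"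
    unfolding J_def using X Fc
    by (intro has_integral_sum has_integral_mult_right integrable_integral integrable_continuous_real continuous_intros) auto
  moreover have "((\<lambda>t. S\<^sup>2) has_integral T * S\<^sup>2) {0..T}"
    using has_integral_const_real[of "S\<^sup>2" 0 T] T by simp
  moreover have "(\<Sum>\<xi>\<in>X. (w \<xi>)\<^sup>2 * (cmod (F \<xi> t))\<^sup>2) \<le> S\<^sup>2" if "t \<in> {0..T}" for t
    using sq[OF F[OF that]] by (simp add: power_mult_distrib)
  ultimately have 3: "(\<Sum>\<xi>\<in>X. (w \<xi>)\<^sup>2 * J \<xi>) \<le> T * S\<^sup>2"
    by (rule has_integral_le)
  have "(\<Sum>\<xi>\<in>X. (w \<xi> * cmod (of_real (sqrt ((cmod (u \<xi>))\<^sup>2 + (cmod (v \<xi>))\<^sup>2 + J \<xi>))))\<^sup>2)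
      = (\<Sum>\<xi>\<in>X. (w \<xi> * cmod (u \<xi>))\<^sup>2) + (\<Sum>\<xi>\<in>X. (w \<xi> * cmod (v \<xi>))\<^sup>2) + (\<Sum>\<xi>\<in>X. (w \<xi>)\<^sup>2 * J \<xi>)"
    unfolding sum.distrib[symmetric] using J0
    by (intro sum.cong refl) (simp add: power_mult_distrib distrib_left)
  also have "\<dots> \<le> S\<^sub>0\<^sup>2 + S\<^sub>1\<^sup>2 + T * S\<^sup>2"
    using sq[OF u] sq[OF v] 3 by (intro add_mono)
  finally show "L2_set (\<lambda>\<xi>. w \<xi> * cmod (of_real (sqrt ((cmod (u \<xi>))\<^sup>2 + (cmod (v \<xi>))\<^sup>2 +
      integral {0..T} (\<lambda>t. (cmod (F \<xi> t))\<^sup>2))))) X \<le> sqrt (S\<^sub>0\<^sup>2 + S\<^sub>1\<^sup>2 + T * S\<^sup>2)"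
    unfolding L2_set_def J_def by (rule real_sqrt_le_mono)
qed

text \<open>
  The scalar equations of all frequencies.  The potential \<open>r\<close> is bounded everywhere, and not just almost
  everywhere: it is a bounded representative of the essentially bounded potential, which changes none
  of the integrals.
\<close>

locale gevrey_modes =
  fixes I :: "'i set" and lam :: "'i \<Rightarrow> complex"
    and c s T \<alpha> M a\<^sub>0 A1 B :: real and a r :: "real \<Rightarrow> real"
  assumes c_pos: "c > 0" and T_pos: "T > 0" and alpha: "0 < \<alpha>" "\<alpha> < 1"
    and s_range: "1 \<le> s" "s < 1 + \<alpha> / (1 - \<alpha>)"
    and M_nonneg: "M \<ge> 0"
    and hoelder: "\<And>t t'. t \<in> {0..T} \<Longrightarrow> t' \<in> {0..T} \<Longrightarrow> \<bar>a t - a t'\<bar> \<le> M * \<bar>t - t'\<bar> powr \<alpha>"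
    and a0_pos: "a\<^sub>0 > 0" and a_bounds: "\<And>t. t \<in> {0..T} \<Longrightarrow> a\<^sub>0 \<le> a t \<and> a t \<le> A1"
    and r_measurable: "r \<in> borel_measurable (lebesgue_on {0..T})"
    and r_bound: "\<And>t. t \<in> {0..T} \<Longrightarrow> \<bar>r t\<bar> \<le> B"
begin

abbreviation "mu \<equiv> abs_eigenvalue I lam c"

definition is_mode :: "'i \<Rightarrow> (real \<Rightarrow> complex) \<Rightarrow> (real \<Rightarrow> complex) \<Rightarrow> (real \<Rightarrow> complex) \<Rightarrow> bool" where
  "is_mode \<xi> F y z \<longleftrightarrow>
     (\<forall>t\<in>{0..T}. (y has_vector_derivative z t) (at t within {0..T})) \<and>
     (\<forall>t\<in>{0..T}. ((\<lambda>\<tau>. F \<tau> - of_real (a \<tau> * mu \<xi> + r \<tau>) * y \<tau>) has_integral (z t - z 0)) {0..t})"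

lemma mu_nonneg: "mu \<xi> \<ge> 0"
  using c_pos by (simp add: abs_eigenvalue_def)

lemma mu_le_bracket: "1 + mu \<xi> \<le> (1 + c) * (bracket lam \<xi>)\<^sup>2"
  using c_pos by (simp add: bracket_power2 abs_eigenvalue_def algebra_simps)

lemma a_continuous: "continuous_on {0..T} a"
  using hoelder alpha(1) by (rule hoelder_imp_continuous_on)

lemma A1_nonneg: "A1 \<ge> 0" and B_nonneg: "B \<ge> 0"
  using a_bounds[of 0] r_bound[of 0] T_pos a0_pos by auto

lemma mode_exists:
  assumes "continuous_on {0..T} F"
  shows "\<exists>y z. is_mode \<xi> F y z \<and> y 0 = y\<^sub>0 \<and> z 0 = z\<^sub>0"
proof -
  have "a \<in> borel_measurable (lebesgue_on {0..T})"
    using a_continuous by (rule continuous_imp_measurable_on_sets_lebesgue) simp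
  then have m: "(\<lambda>\<tau>. a \<tau> * mu \<xi> + r \<tau>) \<in> borel_measurable (lebesgue_on {0..T})"
    using r_measurable by measurable
  have b: "\<bar>a t * mu \<xi> + r t\<bar> \<le> A1 * mu \<xi> + B" if "t \<in> {0..T}" for t
  proof -
    have "\<bar>a t * mu \<xi> + r t\<bar> \<le> a t * mu \<xi> + \<bar>r t\<bar>"
      using a_bounds[OF that] a0_pos mu_nonneg[of \<xi>] abs_triangle_ineq[of "a t * mu \<xi>" "r t"] by (simp add: abs_mult)
    also have "\<dots> \<le> A1 * mu \<xi> + B"
      using a_bounds[OF that] r_bound[OF that] mu_nonneg by (intro add_mono mult_right_mono) auto
    finally show ?thesis .
  qed
  have T0: "T \<ge> 0" using T_pos by simp
  obtain y z where "y 0 = y\<^sub>0" "z 0 = z\<^sub>0"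
    "\<And>t. t \<in> {0..T} \<Longrightarrow> (y has_vector_derivative z t) (at t within {0..T})"
    "\<And>t. t \<in> {0..T} \<Longrightarrow> ((\<lambda>\<tau>. F \<tau> - of_real (a \<tau> * mu \<xi> + r \<tau>) * y \<tau>) has_integral (z t - z 0)) {0..t}"
    by (rule second_order_linear_ode_exists[OF T0 m b assms, of y\<^sub>0 z\<^sub>0]) blast+
  then show ?thesis unfolding is_mode_def by blast
qed

text \<open>
  The energy estimate with its factor \<open>exp (K * T)\<close> and the powers of \<open>L\<close> replaced by the weight
  \<open>exp (\<delta> * \<langle>\<xi>\<rangle> powr (1/s))\<close>.  This is the place where the upper bound on \<open>s\<close> is used, in the form
  \<open>1 - \<alpha> < 1/s\<close>.
\<close>

lemma mode_bound:
  assumes \<delta>: "\<delta> > 0"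
  obtains C where "C > 0"
    "\<And>\<xi> F y z t. is_mode \<xi> F y z \<Longrightarrow> continuous_on {0..T} F \<Longrightarrow> t \<in> {0..T} \<Longrightarrow>
       max (cmod (y t)) (cmod (z t)) \<le> C * gweight lam s \<delta> \<xi> *
         sqrt ((cmod (y 0))\<^sup>2 + (cmod (z 0))\<^sup>2 + integral {0..T} (\<lambda>\<tau>. (cmod (F \<tau>))\<^sup>2))"
proof -
  define \<kappa> where "\<kappa> = max 1 (1 / a\<^sub>0)"
  have \<kappa>: "\<kappa> \<ge> 1" by (simp add: \<kappa>_def)
  have s_sub: "1 - \<alpha> < 1 / s"
  proof -
    have "1 + \<alpha> / (1 - \<alpha>) = 1 / (1 - \<alpha>)" using alpha by (simp add: field_simps)
    then have "s * (1 - \<alpha>) < 1" using s_range alpha by (simp add: field_simps)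
    then show ?thesis using s_range by (simp add: field_simps)
  qed
  define k where "k = \<kappa> * (2 * M) * (1 + c) * T"
  define k' where "k' = (\<kappa> * (A1 + B) + 1) * T"
  have k0: "k \<ge> 0" using \<kappa> M_nonneg c_pos T_pos by (simp add: k_def)
  obtain C\<^sub>0 where C0: "C\<^sub>0 > 0" "\<And>x. x \<ge> 1 \<Longrightarrow> x\<^sup>2 * exp (k * x powr (1 - \<alpha>)) \<le> C\<^sub>0 * exp (2 * \<delta> * x powr (1/s))"
    using subexponential_factor_absorbed[OF s_sub _ _ k0, of "2 * \<delta>"] alpha \<delta> by auto
  define C1 where "C1 = (exp k' * (1 + c) * C\<^sub>0) * (1 + A1) / min 1 a\<^sub>0"
  have C1: "C1 > 0" using C0(1) c_pos A1_nonneg a0_pos by (auto simp: C1_def)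
  show ?thesis
  proof
    show "sqrt C1 > 0" using C1 by simp
    fix \<xi> F y z t
    assume mode: "is_mode \<xi> F y z" and F: "continuous_on {0..T} F" and t: "t \<in> {0..T}"
    define x where "x = bracket lam \<xi>"
    define L where "L = sqrt (1 + mu \<xi>)"
    define K where "K = \<kappa> * (2 * M * L powr (1 - \<alpha>) + A1 + B) + 1"
    define N where "N = (cmod (y 0))\<^sup>2 + (cmod (z 0))\<^sup>2 + integral {0..T} (\<lambda>\<tau>. (cmod (F \<tau>))\<^sup>2)"
    have x1: "x \<ge> 1" unfolding x_def by (rule bracket_ge_1)
    have L1: "L \<ge> 1" "L\<^sup>2 = 1 + mu \<xi>" using mu_nonneg[of \<xi>] by (auto simp: L_def)
    have L2: "L\<^sup>2 \<le> (1 + c) * x\<^sup>2" unfolding L1(2) x_def by (rule mu_le_bracket)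
    have "L\<^sup>2 \<le> ((1 + c) * x)\<^sup>2"
    proof -
      have "(1 + c) * x\<^sup>2 \<le> (1 + c)\<^sup>2 * x\<^sup>2"
        using c_pos by (intro mult_right_mono self_le_power) auto
      with L2 show ?thesis by (simp add: power_mult_distrib)
    qed
    then have "L \<le> (1 + c) * x" by (rule power2_le_imp_le) (use c_pos x1 in simp)
    then have "L powr (1 - \<alpha>) \<le> ((1 + c) * x) powr (1 - \<alpha>)"
      using L1 alpha by (intro powr_mono2) auto
    also have "\<dots> = (1 + c) powr (1 - \<alpha>) * x powr (1 - \<alpha>)"
      by (rule powr_mult)
    also have "(1 + c) powr (1 - \<alpha>) \<le> (1 + c) powr 1"
      using c_pos alpha by (intro powr_mono) auto
    finally have Lp: "L powr (1 - \<alpha>) \<le> (1 + c) * x powr (1 - \<alpha>)"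
      using c_pos by (simp add: mult_right_mono)
    have "K * T = \<kappa> * (2 * M) * T * L powr (1 - \<alpha>) + k'" by (simp add: K_def k'_def algebra_simps)
    also have "\<dots> \<le> \<kappa> * (2 * M) * T * ((1 + c) * x powr (1 - \<alpha>)) + k'"
      using Lp \<kappa> M_nonneg T_pos by (intro add_right_mono mult_left_mono) auto
    finally have KT: "K * T \<le> k * x powr (1 - \<alpha>) + k'" by (simp add: k_def algebra_simps)
    have K0: "K \<ge> 0" using \<kappa> M_nonneg A1_nonneg B_nonneg by (simp add: K_def)
    have J: "0 \<le> integral {0..T} (\<lambda>\<tau>. (cmod (F \<tau>))\<^sup>2)"
      using F by (intro integral_nonneg integrable_continuous_real continuous_intros) auto
    have N0: "N \<ge> 0" using J by (simp add: N_def)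
    have Jt: "integral {0..t} (\<lambda>\<tau>. (cmod (F \<tau>))\<^sup>2) \<le> integral {0..T} (\<lambda>\<tau>. (cmod (F \<tau>))\<^sup>2)"
      using t F by (intro integral_subset_le integrable_continuous_real continuous_intros) (auto intro: continuous_on_subset)
    have "(cmod (z t))\<^sup>2 + a\<^sub>0 * L\<^sup>2 * (cmod (y t))\<^sup>2
        \<le> exp (K * t) * ((cmod (z 0))\<^sup>2 + A1 * L\<^sup>2 * (cmod (y 0))\<^sup>2 + integral {0..t} (\<lambda>\<tau>. (cmod (F \<tau>))\<^sup>2))"
      unfolding L_def K_def \<kappa>_def
    proof (rule energy_estimate[OF _ alpha(1) mu_nonneg hoelder M_nonneg a0_pos a_bounds r_bound F _ _ t])
      show "T \<ge> 0" using T_pos by simp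
    qed (use mode in \<open>auto simp: is_mode_def\<close>)
    also have "\<dots> \<le> exp (K * T) * ((1 + A1) * L\<^sup>2 * N)"
    proof (rule mult_mono)
      show "exp (K * t) \<le> exp (K * T)" using t K0 by (simp add: mult_left_mono)
      have e: "1 \<le> (1 + A1) * L\<^sup>2" "A1 * L\<^sup>2 \<le> (1 + A1) * L\<^sup>2"
        using A1_nonneg L1(2) mu_nonneg[of \<xi>] mult_mono[of 1 "1 + A1" 1 "L\<^sup>2"] by (auto simp: mult_right_mono)
      have "1 * ((cmod (z 0))\<^sup>2 + integral {0..t} (\<lambda>\<tau>. (cmod (F \<tau>))\<^sup>2)) + (A1 * L\<^sup>2) * (cmod (y 0))\<^sup>2
          \<le> ((1 + A1) * L\<^sup>2) * ((cmod (z 0))\<^sup>2 + integral {0..T} (\<lambda>\<tau>. (cmod (F \<tau>))\<^sup>2)) + ((1 + A1) * L\<^sup>2) * (cmod (y 0))\<^sup>2"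
      proof (intro add_mono mult_mono e order_refl Jt)
        show "0 \<le> (cmod (z 0))\<^sup>2 + integral {0..t} (\<lambda>\<tau>. (cmod (F \<tau>))\<^sup>2)"
          using t F by (intro add_nonneg_nonneg integral_nonneg integrable_continuous_real continuous_intros)
            (auto intro: continuous_on_subset)
      qed (use A1_nonneg in auto)
      then show "(cmod (z 0))\<^sup>2 + A1 * L\<^sup>2 * (cmod (y 0))\<^sup>2 + integral {0..t} (\<lambda>\<tau>. (cmod (F \<tau>))\<^sup>2) \<le> (1 + A1) * L\<^sup>2 * N"
        by (simp add: N_def algebra_simps)
      show "0 \<le> (cmod (z 0))\<^sup>2 + A1 * L\<^sup>2 * (cmod (y 0))\<^sup>2 + integral {0..t} (\<lambda>\<tau>. (cmod (F \<tau>))\<^sup>2)"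
        using t F A1_nonneg by (intro add_nonneg_nonneg integral_nonneg integrable_continuous_real continuous_intros)
          (auto intro: continuous_on_subset)
    qed simp
    also have "\<dots> = (exp (K * T) * L\<^sup>2) * ((1 + A1) * N)" by (simp add: mult_ac)
    also have "\<dots> \<le> (exp k' * (1 + c) * C\<^sub>0 * (gweight lam s \<delta> \<xi>)\<^sup>2) * ((1 + A1) * N)"
    proof (rule mult_right_mono)
      have "exp (K * T) * L\<^sup>2 \<le> exp (k * x powr (1 - \<alpha>) + k') * ((1 + c) * x\<^sup>2)"
        using KT L2 by (intro mult_mono) auto
      also have "\<dots> = exp k' * (1 + c) * (x\<^sup>2 * exp (k * x powr (1 - \<alpha>)))" by (simp add: exp_add mult_ac)
      also have "\<dots> \<le> exp k' * (1 + c) * (C\<^sub>0 * exp (2 * \<delta> * x powr (1/s)))"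
        using c_pos C0(2)[OF x1] by (intro mult_left_mono) auto
      also have "exp (2 * \<delta> * x powr (1/s)) = (gweight lam s \<delta> \<xi>)\<^sup>2"
        by (simp add: gweight_def x_def exp_double[symmetric] mult.assoc)
      finally show "exp (K * T) * L\<^sup>2 \<le> exp k' * (1 + c) * C\<^sub>0 * (gweight lam s \<delta> \<xi>)\<^sup>2" by (simp add: mult_ac)
    qed (use N0 A1_nonneg in auto)
    also have "\<dots> = min 1 a\<^sub>0 * (C1 * (gweight lam s \<delta> \<xi>)\<^sup>2 * N)"
      using a0_pos by (simp add: C1_def)
    finally have est: "(cmod (z t))\<^sup>2 + a\<^sub>0 * L\<^sup>2 * (cmod (y t))\<^sup>2 \<le> min 1 a\<^sub>0 * (C1 * (gweight lam s \<delta> \<xi>)\<^sup>2 * N)" .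
    have R0: "0 \<le> C1 * (gweight lam s \<delta> \<xi>)\<^sup>2 * N" using C1 N0 by simp
    have zz: "(cmod (z t))\<^sup>2 \<le> C1 * (gweight lam s \<delta> \<xi>)\<^sup>2 * N"
    proof -
      have "(cmod (z t))\<^sup>2 \<le> min 1 a\<^sub>0 * (C1 * (gweight lam s \<delta> \<xi>)\<^sup>2 * N)"
        using est a0_pos by (smt (verit) mult_nonneg_nonneg zero_le_power2)
      also have "\<dots> \<le> 1 * (C1 * (gweight lam s \<delta> \<xi>)\<^sup>2 * N)" using R0 by (intro mult_right_mono) auto
      finally show ?thesis by simp
    qed
    have yy: "(cmod (y t))\<^sup>2 \<le> C1 * (gweight lam s \<delta> \<xi>)\<^sup>2 * N"
    proof -
      have "a\<^sub>0 * (cmod (y t))\<^sup>2 \<le> a\<^sub>0 * L\<^sup>2 * (cmod (y t))\<^sup>2"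
        using a0_pos L1(2) mu_nonneg[of \<xi>] by (intro mult_right_mono) auto
      also have "\<dots> \<le> min 1 a\<^sub>0 * (C1 * (gweight lam s \<delta> \<xi>)\<^sup>2 * N)" using est zero_le_power2[of "cmod (z t)"] by linarith
      also have "\<dots> \<le> a\<^sub>0 * (C1 * (gweight lam s \<delta> \<xi>)\<^sup>2 * N)" using R0 by (intro mult_right_mono) auto
      finally show ?thesis using a0_pos by simp
    qed
    have sq: "sqrt (C1 * (gweight lam s \<delta> \<xi>)\<^sup>2 * N) = sqrt C1 * gweight lam s \<delta> \<xi> * sqrt N"
      by (simp add: real_sqrt_mult gweight_nonneg)
    show "max (cmod (y t)) (cmod (z t)) \<le> sqrt C1 * gweight lam s \<delta> \<xi> *
        sqrt ((cmod (y 0))\<^sup>2 + (cmod (z 0))\<^sup>2 + integral {0..T} (\<lambda>\<tau>. (cmod (F \<tau>))\<^sup>2))"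
      using real_le_rsqrt[OF yy] real_le_rsqrt[OF zz] unfolding sq N_def[symmetric] by simp
  qed
qed

text \<open>
  The difference of two solutions is a solution with zero force and zero data, to which the bound
  applies.
\<close>

lemma mode_unique:
  assumes 1: "is_mode \<xi> F y z" and 2: "is_mode \<xi> F y' z'"
    and init: "y 0 = y' 0" "z 0 = z' 0" and t: "t \<in> {0..T}"
  shows "y t = y' t"
proof -
  have "is_mode \<xi> (\<lambda>_. 0) (\<lambda>t. y t - y' t) (\<lambda>t. z t - z' t)"
    unfolding is_mode_def
  proof (intro conjI ballI)
    fix t assume t: "t \<in> {0..T}"
    show "((\<lambda>t. y t - y' t) has_vector_derivative z t - z' t) (at t within {0..T})"
      using 1 2 t by (intro has_vector_derivative_diff) (auto simp: is_mode_def)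
    have "((\<lambda>\<tau>. F \<tau> - of_real (a \<tau> * mu \<xi> + r \<tau>) * y \<tau>) has_integral (z t - z 0)) {0..t}"
      and "((\<lambda>\<tau>. F \<tau> - of_real (a \<tau> * mu \<xi> + r \<tau>) * y' \<tau>) has_integral (z' t - z' 0)) {0..t}"
      using 1 2 t unfolding is_mode_def by blast+
    from has_integral_diff[OF this] show "((\<lambda>\<tau>. 0 - of_real (a \<tau> * mu \<xi> + r \<tau>) * (y \<tau> - y' \<tau>)) has_integral
        (z t - z' t - (z 0 - z' 0))) {0..t}"
      by (simp add: algebra_simps)
  qed
  note mode = this
  obtain C where "\<And>\<xi> F y z t. is_mode \<xi> F y z \<Longrightarrow> continuous_on {0..T} F \<Longrightarrow> t \<in> {0..T} \<Longrightarrow>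
       max (cmod (y t)) (cmod (z t)) \<le> C * gweight lam s 1 \<xi> *
         sqrt ((cmod (y 0))\<^sup>2 + (cmod (z 0))\<^sup>2 + integral {0..T} (\<lambda>\<tau>. (cmod (F \<tau>))\<^sup>2))"
    by (rule mode_bound[OF zero_less_one]) blast
  from this[OF mode continuous_on_const t]
  show ?thesis using init by simp
qed

lemma mu_absorbed:
  assumes "\<delta> > 0"
  obtains C where "C > 0" "\<And>\<xi>. 1 + mu \<xi> \<le> C * gweight lam s \<delta> \<xi>"
proof -
  obtain C where C: "C > 0" "\<And>x. x \<ge> 1 \<Longrightarrow> x\<^sup>2 * exp (0 * x powr 0) \<le> C * exp (\<delta> * x powr (1/s))"
    using subexponential_factor_absorbed[of 0 "1/s" \<delta> 0] assms s_range by auto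
  show ?thesis
  proof
    show "(1 + c) * C > 0" using c_pos C(1) by simp
    fix \<xi>
    have "(1 + c) * (bracket lam \<xi>)\<^sup>2 \<le> (1 + c) * (C * gweight lam s \<delta> \<xi>)"
      using C(2)[OF bracket_ge_1] c_pos by (intro mult_left_mono) (auto simp: gweight_def)
    then show "1 + mu \<xi> \<le> (1 + c) * C * gweight lam s \<delta> \<xi>"
      using mu_le_bracket[of \<xi>] by (simp add: mult.assoc)
  qed
qed

end

section \<open>Well-posedness\<close>

lemma gevrey_synthesis:
  fixes u :: "'i \<Rightarrow> real ^ 'n::finite \<Rightarrow> complex"
  assumes ub: "riesz_basis I u" and bi: "biorthogonal_system I u d" and A: "A > 0"
    and k: "\<And>t. t \<in> {0..T} \<Longrightarrow> wl2_le I (gweight lam s A) (\<lambda>\<xi>. k \<xi> t) S"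
  shows "\<exists>v. \<forall>t\<in>{0..T}. v t \<in> gevrey I lam d s \<and> (\<forall>\<xi>\<in>I. hfourier d (v t) \<xi> = k \<xi> t)"
proof (rule bchoice, rule ballI)
  show "\<exists>f. f \<in> gevrey I lam d s \<and> (\<forall>\<xi>\<in>I. hfourier d f \<xi> = k \<xi> t)" if t: "t \<in> {0..T}" for t
  proof -
    have "(\<Sum>\<xi>\<in>F. (cmod (k \<xi> t))\<^sup>2) \<le> S\<^sup>2" if F: "finite F" "F \<subseteq> I" for F
    proof -
      have "(\<Sum>\<xi>\<in>F. (cmod (k \<xi> t))\<^sup>2) \<le> (\<Sum>\<xi>\<in>F. (gweight lam s A \<xi> * cmod (k \<xi> t))\<^sup>2)"
        using A gweight_ge_1[of A lam s] by (intro sum_mono power_mono) (auto simp: mult_le_cancel_right1)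
      also have "\<dots> \<le> S\<^sup>2"
        using wl2_leD[OF k[OF t] F] unfolding L2_set_def by (rule sqrt_le_D)
      finally show ?thesis .
    qed
    then have "(\<lambda>\<xi>. (cmod (k \<xi> t))\<^sup>2) summable_on I"
      by (intro nonneg_bdd_above_summable_on) (auto intro!: bdd_aboveI[where M="S\<^sup>2"])
    then obtain f where f: "f \<in> L2" "\<And>\<xi>. \<xi> \<in> I \<Longrightarrow> hfourier d f \<xi> = k \<xi> t"
      using hfourier_surjective[OF ub bi, of "\<lambda>\<xi>. k \<xi> t"] by blast
    have "wl2_le I (gweight lam s A) (hfourier d f) S"
      using k[OF t] f(2) by (subst wl2_le_cong) auto
    with f show ?thesis using gevreyI[OF f(1) A] by blast
  qed
qed

lemma wl2_le_lipschitz_imp_continuous: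
  assumes lip: "\<And>t'. t' \<in> {0..T} \<Longrightarrow> wl2_le I w (\<Delta> t') (S * \<bar>t' - t\<bar>)" and e: "e > 0"
  shows "\<exists>\<delta>>0. \<forall>t'\<in>{0..T}. \<bar>t' - t\<bar> < \<delta> \<longrightarrow> wl2_le I w (\<Delta> t') e"
proof (intro exI[of _ "e / (\<bar>S\<bar> + 1)"] conjI ballI impI)
  show "e / (\<bar>S\<bar> + 1) > 0" using e by simp
  fix t' assume t': "t' \<in> {0..T}" "\<bar>t' - t\<bar> < e / (\<bar>S\<bar> + 1)"
  have "S * \<bar>t' - t\<bar> \<le> (\<bar>S\<bar> + 1) * \<bar>t' - t\<bar>" by (intro mult_right_mono) auto
  also have "\<dots> \<le> e" using t'(2) by (simp add: field_simps)
  finally show "wl2_le I w (\<Delta> t') e" using lip[OF t'(1)] by (rule wl2_le_mono[rotated])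
qed

lemma Linfty_bounded_representative:
  assumes "Linfty_on T q"
  obtains r B where "B \<ge> 0" "r \<in> borel_measurable (lebesgue_on {0..T})" "\<And>t. \<bar>r t\<bar> \<le> B"
    "AE t in lebesgue_on {0..T}. r t = q t"
proof -
  obtain B where q [measurable]: "q \<in> borel_measurable (lebesgue_on {0..T})"
    and B: "AE t in lebesgue_on {0..T}. \<bar>q t\<bar> \<le> B"
    using assms unfolding Linfty_on_def by blast
  show ?thesis
  proof (rule that[of "max B 0" "\<lambda>t. if \<bar>q t\<bar> \<le> B then q t else 0"])
    show "AE t in lebesgue_on {0..T}. (if \<bar>q t\<bar> \<le> B then q t else 0) = q t"
      using B by (rule AE_mp) auto
    show "(\<lambda>t. if \<bar>q t\<bar> \<le> B then q t else 0) \<in> borel_measurable (lebesgue_on {0..T})"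
      by measurable
  qed auto
qed

lemma has_integral_AE_cong:
  fixes g h :: "real \<Rightarrow> complex"
  assumes ae: "AE \<tau> in lebesgue_on {0..T}. g \<tau> = h \<tau>"
    and g: "(g has_integral X) {0..t}" and t: "t \<in> {0..T}"
  shows "(h has_integral X) {0..t}"
proof -
  obtain N where N: "negligible N" "\<And>\<tau>. \<tau> \<in> {0..T} - N \<Longrightarrow> g \<tau> = h \<tau>"
    using AE_lebesgue_on_negligible[OF ae] by auto
  show ?thesis
    by (rule has_integral_spike[OF N(1) _ g]) (use N(2) t in auto)
qed

text \<open>
  Two almost everywhere equal potentials give the same integrated equation.  This moves between the
  essentially bounded potential, its bounded representative and its continuous representative.
\<close>

lemma integrand_swap_potential:
  fixes p q :: "real \<Rightarrow> real" and y F :: "real \<Rightarrow> complex"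
  assumes "AE t in lebesgue_on {0..T}. p t = q t"
    and "((\<lambda>\<tau>. F \<tau> - of_real (b \<tau> + p \<tau>) * y \<tau>) has_integral X) {0..t}" "t \<in> {0..T}"
  shows "((\<lambda>\<tau>. F \<tau> - of_real (b \<tau> + q \<tau>) * y \<tau>) has_integral X) {0..t}"
  by (rule has_integral_AE_cong[OF _ assms(2,3)]) (rule AE_mp[OF assms(1)], simp)

theorem theorem2p2:
  fixes V :: "real ^ 'n \<Rightarrow> complex"
    and D :: "(real ^ 'n \<Rightarrow> complex) set"
    and I :: "'i set"
    and lam :: "'i \<Rightarrow> complex"
    and u d :: "'i \<Rightarrow> real ^ 'n \<Rightarrow> complex"
    and c T s \<alpha> a\<^sub>0 :: real
    and a q :: "real \<Rightarrow> real"
    and f :: "real \<Rightarrow> real ^ 'n \<Rightarrow> complex"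
    and v\<^sub>0 v\<^sub>1 :: "real ^ 'n \<Rightarrow> complex"
  defines "G \<equiv> gevrey_topology I lam d s"
    and "\<mu> \<equiv> abs_eigenvalue I lam c"
  assumes H0: "schroedinger_operator V D"
    and index: "countable I"
    and spectrum: "op_spectrum V D = lam ` I" "ess_spectrum V D = {}"
    and eigenfunctions: "\<And>\<xi>. \<xi> \<in> I \<Longrightarrow> u \<xi> \<in> D \<and> schroedinger_eq V (u \<xi>) (\<lambda>x. lam \<xi> * u \<xi> x)"
    and basis: "riesz_basis I u"
    and dual: "biorthogonal_system I u d"
    and shift: "c > 0"
    and T: "T > 0"
    and alpha: "0 < \<alpha>" "\<alpha> < 1"
    and a_hoelder: "hoelder_on T \<alpha> a"
    and a_inf: "(INF t\<in>{0..T}. a t) = a\<^sub>0" "a\<^sub>0 > 0"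
    and q_bounded: "Linfty_on T q"
    and s_range: "1 \<le> s" "s < 1 + \<alpha> / (1 - \<alpha>)"
    and f_cont: "time_continuous T G f"
    and data: "v\<^sub>0 \<in> gevrey I lam d s" "v\<^sub>1 \<in> gevrey I lam d s"
  shows "\<exists>v. strong_solution I d \<mu> T G a q f v\<^sub>0 v\<^sub>1 v \<and>
             (\<forall>w. strong_solution I d \<mu> T G a q f v\<^sub>0 v\<^sub>1 w \<longrightarrow>
                  (\<forall>t\<in>{0..T}. AE x in lebesgue. w t x = v t x)) \<and>
             (\<forall>p. continuous_on {0..T} p \<and> (AE t in lebesgue_on {0..T}. p t = q t) \<longrightarrow>
                  classical_solution I d \<mu> T G a p f v\<^sub>0 v\<^sub>1 v)"
proof -
  have d: "\<forall>\<xi>\<in>I. d \<xi> \<in> L2" using dual by (simp add: biorthogonal_system_def)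
  have f_cont': "time_continuous T (gevrey_topology I lam d s) f" using f_cont by (simp add: G_def)
  obtain M where M: "M > 0"
    "\<And>t t'. t \<in> {0..T} \<Longrightarrow> t' \<in> {0..T} \<Longrightarrow> \<bar>a t - a t'\<bar> \<le> M * \<bar>t - t'\<bar> powr \<alpha>"
    using a_hoelder unfolding hoelder_on_def by blast
  define A1 where "A1 = a 0 + M * T powr \<alpha>"
  have a_near: "\<bar>a t - a 0\<bar> \<le> M * T powr \<alpha>" if t: "t \<in> {0..T}" for t
  proof -
    have "\<bar>a t - a 0\<bar> \<le> M * \<bar>t - 0\<bar> powr \<alpha>" using t by (intro M(2)) auto
    also have "\<dots> \<le> M * T powr \<alpha>" using t M(1) alpha by (intro mult_left_mono powr_mono2) auto
    finally show ?thesis .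
  qed
  have "bdd_below (a ` {0..T})"
  proof (rule bdd_belowI2)
    show "a 0 - M * T powr \<alpha> \<le> a t" if "t \<in> {0..T}" for t using a_near[OF that] by linarith
  qed
  then have a_bounds: "a\<^sub>0 \<le> a t \<and> a t \<le> A1" if "t \<in> {0..T}" for t
    using cINF_lower[of a "{0..T}" t] that a_inf(1) a_near[OF that] by (auto simp: A1_def)
  obtain r B where B: "B \<ge> 0" and r: "r \<in> borel_measurable (lebesgue_on {0..T})" "\<And>t. \<bar>r t\<bar> \<le> B"
    and rq: "AE t in lebesgue_on {0..T}. r t = q t"
    using Linfty_bounded_representative[OF q_bounded] by metis
  interpret gevrey_modes I lam c s T \<alpha> M a\<^sub>0 A1 B a r
    using shift T alpha s_range M a_inf(2) a_bounds r by unfold_locales auto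
  have \<mu>: "\<mu> = mu" by (simp add: \<mu>_def)
  have qr: "AE t in lebesgue_on {0..T}. q t = r t" using rq by (rule AE_mp) auto
  have a_pos: "0 \<le> a t" if "t \<in> {0..T}" for t using a_bounds[OF that] a_inf(2) by linarith

  obtain Af Sf where Af: "Af > 0" "\<And>t. t \<in> {0..T} \<Longrightarrow> wl2_le I (gweight lam s Af) (hfourier d (f t)) Sf"
    using time_continuous_step_bounded[OF d f_cont'] by metis
  obtain B0 S0 where B0: "B0 > 0" "wl2_le I (gweight lam s B0) (hfourier d v\<^sub>0) S0"
    using data(1) by (rule gevreyE)
  obtain B1 S1 where B1: "B1 > 0" "wl2_le I (gweight lam s B1) (hfourier d v\<^sub>1) S1"
    using data(2) by (rule gevreyE)
  define A where "A = min Af (min B0 B1)"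
  \<comment> \<open>Half of the exponent is kept: one \<open>\<delta>\<close> pays for the energy estimate, and a second one for
    the factor \<open>\<mu>\<close> in \<open>y'' = F - (a \<mu> + q) y\<close>.\<close>
  define \<delta> where "\<delta> = A / 4"
  define E where "E = A / 2"
  have A0: "A > 0" using Af(1) B0(1) B1(1) by (simp add: A_def)
  have pos: "\<delta> > 0" "E > 0" "A - \<delta> > 0" "E < Af" "E \<le> A" "E \<le> A - \<delta>" and E_eq: "A - \<delta> - \<delta> = E"
    using A0 by (auto simp: \<delta>_def E_def A_def)
  define F where "F = (\<lambda>\<xi> t. hfourier d (f t) \<xi>)"
  have FA: "wl2_le I (gweight lam s A) (\<lambda>\<xi>. F \<xi> t) Sf" if "t \<in> {0..T}" for t
    using wl2_le_gweight_mono[OF Af(2)[OF that], of A] by (simp add: F_def A_def)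
  have v0A: "wl2_le I (gweight lam s A) (hfourier d v\<^sub>0) S0"
    using wl2_le_gweight_mono[OF B0(2), of A] by (simp add: A_def)
  have v1A: "wl2_le I (gweight lam s A) (hfourier d v\<^sub>1) S1"
    using wl2_le_gweight_mono[OF B1(2), of A] by (simp add: A_def)
  have F_cont: "\<exists>\<delta>>0. \<forall>t'\<in>{0..T}. \<bar>t' - t\<bar> < \<delta> \<longrightarrow> wl2_le I (gweight lam s E) (\<lambda>\<xi>. F \<xi> t' - F \<xi> t) e"
    if t: "t \<in> {0..T}" and e: "e > 0" for t e
  proof -
    obtain \<delta>' where "\<delta>' > 0" "\<And>t'. t' \<in> {0..T} \<Longrightarrow> \<bar>t' - t\<bar> < \<delta>' \<Longrightarrow>
      wl2_le I (gweight lam s E) (\<lambda>\<xi>. hfourier d (f t') \<xi> - hfourier d (f t) \<xi>) e"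
      by (rule time_continuous_step_continuous[OF d f_cont' Af(2) less_imp_le[OF pos(2)] pos(4) t e]) blast+
    then show ?thesis unfolding F_def by blast
  qed
  have Fc: "continuous_on {0..T} (F \<xi>)" if \<xi>: "\<xi> \<in> I" for \<xi>
  proof (rule continuous_onI)
    fix t e :: real assume t: "t \<in> {0..T}" and e: "e > 0"
    obtain \<delta>' where \<delta>': "\<delta>' > 0" "\<And>t'. t' \<in> {0..T} \<Longrightarrow> \<bar>t' - t\<bar> < \<delta>' \<Longrightarrow>
        wl2_le I (gweight lam s E) (\<lambda>\<xi>. F \<xi> t' - F \<xi> t) e"
      using F_cont[OF t e] by blast
    have "dist (F \<xi> t') (F \<xi> t) \<le> e" if "t' \<in> {0..T}" "dist t' t < \<delta>'" for t'
    proof -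
      have "gweight lam s E \<xi> * cmod (F \<xi> t' - F \<xi> t) \<le> e"
        using wl2_leD[OF \<delta>'(2)[of t'], of "{\<xi>}"] that \<xi> gweight_nonneg[of lam s E \<xi>]
        by (simp add: dist_real_def L2_set_def abs_mult)
      moreover have "1 * cmod (F \<xi> t' - F \<xi> t) \<le> gweight lam s E \<xi> * cmod (F \<xi> t' - F \<xi> t)"
        using gweight_ge_1[of E lam s \<xi>] pos(2) by (intro mult_right_mono) auto
      ultimately show ?thesis by (simp add: dist_norm)
    qed
    with \<delta>'(1) show "\<exists>d>0. \<forall>x'\<in>{0..T}. dist x' t < d \<longrightarrow> dist (F \<xi> x') (F \<xi> t) \<le> e" by blast
  qed

  have "\<forall>\<xi>\<in>I. \<exists>yz. is_mode \<xi> (F \<xi>) (fst yz) (snd yz) \<and> fst yz 0 = hfourier d v\<^sub>0 \<xi> \<and> snd yz 0 = hfourier d v\<^sub>1 \<xi>"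
    using mode_exists[OF Fc] by (metis fst_conv snd_conv)
  \<comment> \<open>The pair consists of the solution at frequency \<open>\<xi>\<close> and its time derivative.\<close>
  then obtain yz where yz: "\<forall>\<xi>\<in>I. is_mode \<xi> (F \<xi>) (fst (yz \<xi>)) (snd (yz \<xi>)) \<and>
      fst (yz \<xi>) 0 = hfourier d v\<^sub>0 \<xi> \<and> snd (yz \<xi>) 0 = hfourier d v\<^sub>1 \<xi>"
    by (rule bchoice[THEN exE])
  define y where "y = (\<lambda>\<xi>. fst (yz \<xi>))"
  define z where "z = (\<lambda>\<xi>. snd (yz \<xi>))"
  have mode: "is_mode \<xi> (F \<xi>) (y \<xi>) (z \<xi>)" and y0: "y \<xi> 0 = hfourier d v\<^sub>0 \<xi>" and z0: "z \<xi> 0 = hfourier d v\<^sub>1 \<xi>"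
    if "\<xi> \<in> I" for \<xi>
    using yz that by (auto simp: y_def z_def)
  define N where "N = (\<lambda>\<xi>. sqrt ((cmod (hfourier d v\<^sub>0 \<xi>))\<^sup>2 + (cmod (hfourier d v\<^sub>1 \<xi>))\<^sup>2 +
      integral {0..T} (\<lambda>t. (cmod (F \<xi> t))\<^sup>2)))"
  define SN where "SN = sqrt (S0\<^sup>2 + S1\<^sup>2 + T * Sf\<^sup>2)"
  have NA: "wl2_le I (gweight lam s A) (\<lambda>\<xi>. of_real (N \<xi>)) SN"
    unfolding N_def SN_def using T by (intro wl2_le_data_norm v0A v1A FA Fc) auto
  obtain C where C: "C > 0"
    "\<And>\<xi> F y z t. is_mode \<xi> F y z \<Longrightarrow> continuous_on {0..T} F \<Longrightarrow> t \<in> {0..T} \<Longrightarrow>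
       max (cmod (y t)) (cmod (z t)) \<le> C * gweight lam s \<delta> \<xi> *
         sqrt ((cmod (y 0))\<^sup>2 + (cmod (z 0))\<^sup>2 + integral {0..T} (\<lambda>\<tau>. (cmod (F \<tau>))\<^sup>2))"
    by (rule mode_bound[OF pos(1)]) blast
  have yz_bound: "cmod (y \<xi> t) \<le> C * gweight lam s \<delta> \<xi> * N \<xi>" "cmod (z \<xi> t) \<le> C * gweight lam s \<delta> \<xi> * N \<xi>"
    if "\<xi> \<in> I" "t \<in> {0..T}" for \<xi> t
    using C(2)[OF mode[OF that(1)] Fc[OF that(1)] that(2)] unfolding y0[OF that(1)] z0[OF that(1)] N_def by simp_all
  define S where "S = C * SN"
  have absorb: "wl2_le I (gweight lam s (A - \<delta>)) k S"
    if k: "\<And>\<xi>. \<xi> \<in> I \<Longrightarrow> cmod (k \<xi>) \<le> C * gweight lam s \<delta> \<xi> * N \<xi>" for k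
    unfolding S_def
  proof (rule wl2_le_dominated[OF NA less_imp_le[OF C(1)] gweight_nonneg])
    fix \<xi> assume \<xi>: "\<xi> \<in> I"
    have "gweight lam s (A - \<delta>) \<xi> * cmod (k \<xi>) \<le> gweight lam s (A - \<delta>) \<xi> * (C * gweight lam s \<delta> \<xi> * N \<xi>)"
      using k[OF \<xi>] by (intro mult_left_mono gweight_nonneg)
    also have "\<dots> = C * (gweight lam s (A - \<delta> + \<delta>) \<xi> * N \<xi>)" unfolding gweight_add by (simp add: mult_ac)
    also have "\<dots> \<le> C * (gweight lam s A \<xi> * cmod (of_real (N \<xi>)))"
      using C(1) by (auto intro!: mult_left_mono gweight_nonneg)
    finally show "gweight lam s (A - \<delta>) \<xi> * cmod (k \<xi>) \<le> C * (gweight lam s A \<xi> * cmod (of_real (N \<xi>)))" .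
  qed
  have yA: "wl2_le I (gweight lam s (A - \<delta>)) (\<lambda>\<xi>. y \<xi> t) S" and zA: "wl2_le I (gweight lam s (A - \<delta>)) (\<lambda>\<xi>. z \<xi> t) S"
    if "t \<in> {0..T}" for t
    by (intro absorb yz_bound that; assumption)+
  have S_nonneg: "S \<ge> 0" using yA[of 0] T by (auto intro: wl2_le_nonneg)

  obtain Cm where Cm: "Cm > 0" "\<And>\<xi>. 1 + mu \<xi> \<le> Cm * gweight lam s \<delta> \<xi>"
    using mu_absorbed[OF pos(1)] by blast
  have mult_mu: "wl2_le I (gweight lam s E) (\<lambda>\<xi>. of_real (x1 * mu \<xi> + x2) * k \<xi>) ((\<bar>x1\<bar> + \<bar>x2\<bar>) * Cm * R)"
    if "wl2_le I (gweight lam s (A - \<delta>)) k R" for x1 x2 k R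
    unfolding E_eq[symmetric]
  proof (rule wl2_le_mult_gweight[OF that])
    show "(\<bar>x1\<bar> + \<bar>x2\<bar>) * Cm \<ge> 0" using Cm(1) by simp
    fix \<xi>
    have "cmod (of_real (x1 * mu \<xi> + x2)) \<le> \<bar>x1\<bar> * mu \<xi> + \<bar>x2\<bar>"
      unfolding norm_of_real using abs_triangle_ineq[of "x1 * mu \<xi>" x2] mu_nonneg[of \<xi>] by (simp add: abs_mult)
    also have "\<dots> \<le> (\<bar>x1\<bar> + \<bar>x2\<bar>) * (1 + mu \<xi>)" using mu_nonneg[of \<xi>] by (simp add: algebra_simps)
    also have "\<dots> \<le> (\<bar>x1\<bar> + \<bar>x2\<bar>) * (Cm * gweight lam s \<delta> \<xi>)" using Cm(2) by (intro mult_left_mono) auto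
    finally show "cmod (of_real (x1 * mu \<xi> + x2)) \<le> (\<bar>x1\<bar> + \<bar>x2\<bar>) * Cm * gweight lam s \<delta> \<xi>" by (simp add: mult.assoc)
  qed
  define g where "g = (\<lambda>p \<xi> t. F \<xi> t - of_real (a t * mu \<xi> + p t) * y \<xi> t)"
  have gE: "wl2_le I (gweight lam s E) (\<lambda>\<xi>. g p \<xi> t) (Sf + (A1 + P) * Cm * S)"
    if t: "t \<in> {0..T}" and p: "\<bar>p t\<bar> \<le> P" for p t P
  proof -
    have "wl2_le I (gweight lam s E) (\<lambda>\<xi>. g p \<xi> t) (Sf + (\<bar>a t\<bar> + \<bar>p t\<bar>) * Cm * S)"
      unfolding g_def by (intro wl2_le_diff mult_mu yA t gweight_nonneg wl2_le_gweight_mono[OF FA pos(5)])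
    moreover have "(\<bar>a t\<bar> + \<bar>p t\<bar>) * Cm * S \<le> (A1 + P) * Cm * S"
      using a_bounds[OF t] a_pos[OF t] p Cm(1) S_nonneg by (intro mult_right_mono) auto
    ultimately show ?thesis by (auto intro: wl2_le_mono)
  qed
  have grE: "wl2_le I (gweight lam s E) (\<lambda>\<xi>. g r \<xi> t) (Sf + (A1 + B) * Cm * S)" if "t \<in> {0..T}" for t
    by (rule gE[OF that, of r B]) (rule r(2))
  have int_y: "(z \<xi> has_integral (y \<xi> t - y \<xi> 0)) {0..t}" if "\<xi> \<in> I" "t \<in> {0..T}" for \<xi> t
  proof (rule fundamental_theorem_of_calculus)
    fix x assume x: "x \<in> {0..t}"
    show "(y \<xi> has_vector_derivative z \<xi> x) (at x within {0..t})"
      by (rule has_vector_derivative_within_subset[where S="{0..T}"])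
        (use mode[OF that(1)] that(2) x in \<open>auto simp: is_mode_def\<close>)
  qed (use that in simp)
  have int_z: "(g r \<xi> has_integral (z \<xi> t - z \<xi> 0)) {0..t}" if "\<xi> \<in> I" "t \<in> {0..T}" for \<xi> t
    using mode[OF that(1)] that(2) unfolding is_mode_def g_def by blast
  have y_lip: "wl2_le I (gweight lam s (A - \<delta>)) (\<lambda>\<xi>. y \<xi> t' - y \<xi> t) (S * \<bar>t' - t\<bar>)"
    if "t \<in> {0..T}" "t' \<in> {0..T}" for t t'
    by (rule wl2_le_primitive_lipschitz[OF int_y gweight_nonneg zA that])
  have z_lip: "wl2_le I (gweight lam s E) (\<lambda>\<xi>. z \<xi> t' - z \<xi> t) ((Sf + (A1 + B) * Cm * S) * \<bar>t' - t\<bar>)"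
    if "t \<in> {0..T}" "t' \<in> {0..T}" for t t'
    by (rule wl2_le_primitive_lipschitz[OF int_z gweight_nonneg grE that])

  obtain v where v_props: "\<forall>t\<in>{0..T}. v t \<in> gevrey I lam d s \<and> (\<forall>\<xi>\<in>I. hfourier d (v t) \<xi> = y \<xi> t)"
    using gevrey_synthesis[OF basis dual pos(3) yA] ..
  then have v: "\<And>t. t \<in> {0..T} \<Longrightarrow> v t \<in> gevrey I lam d s"
    "\<And>t \<xi>. t \<in> {0..T} \<Longrightarrow> \<xi> \<in> I \<Longrightarrow> hfourier d (v t) \<xi> = y \<xi> t"
    by simp_all
  obtain v' where v'_props: "\<forall>t\<in>{0..T}. v' t \<in> gevrey I lam d s \<and> (\<forall>\<xi>\<in>I. hfourier d (v' t) \<xi> = z \<xi> t)"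
    using gevrey_synthesis[OF basis dual pos(3) zA] ..
  then have v': "\<And>t. t \<in> {0..T} \<Longrightarrow> v' t \<in> gevrey I lam d s"
    "\<And>t \<xi>. t \<in> {0..T} \<Longrightarrow> \<xi> \<in> I \<Longrightarrow> hfourier d (v' t) \<xi> = z \<xi> t"
    by simp_all
  have T0: "0 \<in> {0..T}" using T by simp
  have v_cont: "\<exists>\<eta>>0. \<forall>t'\<in>{0..T}. \<bar>t' - t\<bar> < \<eta> \<longrightarrow>
      wl2_le I (gweight lam s (A - \<delta>)) (\<lambda>\<xi>. hfourier d (v t') \<xi> - hfourier d (v t) \<xi>) e"
    if t: "t \<in> {0..T}" and e: "e > 0" for t e
    using y_lip[OF t] v(2) t
    by (intro wl2_le_lipschitz_imp_continuous[OF _ e, where S=S]) (subst wl2_le_cong, auto)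
  have v'_cont: "\<exists>\<delta>>0. \<forall>t'\<in>{0..T}. \<bar>t' - t\<bar> < \<delta> \<longrightarrow>
      wl2_le I (gweight lam s E) (\<lambda>\<xi>. hfourier d (v' t') \<xi> - hfourier d (v' t) \<xi>) e"
    if t: "t \<in> {0..T}" and e: "e > 0" for t e
    using z_lip[OF t] v'(2) t
    by (intro wl2_le_lipschitz_imp_continuous[OF _ e, where S="Sf + (A1 + B) * Cm * S"]) (subst wl2_le_cong, auto)
  have tc_v: "time_continuous T G v"
    unfolding G_def using v_cont by (intro time_continuous_gevreyI[OF d pos(3) v(1)]) auto
  have tc_v': "time_continuous T G v'"
    unfolding G_def using v'_cont by (intro time_continuous_gevreyI[OF d pos(2) v'(1)]) auto
  have deriv_v: "has_time_derivative T G v v'"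
    unfolding G_def
  proof (rule has_time_derivative_gevreyI[OF d pos(2) v(1) v'(1)])
    fix \<xi> t assume "\<xi> \<in> I" "t \<in> {0..T}"
    then show "((\<lambda>\<tau>. hfourier d (v' \<tau>) \<xi>) has_integral hfourier d (v t) \<xi> - hfourier d (v 0) \<xi>) {0..t}"
      using int_y[of \<xi> t] v(2) T0 v'(2) by (auto elim!: has_integral_eq[rotated])
  qed (use v'_cont in auto)

  obtain v'' where v''_props: "\<forall>t\<in>{0..T}. v'' t \<in> gevrey I lam d s \<and> (\<forall>\<xi>\<in>I. hfourier d (v'' t) \<xi> = g r \<xi> t)"
    using gevrey_synthesis[OF basis dual pos(2) grE] ..
  then have v'': "\<And>t. t \<in> {0..T} \<Longrightarrow> v'' t \<in> gevrey I lam d s"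
    "\<And>t \<xi>. t \<in> {0..T} \<Longrightarrow> \<xi> \<in> I \<Longrightarrow> hfourier d (v'' t) \<xi> = g r \<xi> t"
    by simp_all
  have bounded_v'': "bounded_in G (v'' ` {0..T})"
    unfolding G_def
  proof (rule bounded_in_gevreyI[OF d pos(2), where S="Sf + (A1 + B) * Cm * S"])
    fix h assume "h \<in> v'' ` {0..T}"
    then obtain t where t: "t \<in> {0..T}" "h = v'' t" by blast
    show "h \<in> L2" using gevrey_L2[OF v''(1)[OF t(1)]] t(2) by simp
    have "wl2_le I (gweight lam s E) (hfourier d (v'' t)) (Sf + (A1 + B) * Cm * S) \<longleftrightarrow>
        wl2_le I (gweight lam s E) (\<lambda>\<xi>. g r \<xi> t) (Sf + (A1 + B) * Cm * S)"
      using v''(2)[OF t(1)] by (rule wl2_le_cong)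
    with grE[OF t(1)] show "wl2_le I (gweight lam s E) (hfourier d h) (Sf + (A1 + B) * Cm * S)"
      by (simp add: t(2))
  qed
  have strong: "strong_solution I d \<mu> T G a q f v\<^sub>0 v\<^sub>1 v"
    unfolding strong_solution_def
  proof (rule exI[of _ v'], rule exI[of _ v''], intro conjI ballI tc_v tc_v' deriv_v)
    show "bounded_in G (v'' ` {0..T})" by (rule bounded_v'')
    fix \<xi> assume \<xi>: "\<xi> \<in> I"
    show "((\<lambda>\<tau>. hfourier d (v'' \<tau>) \<xi>) has_integral (hfourier d (v' t) \<xi> - hfourier d (v' 0) \<xi>)) {0..t}"
      if t: "t \<in> {0..T}" for t
      using int_z[OF \<xi> t] v'(2) T0 v''(2) t \<xi> by (auto elim!: has_integral_eq[rotated])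
    have "AE t in lebesgue_on {0..T}. t \<in> {0..T}" by (rule AE_space[THEN AE_mp]) simp
    with rq show "AE t in lebesgue_on {0..T}.
           hfourier d (v'' t) \<xi> + of_real (a t) * of_real (\<mu> \<xi>) * hfourier d (v t) \<xi>
             + of_real (q t) * hfourier d (v t) \<xi> = hfourier d (f t) \<xi>"
    proof eventually_elim
      case (elim t)
      show ?case
        unfolding elim(1)[symmetric] v(2)[OF elim(2) \<xi>] v''(2)[OF elim(2) \<xi>] by (simp add: g_def F_def \<mu> algebra_simps)
    qed
    show "hfourier d (v 0) \<xi> = hfourier d v\<^sub>0 \<xi>" "hfourier d (v' 0) \<xi> = hfourier d v\<^sub>1 \<xi>"
      using v(2)[OF T0 \<xi>] v'(2)[OF T0 \<xi>] y0 z0 \<xi> by auto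
  qed

  have unique: "AE x in lebesgue. w t x = v t x"
    if w: "strong_solution I d \<mu> T G a q f v\<^sub>0 v\<^sub>1 w" and t: "t \<in> {0..T}" for w t
  proof -
    obtain w' w'' where w1: "time_continuous T G w" and w2: "has_time_derivative T G w w'"
      and w3: "\<And>\<xi> t. \<xi> \<in> I \<Longrightarrow> t \<in> {0..T} \<Longrightarrow>
           ((\<lambda>\<tau>. hfourier d (w'' \<tau>) \<xi>) has_integral (hfourier d (w' t) \<xi> - hfourier d (w' 0) \<xi>)) {0..t}"
      and w4: "\<And>\<xi>. \<xi> \<in> I \<Longrightarrow> AE t in lebesgue_on {0..T}.
           hfourier d (w'' t) \<xi> + of_real (a t) * of_real (\<mu> \<xi>) * hfourier d (w t) \<xi>
             + of_real (q t) * hfourier d (w t) \<xi> = hfourier d (f t) \<xi>"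
      and w5: "\<And>\<xi>. \<xi> \<in> I \<Longrightarrow> hfourier d (w 0) \<xi> = hfourier d v\<^sub>0 \<xi> \<and> hfourier d (w' 0) \<xi> = hfourier d v\<^sub>1 \<xi>"
      using w unfolding strong_solution_def by blast
    have wG: "w t \<in> gevrey I lam d s" if "t \<in> {0..T}" for t
      using w1 that unfolding G_def by (rule time_continuous_gevrey[OF d])
    have coeff: "hfourier d (w t) \<xi> = hfourier d (v t) \<xi>" if \<xi>: "\<xi> \<in> I" for \<xi>
    proof -
      have "is_mode \<xi> (F \<xi>) (\<lambda>t. hfourier d (w t) \<xi>) (\<lambda>t. hfourier d (w' t) \<xi>)"
        unfolding is_mode_def
      proof (intro conjI ballI)
        fix t assume t: "t \<in> {0..T}"
        show "((\<lambda>t. hfourier d (w t) \<xi>) has_vector_derivative hfourier d (w' t) \<xi>) (at t within {0..T})"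
          using w2 unfolding G_def by (intro has_time_derivative_hfourier[OF d wG _ \<xi> t])
        have "AE \<tau> in lebesgue_on {0..T}. hfourier d (w'' \<tau>) \<xi> = F \<xi> \<tau> - of_real (a \<tau> * mu \<xi> + q \<tau>) * hfourier d (w \<tau>) \<xi>"
          using w4[OF \<xi>] by (rule AE_mp) (auto simp: F_def \<mu> algebra_simps)
        from has_integral_AE_cong[OF this w3[OF \<xi> t] t]
        show "((\<lambda>\<tau>. F \<xi> \<tau> - of_real (a \<tau> * mu \<xi> + r \<tau>) * hfourier d (w \<tau>) \<xi>)
            has_integral (hfourier d (w' t) \<xi> - hfourier d (w' 0) \<xi>)) {0..t}"
          by (rule integrand_swap_potential[OF qr _ t])
      qed
      then have "hfourier d (w t) \<xi> = y \<xi> t"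
        by (rule mode_unique[OF _ mode[OF \<xi>] _ _ t]) (use w5[OF \<xi>] y0[OF \<xi>] z0[OF \<xi>] in auto)
      then show ?thesis using v(2)[OF t \<xi>] by simp
    qed
    have L: "w t \<in> L2" "v t \<in> L2" using gevrey_L2[OF wG[OF t]] gevrey_L2[OF v(1)[OF t]] by auto
    have "AE x in lebesgue. w t x - v t x = 0"
      using coeff d L by (intro hfourier_injective[OF basis dual L2_diff[OF L]]) (simp add: hfourier_diff)
    then show ?thesis by (rule AE_mp) auto
  qed

  have classical: "classical_solution I d \<mu> T G a p f v\<^sub>0 v\<^sub>1 v"
    if p: "continuous_on {0..T} p" and pq: "AE t in lebesgue_on {0..T}. p t = q t" for p
  proof -
    have "bounded (p ` {0..T})"
      using compact_continuous_image[OF p compact_Icc] by (rule compact_imp_bounded)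
    then obtain P where P: "\<And>t. t \<in> {0..T} \<Longrightarrow> \<bar>p t\<bar> \<le> P"
      unfolding bounded_iff real_norm_def by blast
    have gpE: "wl2_le I (gweight lam s E) (\<lambda>\<xi>. g p \<xi> t) (Sf + (A1 + P) * Cm * S)" if "t \<in> {0..T}" for t
      by (rule gE[OF that, of p P]) (rule P[OF that])
    obtain vp where vp_props: "\<forall>t\<in>{0..T}. vp t \<in> gevrey I lam d s \<and> (\<forall>\<xi>\<in>I. hfourier d (vp t) \<xi> = g p \<xi> t)"
    using gevrey_synthesis[OF basis dual pos(2) gpE] ..
  then have vp: "\<And>t. t \<in> {0..T} \<Longrightarrow> vp t \<in> gevrey I lam d s"
    "\<And>t \<xi>. t \<in> {0..T} \<Longrightarrow> \<xi> \<in> I \<Longrightarrow> hfourier d (vp t) \<xi> = g p \<xi> t"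
    by simp_all
    have rp: "AE t in lebesgue_on {0..T}. r t = p t"
      using rq pq by eventually_elim simp
    have int_p: "(g p \<xi> has_integral (z \<xi> t - z \<xi> 0)) {0..t}" if "\<xi> \<in> I" "t \<in> {0..T}" for \<xi> t
      using int_z[OF that] unfolding g_def by (rule integrand_swap_potential[OF rp _ that(2)])
    have g_cont: "\<exists>\<delta>>0. \<forall>t'\<in>{0..T}. \<bar>t' - t\<bar> < \<delta> \<longrightarrow> wl2_le I (gweight lam s E) (\<lambda>\<xi>. g p \<xi> t' - g p \<xi> t) e"
      if t: "t \<in> {0..T}" and e: "e > 0" for t e
    proof -
      \<comment> \<open>\<open>h\<close> collects the contributions of the varying coefficients and of the varying \<open>y\<close>.\<close>
      define h where "h = (\<lambda>t'. (\<bar>a t' - a t\<bar> + \<bar>p t' - p t\<bar>) * Cm * S + (\<bar>a t\<bar> + \<bar>p t\<bar>) * Cm * (S * \<bar>t' - t\<bar>))"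
      obtain \<delta>1 where \<delta>1: "\<delta>1 > 0" "\<And>t'. t' \<in> {0..T} \<Longrightarrow> \<bar>t' - t\<bar> < \<delta>1 \<Longrightarrow>
          wl2_le I (gweight lam s E) (\<lambda>\<xi>. F \<xi> t' - F \<xi> t) (e/2)"
        using F_cont[OF t, of "e/2"] e by auto
      have "continuous_on {0..T} h"
        unfolding h_def by (intro continuous_intros p a_continuous)
      then obtain \<delta>2 where \<delta>2: "\<delta>2 > 0" "\<And>t'. t' \<in> {0..T} \<Longrightarrow> dist t' t < \<delta>2 \<Longrightarrow> dist (h t') (h t) < e/2"
        using t e unfolding continuous_on_iff by (meson half_gt_zero)
      show ?thesis
      proof (intro exI[of _ "min \<delta>1 \<delta>2"] conjI ballI impI)
        show "min \<delta>1 \<delta>2 > 0" using \<delta>1 \<delta>2 by simp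
        fix t' assume t': "t' \<in> {0..T}" "\<bar>t' - t\<bar> < min \<delta>1 \<delta>2"
        have "h t = 0" by (simp add: h_def)
        then have "h t' \<le> e/2" using \<delta>2(2)[of t'] t' by (auto simp: dist_real_def)
        have "wl2_le I (gweight lam s E) (\<lambda>\<xi>. (F \<xi> t' - F \<xi> t) -
            (of_real ((a t' - a t) * mu \<xi> + (p t' - p t)) * y \<xi> t' + of_real (a t * mu \<xi> + p t) * (y \<xi> t' - y \<xi> t)))
            (e/2 + h t')"
          unfolding h_def using t'
          by (intro wl2_le_diff wl2_le_add mult_mu yA y_lip \<delta>1(2) t gweight_nonneg) auto
        moreover have "(F \<xi> t' - F \<xi> t) -
            (of_real ((a t' - a t) * mu \<xi> + (p t' - p t)) * y \<xi> t' + of_real (a t * mu \<xi> + p t) * (y \<xi> t' - y \<xi> t))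
            = g p \<xi> t' - g p \<xi> t" for \<xi>
          by (simp add: g_def algebra_simps)
        ultimately have "wl2_le I (gweight lam s E) (\<lambda>\<xi>. g p \<xi> t' - g p \<xi> t) (e/2 + h t')" by simp
        then show "wl2_le I (gweight lam s E) (\<lambda>\<xi>. g p \<xi> t' - g p \<xi> t) e"
          by (rule wl2_le_mono) (use \<open>h t' \<le> e/2\<close> in simp)
      qed
    qed
    have vp_cont: "\<exists>\<delta>>0. \<forall>t'\<in>{0..T}. \<bar>t' - t\<bar> < \<delta> \<longrightarrow>
        wl2_le I (gweight lam s E) (\<lambda>\<xi>. hfourier d (vp t') \<xi> - hfourier d (vp t) \<xi>) e"
      if t: "t \<in> {0..T}" and e: "e > 0" for t e
    proof -
      have "wl2_le I (gweight lam s E) (\<lambda>\<xi>. hfourier d (vp t') \<xi> - hfourier d (vp t) \<xi>) e \<longleftrightarrow>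
          wl2_le I (gweight lam s E) (\<lambda>\<xi>. g p \<xi> t' - g p \<xi> t) e" if "t' \<in> {0..T}" for t'
        using that t vp(2) by (intro wl2_le_cong) auto
      then show ?thesis using g_cont[OF t e] by auto
    qed
    have tc_vp: "time_continuous T G vp"
      unfolding G_def using vp_cont by (intro time_continuous_gevreyI[OF d pos(2) vp(1)]) auto
    have deriv_v': "has_time_derivative T G v' vp"
      unfolding G_def
    proof (rule has_time_derivative_gevreyI[OF d pos(2) v'(1) vp(1)])
      fix \<xi> t assume "\<xi> \<in> I" "t \<in> {0..T}"
      then show "((\<lambda>\<tau>. hfourier d (vp \<tau>) \<xi>) has_integral hfourier d (v' t) \<xi> - hfourier d (v' 0) \<xi>) {0..t}"
        using int_p[of \<xi> t] v'(2) T0 vp(2) by (auto elim!: has_integral_eq[rotated])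
    qed (use vp_cont in auto)
    show ?thesis
      unfolding classical_solution_def
    proof (rule exI[of _ v'], rule exI[of _ vp], intro conjI ballI tc_v tc_v' tc_vp deriv_v deriv_v')
      fix \<xi> assume \<xi>: "\<xi> \<in> I"
      show "hfourier d (vp t) \<xi> + of_real (a t) * of_real (\<mu> \<xi>) * hfourier d (v t) \<xi>
             + of_real (p t) * hfourier d (v t) \<xi> = hfourier d (f t) \<xi>" if "t \<in> {0..T}" for t
        using v(2) vp(2) \<xi> that by (simp add: g_def F_def \<mu> algebra_simps)
      show "hfourier d (v 0) \<xi> = hfourier d v\<^sub>0 \<xi>" "hfourier d (v' 0) \<xi> = hfourier d v\<^sub>1 \<xi>"
        using v(2)[OF T0 \<xi>] v'(2)[OF T0 \<xi>] y0 z0 \<xi> by auto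
    qed
  qed
  from strong unique classical show ?thesis by blast
qed

end
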